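(* Assume that a vector field $A(x)\in H^2_{loc}(\mathbb{R}^3)$ decays at infinity sufficiently fast, for example, $A(x)\in H^2(\mathbb{R}^3,1+|x|^\gamma)$, $\gamma>2$. Let $g(x,y):=\frac{1}{4\pi|x-y|}$. Then, given $a:=\nabla\times A$ and $f:=\nabla\cdot A$ in $\mathbb{R}^3$, one can uniquely recover $A$ by the formula $$A(x)=\int_{\mathbb{R}^3}g(x,y)\,\nabla\times a(y)\,dy-\int_{\mathbb{R}^3}g(x,y)\,\nabla f(y)\,dy.$$ Moreover, one can uniquely represent $A(x)$ in the form $$A=\nabla u+B,\qquad \int_{\mathbb{R}^3}\nabla u\cdot B\,dx=0,$$ with a scalar field $u$ and a divergence-free vector field $B$, $\nabla\cdot B=0$, where $u$ and $B$ are uniquely defined by the formulas $$u(x)=-\int_{\mathbb{R}^3}g(x,y)f(y)\,dy,\qquad B(x)=\nabla\times\int_{\mathbb{R}^3}g(x,y)a(y)\,dy.$$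
   Context: $A$ is a vector field on $\mathbb{R}^3$ with three components. $H^2_{loc}(\mathbb{R}^3)$ is the usual local Sobolev space, and $H^2(\mathbb{R}^3,w(x))$ is the weighted Sobolev space with weight function $w=w(x)>0$ (here $w(x)=1+|x|^\gamma$). The symbols $\nabla\times$, $\nabla\cdot$ and $\nabla$ denote curl, divergence and gradient; inside the integrals of the first formula they act in the variable $y$, and the curl in front of the integral defining $B$ acts in $x$. Integrals of vector fields are taken componentwise. The phrase "decays at infinity sufficiently fast" is not made more precise in the theorem than by the example given. *)

theory Defs
  imports "HOL-Analysis.Analysis"
begin

definition partial_derivative :: "3 \<Rightarrow> (real^3 \<Rightarrow> real) \<Rightarrow> real^3 \<Rightarrow> real" where
  "partial_derivative i \<phi> x = frechet_derivative \<phi> (at x) (axis i 1)"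

definition nabla :: "(real^3 \<Rightarrow> real) \<Rightarrow> real^3 \<Rightarrow> real^3" where
  "nabla \<phi> x = (\<chi> i. partial_derivative i \<phi> x)"

text \<open>All iterated partial derivatives, of every order, are (totally) differentiable everywhere;
  this is the class of infinitely differentiable functions.\<close>

definition smooth :: "(real^3 \<Rightarrow> real) \<Rightarrow> bool" where
  "smooth \<phi> \<longleftrightarrow> (\<forall>is. fold partial_derivative is \<phi> differentiable_on UNIV)"

definition test_function :: "(real^3 \<Rightarrow> real) \<Rightarrow> bool" where
  "test_function \<phi> \<longleftrightarrow> smooth \<phi> \<and> bounded {x. \<phi> x \<noteq> 0}"

definition locally_integrable :: "(real^3 \<Rightarrow> 'b::euclidean_space) \<Rightarrow> bool" where
  "locally_integrable F \<longleftrightarrow> (\<forall>K. compact K \<longrightarrow> F absolutely_integrable_on K)"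

text \<open>Weak (distributional) derivatives, as relations between functions that are determined only
  up to null sets. Each definition is the integration by parts identity against a test function;
  for the curl it comes from \<open>curl (\<phi> F) = \<phi> curl F + nabla \<phi> \<times> F\<close>.\<close>

definition has_weak_partial ::
    "3 \<Rightarrow> (real^3 \<Rightarrow> 'b::euclidean_space) \<Rightarrow> (real^3 \<Rightarrow> 'b) \<Rightarrow> bool" where
  "has_weak_partial i F D \<longleftrightarrow> locally_integrable F \<and> locally_integrable D \<and>
     (\<forall>\<phi>. test_function \<phi> \<longrightarrow>
        (LINT x|lebesgue. \<phi> x *\<^sub>R D x) = - (LINT x|lebesgue. partial_derivative i \<phi> x *\<^sub>R F x))"

definition has_weak_gradient :: "(real^3 \<Rightarrow> real) \<Rightarrow> (real^3 \<Rightarrow> real^3) \<Rightarrow> bool" where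
  "has_weak_gradient u G \<longleftrightarrow> locally_integrable u \<and> locally_integrable G \<and>
     (\<forall>\<phi>. test_function \<phi> \<longrightarrow>
        (LINT x|lebesgue. \<phi> x *\<^sub>R G x) = - (LINT x|lebesgue. u x *\<^sub>R nabla \<phi> x))"

definition has_weak_divergence :: "(real^3 \<Rightarrow> real^3) \<Rightarrow> (real^3 \<Rightarrow> real) \<Rightarrow> bool" where
  "has_weak_divergence F f \<longleftrightarrow> locally_integrable F \<and> locally_integrable f \<and>
     (\<forall>\<phi>. test_function \<phi> \<longrightarrow>
        (LINT x|lebesgue. \<phi> x * f x) = - (LINT x|lebesgue. nabla \<phi> x \<bullet> F x))"

definition has_weak_curl :: "(real^3 \<Rightarrow> real^3) \<Rightarrow> (real^3 \<Rightarrow> real^3) \<Rightarrow> bool" where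
  "has_weak_curl F C \<longleftrightarrow> locally_integrable F \<and> locally_integrable C \<and>
     (\<forall>\<phi>. test_function \<phi> \<longrightarrow>
        (LINT x|lebesgue. \<phi> x *\<^sub>R C x) = - (LINT x|lebesgue. cross3 (nabla \<phi> x) (F x)))"

definition L2_loc :: "(real^3 \<Rightarrow> 'b::euclidean_space) set" where
  "L2_loc = {F. F \<in> borel_measurable lebesgue \<and>
     (\<forall>K. compact K \<longrightarrow> (\<lambda>x. (norm (F x))\<^sup>2) absolutely_integrable_on K)}"

definition L2_weighted :: "(real^3 \<Rightarrow> real) \<Rightarrow> (real^3 \<Rightarrow> 'b::euclidean_space) set" where
  "L2_weighted w = {F. F \<in> borel_measurable lebesgue \<and>
     integrable lebesgue (\<lambda>x. w x * (norm (F x))\<^sup>2)}"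

text \<open>The functions in \<open>X\<close> whose weak derivatives of orders one and two exist and are in \<open>X\<close>.\<close>

definition sobolev2 ::
    "(real^3 \<Rightarrow> 'b::euclidean_space) set \<Rightarrow> (real^3 \<Rightarrow> 'b) set" where
  "sobolev2 X = {F \<in> X. \<exists>D D2. \<forall>i.
     has_weak_partial i F (D i) \<and> D i \<in> X \<and>
     (\<forall>j. has_weak_partial j (D i) (D2 i j) \<and> D2 i j \<in> X)}"

definition H2_loc :: "(real^3 \<Rightarrow> 'b::euclidean_space) set" where
  "H2_loc = sobolev2 L2_loc"

definition H2_weighted :: "(real^3 \<Rightarrow> real) \<Rightarrow> (real^3 \<Rightarrow> 'b::euclidean_space) set" where
  "H2_weighted w = sobolev2 (L2_weighted w)"

text \<open>The value at \<open>x = y\<close> is \<open>0\<close> here, which is irrelevant under the integral sign.\<close>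

definition newton_kernel :: "real^3 \<Rightarrow> real^3 \<Rightarrow> real" where
  "newton_kernel x y = 1 / (4 * pi * norm (x - y))"

text \<open>\<open>A = \<nabla>u + B\<close> almost everywhere, where \<open>G\<close> is the weak gradient of \<open>u\<close>, with \<open>B\<close>
  divergence-free and orthogonal to \<open>G\<close>. Integrability of \<open>G \<bullet> B\<close> is required explicitly because
  the integral of a non-integrable function is \<open>0\<close> by convention.\<close>

definition helmholtz_decomposition ::
    "(real^3 \<Rightarrow> real^3) \<Rightarrow> (real^3 \<Rightarrow> real) \<Rightarrow> (real^3 \<Rightarrow> real^3) \<Rightarrow> (real^3 \<Rightarrow> real^3) \<Rightarrow> bool" where
  "helmholtz_decomposition A u G B \<longleftrightarrow>
     has_weak_gradient u G \<and> has_weak_divergence B (\<lambda>_. 0) \<and>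
     (AE x in lebesgue. A x = G x + B x) \<and>
     integrable lebesgue (\<lambda>x. G x \<bullet> B x) \<and> (LINT x|lebesgue. G x \<bullet> B x) = 0"

text \<open>The potential in a decomposition is determined only up to an additive constant; this
  condition, insensitive to null sets, fixes the constant.\<close>

definition vanishes_at_infinity :: "(real^3 \<Rightarrow> real) \<Rightarrow> bool" where
  "vanishes_at_infinity u \<longleftrightarrow>
     (\<forall>\<epsilon>>0. \<exists>R. AE x in lebesgue. norm x \<ge> R \<longrightarrow> \<bar>u x\<bar> < \<epsilon>)"

end

(*
Everything is done by duality with test functions. For a test function \<phi> the potential pot \<phi> = g * \<phi> is smooth, solves
- Laplace (pot \<phi>) = \<phi>, and satisfies |pot \<phi>| = O(1 / |x|), |grad (pot \<phi>)| = O(1 / |x|^2). By a cut-off, it may therefore be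
inserted in place of a test function in the weak derivative identities of square-integrable fields. Since
- Laplace = curl curl - grad div, this gives the integral of \<phi> A, hence the formula for A, and also shows that a
square-integrable field with zero curl and zero divergence is zero, which yields uniqueness of the decomposition.
The fields grad u and B = curl V are given by the kernel grad g, of size 1 / |x - y|^2; by Schur's test with power weights this
kernel maps L^2(|y|^2 dy) into L^2, which is where \<gamma> > 2 enters. As grad g is odd, Fubini turns the integral of grad u . B into
an integral of f against grad g * B, and the latter vanishes because B is divergence-free.
*)
theory Submission
  imports Defs
begin

section \<open>Smooth functions and their partial derivatives\<close>

text \<open>The data are weak derivatives, determined only up to null sets, so every identity
  between fields is reduced to their pairings with test functions. What shapes the estimates is
  which decay may be paired with which field: \<open>1 / |x|\<close> needs the weight,
  \<open>1 / |x|^2\<close> only square-integrability. In the cut-off for a square-integrable field,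
  the gradient of the cut-off function supplies the missing factor \<open>1 / |x|\<close>.

  In Schur's test any power \<open>s\<close> with \<open>2 < s < 3\<close> would serve in place of
  \<open>5 / 2\<close>: integrating \<open>|y|^(-s) |x - y|^(-2)\<close> needs
  \<open>1 < s < 3\<close> and leaves \<open>|x|^(1 - s)\<close>, the second integration needs the
  same of \<open>s - 1\<close> and leaves \<open>|y|^(2 - s)\<close>, and
  \<open>s + (2 - s) = 2\<close> is the power in the weight.

  A competing decomposition is only known to have an integrable product
  \<open>G' \<bullet> B'\<close>. This already makes \<open>G'\<close> square-integrable, because
  \<open>|A|^2 = |G'|^2 + |B'|^2 + 2 G' \<bullet> B'\<close>.

  The singularity of the kernel is not cut out by small spheres but smoothed: \<open>|z|\<close> is
  replaced by \<open>sqrt (|z|^2 + e^2)\<close>, and \<open>e\<close> tends to 0.\<close>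

lemma partial_derivative_eq:
  assumes "(\<phi> has_derivative D) (at x)"
  shows "partial_derivative i \<phi> x = D (axis i 1)"
  using frechet_derivative_at[OF assms] by (simp add: partial_derivative_def)

lemma nabla_inner_axis [simp]: "nabla \<phi> x \<bullet> axis i 1 = partial_derivative i \<phi> x"
  by (simp add: nabla_def inner_axis)

lemma nabla_nth [simp]: "nabla \<phi> x $ i = partial_derivative i \<phi> x"
  by (simp add: nabla_def)

lemma differentiable_has_nabla:
  assumes "\<phi> differentiable (at x)"
  shows "(\<phi> has_derivative (\<lambda>h. nabla \<phi> x \<bullet> h)) (at x)"
proof -
  obtain D where D: "(\<phi> has_derivative D) (at x)"
    using assms by (auto simp: differentiable_def)
  then have lin: "linear D" using has_derivative_linear by blast
  have "D h = nabla \<phi> x \<bullet> h" for h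
  proof -
    have "D h = D (\<Sum>i\<in>UNIV. h $ i *\<^sub>R axis i 1)"
      by (simp add: basis_expansion scalar_mult_eq_scaleR[symmetric])
    also have "\<dots> = (\<Sum>i\<in>UNIV. h $ i *\<^sub>R D (axis i 1))"
      by (simp add: linear_sum[OF lin] linear_scale[OF lin])
    also have "\<dots> = nabla \<phi> x \<bullet> h"
      by (simp add: inner_vec_def partial_derivative_eq[OF D] mult.commute)
    finally show ?thesis .
  qed
  then have "D = (\<lambda>h. nabla \<phi> x \<bullet> h)" by auto
  then show ?thesis using D by simp
qed

lemma smooth_differentiable: "smooth \<phi> \<Longrightarrow> \<phi> differentiable (at x)"
  by (force simp: smooth_def differentiable_on_def dest: spec[of _ "[]"])

lemma smooth_partial: "smooth \<phi> \<Longrightarrow> smooth (partial_derivative i \<phi>)"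
  unfolding smooth_def by (metis fold_simps(2))

text \<open>A class of differentiable functions that is closed under partial derivatives contains
  all iterated derivatives of its members. With a suitable class, no later proof of smoothness has
  to induct over lists of indices.\<close>

lemma smooth_coinduct:
  assumes "P \<phi>"
    and "\<And>\<phi> x. P \<phi> \<Longrightarrow> \<phi> differentiable (at x)"
    and "\<And>\<phi> i. P \<phi> \<Longrightarrow> P (partial_derivative i \<phi>)"
  shows "smooth \<phi>"
proof -
  have "P \<phi> \<Longrightarrow> P (fold partial_derivative is \<phi>)" for "is" \<phi>
    by (induction "is" arbitrary: \<phi>) (auto simp: assms(3))
  then show ?thesis
    using assms(1,2) by (auto simp: smooth_def differentiable_on_def)
qed

lemma smooth_has_nabla: "smooth \<phi> \<Longrightarrow> (\<phi> has_derivative (\<lambda>h. nabla \<phi> x \<bullet> h)) (at x)"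
  by (intro differentiable_has_nabla smooth_differentiable)

lemma has_real_derivative_line:
  assumes "\<And>x. \<phi> differentiable (at x)"
  shows "((\<lambda>s. \<phi> (x + s *\<^sub>R v)) has_real_derivative nabla \<phi> (x + s *\<^sub>R v) \<bullet> v) (at s)"
proof -
  have "((\<lambda>s. \<phi> (x + s *\<^sub>R v)) has_derivative (\<lambda>r. nabla \<phi> (x + s *\<^sub>R v) \<bullet> (r *\<^sub>R v))) (at s)"
    by (rule has_derivative_compose[where f = "\<lambda>s. x + s *\<^sub>R v", OF _ differentiable_has_nabla[OF assms]])
      (auto intro!: derivative_eq_intros)
  then show ?thesis
    by (simp add: has_field_derivative_def mult_commute_abs inner_scaleR_right)
qed

lemma smooth_continuous: "smooth \<phi> \<Longrightarrow> continuous_on S \<phi>"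
  by (meson continuous_at_imp_continuous_on differentiable_imp_continuous_within smooth_differentiable)

text \<open>The product and chain rules lead out of any class of plain products or compositions, so
  the class for the coinduction is closed under all the operations at once. In \<open>comp\<close>
  the outer function is a member of a sequence \<open>h\<close> of successive derivatives;
  differentiating moves to the next member, and no notion of smoothness on the reals is
  needed.\<close>

inductive smooth_closure :: "(real^3 \<Rightarrow> real) \<Rightarrow> bool" where
  base: "smooth \<phi> \<Longrightarrow> smooth_closure \<phi>"
| add: "smooth_closure \<phi> \<Longrightarrow> smooth_closure \<psi> \<Longrightarrow> smooth_closure (\<lambda>x. \<phi> x + \<psi> x)"
| mult: "smooth_closure \<phi> \<Longrightarrow> smooth_closure \<psi> \<Longrightarrow> smooth_closure (\<lambda>x. \<phi> x * \<psi> x)"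
| comp: "smooth_closure \<phi> \<Longrightarrow> (\<And>k t. (h k has_field_derivative h (Suc k) t) (at t)) \<Longrightarrow>
    smooth_closure (\<lambda>x. h (k::nat) (\<phi> x))"

lemma partial_derivative_add:
  assumes "\<phi> differentiable (at x)" "\<psi> differentiable (at x)"
  shows "partial_derivative i (\<lambda>x. \<phi> x + \<psi> x) x = partial_derivative i \<phi> x + partial_derivative i \<psi> x"
  by (subst partial_derivative_eq[OF has_derivative_add[OF assms[THEN differentiable_has_nabla]]]) simp

lemma partial_derivative_mult:
  assumes "\<phi> differentiable (at x)" "\<psi> differentiable (at x)"
  shows "partial_derivative i (\<lambda>x. \<phi> x * \<psi> x) x =
    \<phi> x * partial_derivative i \<psi> x + partial_derivative i \<phi> x * \<psi> x"
  by (subst partial_derivative_eq[OF has_derivative_mult[OF assms[THEN differentiable_has_nabla]]]) simp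

lemma partial_derivative_comp:
  assumes "\<phi> differentiable (at x)" "(h has_field_derivative d) (at (\<phi> x))"
  shows "((\<lambda>x. h (\<phi> x)) has_derivative (\<lambda>y. d * (nabla \<phi> x \<bullet> y))) (at x)"
    and "partial_derivative i (\<lambda>x. h (\<phi> x)) x = d * partial_derivative i \<phi> x"
proof -
  show *: "((\<lambda>x. h (\<phi> x)) has_derivative (\<lambda>y. d * (nabla \<phi> x \<bullet> y))) (at x)"
    using has_derivative_compose[OF differentiable_has_nabla[OF assms(1)]
        assms(2)[unfolded has_field_derivative_def]] by simp
  show "partial_derivative i (\<lambda>x. h (\<phi> x)) x = d * partial_derivative i \<phi> x"
    by (subst partial_derivative_eq[OF *]) simp
qed

lemma smooth_closure_differentiable: "smooth_closure \<phi> \<Longrightarrow> \<phi> differentiable (at x)"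
proof (induction rule: smooth_closure.induct)
  case (comp \<phi> h k)
  show ?case
    using partial_derivative_comp(1)[OF comp.IH comp.hyps(2)] unfolding differentiable_def by blast
qed (auto intro: smooth_differentiable)

lemma smooth_closure_partial: "smooth_closure \<phi> \<Longrightarrow> smooth_closure (partial_derivative i \<phi>)"
proof (induction rule: smooth_closure.induct)
  case (base \<phi>)
  then show ?case by (intro smooth_closure.base smooth_partial)
next
  case (add \<phi> \<psi>)
  have "partial_derivative i (\<lambda>x. \<phi> x + \<psi> x) =
      (\<lambda>x. partial_derivative i \<phi> x + partial_derivative i \<psi> x)"
    using add by (auto intro!: ext partial_derivative_add smooth_closure_differentiable)
  then show ?case using smooth_closure.add[OF add(3,4)] by simp
next
  case (mult \<phi> \<psi>)
  have "partial_derivative i (\<lambda>x. \<phi> x * \<psi> x) =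
      (\<lambda>x. \<phi> x * partial_derivative i \<psi> x + partial_derivative i \<phi> x * \<psi> x)"
    using mult by (auto intro!: ext partial_derivative_mult smooth_closure_differentiable)
  then show ?case using mult by (auto intro!: smooth_closure.add smooth_closure.mult)
next
  case (comp \<phi> h k)
  have "partial_derivative i (\<lambda>x. h k (\<phi> x)) =
      (\<lambda>x. h (Suc k) (\<phi> x) * partial_derivative i \<phi> x)"
    using comp by (auto intro!: ext partial_derivative_comp(2) smooth_closure_differentiable)
  then show ?case
    using smooth_closure.mult[OF smooth_closure.comp[where h = h and k = "Suc k", OF comp.hyps(1)] comp.IH]
      comp.hyps(2) by simp
qed

lemma smooth_closure_smooth: "smooth_closure \<phi> \<Longrightarrow> smooth \<phi>"
  using smooth_coinduct[of smooth_closure] smooth_closure_differentiable smooth_closure_partial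
  by blast

lemma smooth_add: "smooth \<phi> \<Longrightarrow> smooth \<psi> \<Longrightarrow> smooth (\<lambda>x. \<phi> x + \<psi> x)"
  and smooth_mult: "smooth \<phi> \<Longrightarrow> smooth \<psi> \<Longrightarrow> smooth (\<lambda>x. \<phi> x * \<psi> x)"
  by (rule smooth_closure_smooth, auto intro: smooth_closure.base smooth_closure.add smooth_closure.mult)+

lemma smooth_comp:
  assumes "smooth \<phi>" "\<And>k t. (h k has_field_derivative h (Suc k) t) (at t)"
  shows "smooth (\<lambda>x. h k (\<phi> x))"
  using smooth_closure_smooth[OF smooth_closure.comp[OF smooth_closure.base[OF assms(1)], of h k]] assms(2)
  by blast

section \<open>Constants, coordinates, sums and affine substitutions\<close>

lemma partial_derivative_const [simp]: "partial_derivative i (\<lambda>x. c) = (\<lambda>x. 0)"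
  by (rule ext, subst partial_derivative_eq[OF has_derivative_const]) simp

lemma smooth_const [simp]: "smooth (\<lambda>x. c)"
  by (rule smooth_coinduct[where P = "\<lambda>\<phi>. \<exists>c. \<phi> = (\<lambda>x. c)"]) auto

lemma partial_derivative_coordinate:
  "partial_derivative i (\<lambda>x. x $ j) = (\<lambda>x. if i = j then 1 else 0)"
  by (rule ext, subst partial_derivative_eq[OF bounded_linear_imp_has_derivative])
    (auto simp: axis_def bounded_linear_vec_nth)

lemma smooth_coordinate: "smooth (\<lambda>x. x $ j)"
proof (rule smooth_coinduct[where P = "\<lambda>\<phi>. smooth \<phi> \<or> \<phi> = (\<lambda>x. x $ j)"])
  show "smooth (partial_derivative i \<phi>) \<or> partial_derivative i \<phi> = (\<lambda>x. x $ j)"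
    if "smooth \<phi> \<or> \<phi> = (\<lambda>x. x $ j)" for i \<phi>
    using that by (auto intro: smooth_partial simp: partial_derivative_coordinate)
  show "\<phi> differentiable (at x)" if "smooth \<phi> \<or> \<phi> = (\<lambda>x. x $ j)" for \<phi> x
    using that by (auto intro: smooth_differentiable bounded_linear_imp_differentiable
        simp: bounded_linear_vec_nth)
qed simp

lemma partial_derivative_cmult:
  assumes "\<phi> differentiable (at x)"
  shows "partial_derivative i (\<lambda>x. c * \<phi> x) x = c * partial_derivative i \<phi> x"
  using partial_derivative_mult[OF _ assms, of "\<lambda>x. c"] by simp

lemma smooth_cmult: "smooth \<phi> \<Longrightarrow> smooth (\<lambda>x. c * \<phi> x)"
  by (intro smooth_mult smooth_const)

lemma smooth_sum: "(\<And>i. i \<in> I \<Longrightarrow> smooth (\<phi> i)) \<Longrightarrow> smooth (\<lambda>x. \<Sum>i\<in>I. \<phi> i x)"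
  proof (induction I rule: infinite_finite_induct)
  case (insert j I)
  then show ?case using smooth_add[of "\<phi> j" "\<lambda>x. \<Sum>i\<in>I. \<phi> i x"] by simp
qed simp_all

lemma partial_derivative_affine:
  assumes "\<And>x. \<phi> differentiable (at x)"
  shows "partial_derivative i (\<lambda>x. \<phi> (c *\<^sub>R x + b)) = (\<lambda>x. c * partial_derivative i \<phi> (c *\<^sub>R x + b))"
    and "(\<lambda>x. \<phi> (c *\<^sub>R x + b)) differentiable (at x)"
proof -
  have *: "((\<lambda>x. \<phi> (c *\<^sub>R x + b)) has_derivative (\<lambda>h. nabla \<phi> (c *\<^sub>R x + b) \<bullet> (c *\<^sub>R h))) (at x)" for x
    by (rule has_derivative_compose[where f = "\<lambda>x. c *\<^sub>R x + b", OF _ differentiable_has_nabla[OF assms]])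
      (auto intro!: derivative_eq_intros)
  show "partial_derivative i (\<lambda>x. \<phi> (c *\<^sub>R x + b)) = (\<lambda>x. c * partial_derivative i \<phi> (c *\<^sub>R x + b))"
    by (rule ext, subst partial_derivative_eq[OF *]) (simp add: inner_scaleR_right)
  show "(\<lambda>x. \<phi> (c *\<^sub>R x + b)) differentiable (at x)"
    using * unfolding differentiable_def by blast
qed

lemma smooth_affine:
  assumes "smooth \<phi>"
  shows "smooth (\<lambda>x. \<phi> (c *\<^sub>R x + b))"
\<comment> \<open>Every derivative brings out a factor \<open>c\<close>; the invariant collects
  these factors in \<open>d\<close>.\<close>
proof (rule smooth_coinduct[where
      P = "\<lambda>\<eta>. \<exists>\<phi> d. smooth \<phi> \<and> \<eta> = (\<lambda>x. d * \<phi> (c *\<^sub>R x + b))"])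
  show "\<exists>\<psi> d. smooth \<psi> \<and> (\<lambda>x. \<phi> (c *\<^sub>R x + b)) = (\<lambda>x. d * \<psi> (c *\<^sub>R x + b))"
    using assms by (intro exI[of _ \<phi>] exI[of _ 1]) auto
next
  fix \<eta> x assume "\<exists>\<phi> d. smooth \<phi> \<and> \<eta> = (\<lambda>x. d * \<phi> (c *\<^sub>R x + b))"
  then show "\<eta> differentiable (at x)"
    using partial_derivative_affine(2)[OF smooth_differentiable]
    by (auto intro!: differentiable_mult)
next
  fix \<eta> i assume "\<exists>\<phi> d. smooth \<phi> \<and> \<eta> = (\<lambda>x. d * \<phi> (c *\<^sub>R x + b))"
  then obtain \<phi> d where \<phi>: "smooth \<phi>" "\<eta> = (\<lambda>x. d * \<phi> (c *\<^sub>R x + b))" by blast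
  have "partial_derivative i \<eta> = (\<lambda>x. (d * c) * partial_derivative i \<phi> (c *\<^sub>R x + b))"
    unfolding \<phi>(2)
    by (rule ext, subst partial_derivative_cmult)
      (auto simp: partial_derivative_affine \<phi>(1) smooth_differentiable)
  then show "\<exists>\<phi> d. smooth \<phi> \<and> partial_derivative i \<eta> = (\<lambda>x. d * \<phi> (c *\<^sub>R x + b))"
    using \<phi>(1) smooth_partial by blast
qed

text \<open>Both orders of differentiation are limits of the same second difference quotient.\<close>

lemma partial_derivative_commute:
  assumes "smooth \<phi>"
  shows "partial_derivative i (partial_derivative j \<phi>) = partial_derivative j (partial_derivative i \<phi>)"
proof -
  have second_difference:
    "\<exists>s t. 0 < s \<and> s < e \<and> 0 < t \<and> t < e \<and>
       \<phi> (x + e *\<^sub>R axis i 1 + e *\<^sub>R axis j 1) - \<phi> (x + e *\<^sub>R axis i 1) - \<phi> (x + e *\<^sub>R axis j 1) + \<phi> x =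
       e * e * partial_derivative j (partial_derivative i \<phi>) (x + s *\<^sub>R axis i 1 + t *\<^sub>R axis j 1)"
    if "0 < e" for e x i j
  proof -
    \<comment> \<open>The second difference is a difference in direction \<open>i\<close> of the
      difference \<open>g\<close> in direction \<open>j\<close>; the mean value theorem is applied
      first in direction \<open>i\<close>, then in direction \<open>j\<close>.\<close>
    define g where "g s = \<phi> (x + s *\<^sub>R axis i 1 + e *\<^sub>R axis j 1) - \<phi> (x + s *\<^sub>R axis i 1)" for s
    have line: "((\<lambda>s. \<psi> (y + s *\<^sub>R axis k 1)) has_real_derivative
        partial_derivative k \<psi> (y + s *\<^sub>R axis k 1)) (at s)" if "smooth \<psi>" for \<psi> y k s
      using has_real_derivative_line[OF smooth_differentiable[OF that], of y "axis k 1" s] by simp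
    have g': "(g has_real_derivative partial_derivative i \<phi> (x + s *\<^sub>R axis i 1 + e *\<^sub>R axis j 1)
        - partial_derivative i \<phi> (x + s *\<^sub>R axis i 1)) (at s)" for s
      unfolding g_def
      using line[OF assms, of "x + e *\<^sub>R axis j 1" i s] line[OF assms, of x i s]
      by (intro DERIV_diff) (simp_all add: add_ac)
    obtain s where s: "0 < s" "s < e" "g e - g 0 = (e - 0) * (partial_derivative i \<phi> (x + s *\<^sub>R axis i 1 + e *\<^sub>R axis j 1)
        - partial_derivative i \<phi> (x + s *\<^sub>R axis i 1))"
      using MVT2[OF \<open>0 < e\<close>, of g, OF g'] by blast
    obtain t where t: "0 < t" "t < e" "partial_derivative i \<phi> (x + s *\<^sub>R axis i 1 + e *\<^sub>R axis j 1)
        - partial_derivative i \<phi> (x + s *\<^sub>R axis i 1 + 0 *\<^sub>R axis j 1) =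
        (e - 0) * partial_derivative j (partial_derivative i \<phi>) (x + s *\<^sub>R axis i 1 + t *\<^sub>R axis j 1)"
      using MVT2[OF \<open>0 < e\<close>, of "\<lambda>t. partial_derivative i \<phi> (x + s *\<^sub>R axis i 1 + t *\<^sub>R axis j 1)",
          OF line[OF smooth_partial[OF assms]]] by blast
    show ?thesis
      using s t by (intro exI[of _ s] exI[of _ t]) (simp add: g_def)
  qed
  show ?thesis
  proof
    fix x
    let ?ij = "partial_derivative i (partial_derivative j \<phi>)"
    let ?ji = "partial_derivative j (partial_derivative i \<phi>)"
    have cont: "isCont ?ij x" "isCont ?ji x"
      by (intro differentiable_imp_continuous_within smooth_differentiable smooth_partial assms)+
    have "\<bar>?ij x - ?ji x\<bar> \<le> 0 + \<epsilon>" if "\<epsilon> > 0" for \<epsilon>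
    proof -
      obtain d1 where d1: "d1 > 0" "\<And>y. dist y x < d1 \<Longrightarrow> dist (?ij y) (?ij x) < \<epsilon> / 2"
        using cont(1) \<open>\<epsilon> > 0\<close> unfolding continuous_at_eps_delta by (meson half_gt_zero)
      obtain d2 where d2: "d2 > 0" "\<And>y. dist y x < d2 \<Longrightarrow> dist (?ji y) (?ji x) < \<epsilon> / 2"
        using cont(2) \<open>\<epsilon> > 0\<close> unfolding continuous_at_eps_delta by (meson half_gt_zero)
      \<comment> \<open>The intermediate points lie within \<open>2 * e\<close> of \<open>x\<close>,
        hence within both radii of continuity.\<close>
      define e where "e = min d1 d2 / 2"
      have e: "0 < e" "2 * e \<le> d1" "2 * e \<le> d2" using d1 d2 by (auto simp: e_def)
      have near: "dist (x + s *\<^sub>R axis k 1 + t *\<^sub>R axis l 1) x < 2 * e"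
        if "0 < s" "s < e" "0 < t" "t < e" for s t and k l :: 3
        using norm_triangle_ineq[of "s *\<^sub>R axis k (1::real)" "t *\<^sub>R axis l 1"] that
        by (simp add: dist_norm norm_axis_1 add.assoc)
      obtain s t where st: "0 < s" "s < e" "0 < t" "t < e"
        "\<phi> (x + e *\<^sub>R axis i 1 + e *\<^sub>R axis j 1) - \<phi> (x + e *\<^sub>R axis i 1) - \<phi> (x + e *\<^sub>R axis j 1) + \<phi> x =
         e * e * ?ji (x + s *\<^sub>R axis i 1 + t *\<^sub>R axis j 1)"
        using second_difference[OF e(1), of x i j] by blast
      obtain s' t' where st': "0 < s'" "s' < e" "0 < t'" "t' < e"
        "\<phi> (x + e *\<^sub>R axis j 1 + e *\<^sub>R axis i 1) - \<phi> (x + e *\<^sub>R axis j 1) - \<phi> (x + e *\<^sub>R axis i 1) + \<phi> x =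
         e * e * ?ij (x + s' *\<^sub>R axis j 1 + t' *\<^sub>R axis i 1)"
        using second_difference[OF e(1), of x j i] by blast
      have "x + e *\<^sub>R axis i 1 + e *\<^sub>R axis j 1 = x + e *\<^sub>R axis j 1 + e *\<^sub>R axis i 1"
        by (simp add: add_ac)
      then have "e * e * ?ji (x + s *\<^sub>R axis i 1 + t *\<^sub>R axis j 1) = e * e * ?ij (x + s' *\<^sub>R axis j 1 + t' *\<^sub>R axis i 1)"
        using st(5) st'(5) by (simp only:)
      then have "?ji (x + s *\<^sub>R axis i 1 + t *\<^sub>R axis j 1) = ?ij (x + s' *\<^sub>R axis j 1 + t' *\<^sub>R axis i 1)"
        using e(1) by simp
      moreover have "dist (?ji (x + s *\<^sub>R axis i 1 + t *\<^sub>R axis j 1)) (?ji x) < \<epsilon> / 2"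
        using near[OF st(1-4), of i j] e by (intro d2) simp
      moreover have "dist (?ij (x + s' *\<^sub>R axis j 1 + t' *\<^sub>R axis i 1)) (?ij x) < \<epsilon> / 2"
        using near[OF st'(1-4), of j i] e by (intro d1) simp
      ultimately show ?thesis unfolding dist_real_def by linarith
    qed
    then have "\<bar>?ij x - ?ji x\<bar> \<le> 0" by (rule field_le_epsilon)
    then show "?ij x = ?ji x" by simp
  qed
qed

section \<open>Test functions and the fundamental lemma\<close>

lemma test_function_smooth: "test_function \<phi> \<Longrightarrow> smooth \<phi>"
  by (simp add: test_function_def)

text \<open>Off the closure the function is 0 on an open set, so its derivative is 0 there. The
  closure cannot be replaced by the set itself, since a derivative may be nonzero at a zero of the
  function.\<close>

lemma partial_derivative_support:
  assumes "smooth \<phi>" "partial_derivative i \<phi> x \<noteq> 0"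
  shows "x \<in> closure {x. \<phi> x \<noteq> 0}"
proof (rule ccontr)
  let ?S = "closure {x. \<phi> x \<noteq> 0}"
  assume x: "x \<notin> ?S"
  have "((\<lambda>x. 0) has_derivative (\<lambda>h. nabla \<phi> x \<bullet> h)) (at x)"
  proof (rule has_derivative_transform_within_open[OF smooth_has_nabla[OF assms(1)]])
    show "open (- ?S)" "x \<in> - ?S" using x by auto
    show "\<phi> y = 0" if "y \<in> - ?S" for y using that closure_subset[of "{x. \<phi> x \<noteq> 0}"] by blast
  qed
  from has_derivative_unique[OF this has_derivative_const] assms(2)
  show False by (metis nabla_inner_axis)
qed

lemma test_function_partial:
  assumes "test_function \<phi>"
  shows "test_function (partial_derivative i \<phi>)"
proof -
  have "{x. partial_derivative i \<phi> x \<noteq> 0} \<subseteq> closure {x. \<phi> x \<noteq> 0}"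
    using partial_derivative_support[OF test_function_smooth[OF assms]] by blast
  then show ?thesis
    using assms bounded_subset[OF bounded_closure] smooth_partial
    by (auto simp: test_function_def)
qed

lemma test_function_mult:
  assumes "test_function \<phi>" "smooth \<psi>"
  shows "test_function (\<lambda>x. \<phi> x * \<psi> x)"
  using assms by (auto simp: test_function_def intro: smooth_mult elim: bounded_subset)

lemma test_function_cmult: "test_function \<phi> \<Longrightarrow> test_function (\<lambda>x. c * \<phi> x)"
  using test_function_mult[of \<phi> "\<lambda>x. c"] by (simp add: mult.commute)

lemma test_function_affine:
  assumes "test_function \<phi>" "c \<noteq> 0"
  shows "test_function (\<lambda>x. \<phi> (c *\<^sub>R x + b))"
proof -
  obtain M where M: "\<And>x. \<phi> x \<noteq> 0 \<Longrightarrow> norm x \<le> M"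
    using assms(1) by (auto simp: test_function_def bounded_iff)
  have "norm x \<le> (M + norm b) / \<bar>c\<bar>" if "\<phi> (c *\<^sub>R x + b) \<noteq> 0" for x
  proof -
    have "\<bar>c\<bar> * norm x = norm (c *\<^sub>R x + b - b)" by simp
    also have "\<dots> \<le> M + norm b" using M[OF that] norm_triangle_ineq4[of "c *\<^sub>R x + b" b] by linarith
    finally show ?thesis using assms(2) by (simp add: field_simps)
  qed
  then have "bounded {x. \<phi> (c *\<^sub>R x + b) \<noteq> 0}" by (auto simp: bounded_iff)
  then show ?thesis using assms smooth_affine by (auto simp: test_function_def)
qed

lemma smooth_borel: "smooth \<phi> \<Longrightarrow> \<phi> \<in> borel_measurable borel"
  by (intro borel_measurable_continuous_onI smooth_continuous)

lemma continuous_cball_bound: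
  fixes f :: "real^3 \<Rightarrow> real"
  assumes "continuous_on UNIV f"
  obtains C where "C > 0" "\<And>x. norm x \<le> M \<Longrightarrow> \<bar>f x\<bar> \<le> C"
proof -
  have "compact (f ` cball 0 M)"
    using assms by (intro compact_continuous_image) (auto elim: continuous_on_subset)
  then obtain C where "\<forall>y\<in>f ` cball 0 M. norm y \<le> C"
    by (meson bounded_iff compact_imp_bounded)
  then have "\<bar>f x\<bar> \<le> \<bar>C\<bar> + 1" if "norm x \<le> M" for x
  proof -
    have "norm (f x) \<le> C" using \<open>\<forall>y\<in>f ` cball 0 M. norm y \<le> C\<close> that by simp
    then show ?thesis by simp
  qed
  then show ?thesis by (intro that[of "\<bar>C\<bar> + 1"]) auto
qed

lemma test_function_bound:
  assumes "test_function \<phi>"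
  obtains C M where "C > 0" "M > 0" "\<And>x. \<bar>\<phi> x\<bar> \<le> C * indicator (cball 0 M) x"
proof -
  obtain M where M: "\<And>x. \<phi> x \<noteq> 0 \<Longrightarrow> norm x \<le> M"
    using assms(1) by (auto simp: test_function_def bounded_iff)
  obtain C where C: "C > 0" "\<And>x. norm x \<le> \<bar>M\<bar> + 1 \<Longrightarrow> \<bar>\<phi> x\<bar> \<le> C"
    using continuous_cball_bound[OF smooth_continuous[OF test_function_smooth[OF assms]]] by blast
  have "\<bar>\<phi> x\<bar> \<le> (\<bar>C\<bar> + 1) * indicator (cball 0 (\<bar>M\<bar> + 1)) x" for x
    using C(2)[of x] M[of x] by (cases "\<phi> x = 0") (auto simp: indicator_def)
  then show ?thesis by (intro that[of "\<bar>C\<bar> + 1" "\<bar>M\<bar> + 1"]) auto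
qed

section \<open>Invariance of the integral and integration by parts\<close>

lemma lborel_integral_affine:
  fixes f :: "real^3 \<Rightarrow> 'b::{banach, second_countable_topology}"
  assumes [measurable]: "f \<in> borel_measurable borel" and s: "\<bar>s\<bar> = 1"
  shows "(LINT x|lborel. f (c + s *\<^sub>R x)) = (LINT x|lborel. f x)"
    and "integrable lborel (\<lambda>x. f (c + s *\<^sub>R x)) \<longleftrightarrow> integrable lborel f"
    and "g \<in> borel_measurable borel \<Longrightarrow> (\<integral>\<^sup>+x. g (c + s *\<^sub>R x) \<partial>lborel) = (\<integral>\<^sup>+x. g x \<partial>lborel)"
proof -
  \<comment> \<open>Since \<open>s\<close> is 1 or -1, these are translations and point reflections,
    and the Jacobian is 1.\<close>
  have *: "distr lborel borel (\<lambda>x::real^3. c + s *\<^sub>R x) = lborel"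
    using lborel_affine[of s c] s by (auto simp: density_1)
  show "(LINT x|lborel. f (c + s *\<^sub>R x)) = (LINT x|lborel. f x)"
    by (subst (2) *[symmetric], subst integral_distr) auto
  show "integrable lborel (\<lambda>x. f (c + s *\<^sub>R x)) \<longleftrightarrow> integrable lborel f"
    by (subst (2) *[symmetric], subst integrable_distr_eq) auto
  show "(\<integral>\<^sup>+x. g (c + s *\<^sub>R x) \<partial>lborel) = (\<integral>\<^sup>+x. g x \<partial>lborel)" if "g \<in> borel_measurable borel"
    using that by (subst (2) *[symmetric], subst nn_integral_distr) auto
qed

lemma integrable_indicator_cball: "integrable lborel (\<lambda>x. C * indicator (cball (0::real^3) M) x :: real)"
  by (intro integrable_mult_right integrable_real_indicator) (use emeasure_bounded_finite[OF bounded_cball] in \<open>auto simp: less_top\<close>)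

lemma integrable_cball_bound:
  fixes f :: "real^3 \<Rightarrow> real"
  assumes "f \<in> borel_measurable borel" "\<And>x. \<bar>f x\<bar> \<le> C * indicator (cball 0 M) x"
  shows "integrable lborel f"
  by (rule Bochner_Integration.integrable_bound[OF integrable_indicator_cball[of C M]])
    (use assms in \<open>auto intro!: always_eventually intro: order_trans[OF _ abs_ge_self]\<close>)

text \<open>The integral of a difference quotient of \<open>F\<close> is 0 by translation
  invariance. By the mean value theorem the quotients are bounded by a constant on a fixed ball, so
  dominated convergence passes to the derivative. The assumptions concern a single first derivative,
  because the result is applied to products with the regularised kernel and its derivatives.\<close>

lemma integral_partial_derivative_eq_0:
  assumes diff: "\<And>x. F differentiable (at x)"
    and cont: "continuous_on UNIV (partial_derivative i F)"
    and supp: "\<And>x. F x \<noteq> 0 \<Longrightarrow> norm x \<le> M"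
  shows "(LINT x|lborel. partial_derivative i F x) = 0"
proof -
  define D where "D = partial_derivative i F"
  \<comment> \<open>The increments have length at most 1, so outside radius \<open>M'\<close> both
    points of a difference quotient are outside the support.\<close>
  define M' where "M' = \<bar>M\<bar> + 2"
  have line: "((\<lambda>s. F (x + s *\<^sub>R axis i 1)) has_real_derivative D (x + s *\<^sub>R axis i 1)) (at s)" for x s
    using has_real_derivative_line[OF diff, of x "axis i 1" s] by (simp add: D_def)
  obtain C where C: "\<And>x. norm x \<le> M' + 1 \<Longrightarrow> \<bar>D x\<bar> \<le> C"
    using continuous_cball_bound[OF cont[folded D_def]] by blast
  have F_meas [measurable]: "F \<in> borel_measurable borel"
    using diff by (intro borel_measurable_continuous_onI continuous_at_imp_continuous_on)
      (auto intro: differentiable_imp_continuous_within)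
  have D_meas [measurable]: "D \<in> borel_measurable borel"
    using cont by (simp add: borel_measurable_continuous_onI D_def)
  have "continuous_on UNIV F"
    using diff by (auto intro!: continuous_at_imp_continuous_on differentiable_imp_continuous_within)
  then obtain B where B: "\<And>x. norm x \<le> M' \<Longrightarrow> \<bar>F x\<bar> \<le> B"
    using continuous_cball_bound by blast
  have F_int: "integrable lborel F"
  proof (rule integrable_cball_bound[of _ "\<bar>B\<bar>" M'])
    show "\<bar>F x\<bar> \<le> \<bar>B\<bar> * indicator (cball 0 M') x" for x
      using B[of x] supp[of x] by (cases "F x = 0") (auto simp: indicator_def M'_def)
  qed simp
  define t where "t n = 1 / real (Suc n)" for n
  have t: "0 < t n" "t n \<le> 1" for n by (auto simp: t_def)
  define q where "q n x = (F (x + t n *\<^sub>R axis i 1) - F x) / t n" for n x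
  have q_int: "(LINT x|lborel. q n x) = 0" for n
    using lborel_integral_affine(1,2)[of F 1 "t n *\<^sub>R axis i 1"] F_int
    by (simp add: q_def add.commute integral_diff)
  have q_bound: "\<bar>q n x\<bar> \<le> \<bar>C\<bar> * indicator (cball 0 M') x" for n x
  proof -
    obtain s where s: "0 < s" "s < t n"
      "F (x + t n *\<^sub>R axis i 1) - F (x + 0 *\<^sub>R axis i 1) = (t n - 0) * D (x + s *\<^sub>R axis i 1)"
      using MVT2[OF t(1)[of n], of "\<lambda>s. F (x + s *\<^sub>R axis i 1)", OF line] by blast
    have q: "q n x = D (x + s *\<^sub>R axis i 1)" using s t(1)[of n] by (simp add: q_def field_simps)
    have near: "norm (x + r *\<^sub>R axis i 1) \<ge> norm x - 1" "norm (x + r *\<^sub>R axis i 1) \<le> norm x + 1"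
      if "0 \<le> r" "r \<le> 1" for r
      using norm_triangle_ineq4[of "x + r *\<^sub>R axis i 1" "r *\<^sub>R axis i 1"]
        norm_triangle_ineq[of x "r *\<^sub>R axis i 1"] that by (auto simp: norm_axis_1)
    show ?thesis
    proof (cases "norm x \<le> M'")
      case True
      then show ?thesis using C[of "x + s *\<^sub>R axis i 1"] near[of s] s t(2)[of n] q
        by (auto simp: indicator_def)
    next
      case False
      then have "F x = 0" "F (x + t n *\<^sub>R axis i 1) = 0"
        using supp[of x] supp[of "x + t n *\<^sub>R axis i 1"] near[of "t n"] t[of n]
        unfolding M'_def by fastforce+
      then show ?thesis by (simp add: q_def)
    qed
  qed
  have q_lim: "(\<lambda>n. q n x) \<longlonglongrightarrow> D x" for x
  proof -
    have "((\<lambda>h. (F (x + h *\<^sub>R axis i 1) - F x) / h) \<longlongrightarrow> D x) (at 0)"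
      using line[of x 0] by (simp add: DERIV_def)
    moreover have "filterlim t (at 0) sequentially"
      unfolding filterlim_at t_def[abs_def]
      using LIMSEQ_inverse_real_of_nat by (auto simp: inverse_eq_divide)
    ultimately show ?thesis
      unfolding q_def by (rule filterlim_compose)
  qed
  have "(\<lambda>n. LINT x|lborel. q n x) \<longlonglongrightarrow> (LINT x|lborel. D x)"
  proof (rule integral_dominated_convergence[where w = "\<lambda>x. \<bar>C\<bar> * indicator (cball 0 M') x"])
    show "q n \<in> borel_measurable lborel" for n unfolding q_def by measurable
    show "integrable lborel (\<lambda>x. \<bar>C\<bar> * indicator (cball (0::real^3) M') x)"
      by (rule integrable_indicator_cball)
  qed (auto simp: q_bound q_lim)
  then show ?thesis using q_int by (simp add: D_def LIMSEQ_const_iff)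
qed

lemma test_function_mult_continuous_integrable:
  fixes H :: "real^3 \<Rightarrow> real"
  assumes \<psi>: "test_function \<psi>" and H: "continuous_on UNIV H"
  shows "integrable lborel (\<lambda>x. H x * \<psi> x)"
proof -
  obtain C M where CM: "\<And>x. \<bar>\<psi> x\<bar> \<le> C * indicator (cball 0 M) x" using test_function_bound[OF \<psi>] by metis
  obtain B where B: "\<And>x. norm x \<le> M \<Longrightarrow> \<bar>H x\<bar> \<le> B"
    using continuous_cball_bound[OF H] by blast
  show ?thesis
  proof (rule integrable_cball_bound[of _ "B * C" M])
    show "\<bar>H x * \<psi> x\<bar> \<le> B * C * indicator (cball 0 M) x" for x
      using mult_mono[OF B[of x] CM[of x]] CM[of x] order_trans[OF abs_ge_zero B[of x]]
      by (cases "norm x \<le> M") (auto simp: abs_mult indicator_def)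
    show "(\<lambda>x. H x * \<psi> x) \<in> borel_measurable borel"
      using smooth_borel[OF test_function_smooth[OF \<psi>]] borel_measurable_continuous_onI[OF H] by measurable
  qed
qed

text \<open>Compact support is required of \<phi> only: the product inherits it, and the integral of
  the derivative of the product vanishes. \<open>F\<close> may thus be a kernel that extends over
  the whole space.\<close>

lemma integral_partial_by_parts:
  assumes F: "\<And>x. F differentiable (at x)" "continuous_on UNIV (partial_derivative i F)"
    and \<phi>: "test_function \<phi>"
  shows "(LINT x|lborel. F x * partial_derivative i \<phi> x) = - (LINT x|lborel. partial_derivative i F x * \<phi> x)"
proof -
  have sm: "smooth \<phi>" "smooth (partial_derivative i \<phi>)"
    using \<phi> by (auto intro: test_function_smooth smooth_partial)
  have contF: "continuous_on UNIV F"
    using F(1) by (auto intro!: continuous_at_imp_continuous_on differentiable_imp_continuous_within)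
  have pm: "partial_derivative i (\<lambda>x. F x * \<phi> x) = (\<lambda>x. F x * partial_derivative i \<phi> x + partial_derivative i F x * \<phi> x)"
    by (intro ext partial_derivative_mult F smooth_differentiable sm)
  obtain M where M: "\<And>x. \<phi> x \<noteq> 0 \<Longrightarrow> norm x \<le> M"
    using \<phi> by (auto simp: test_function_def bounded_iff)
  have zero: "(LINT x|lborel. partial_derivative i (\<lambda>x. F x * \<phi> x) x) = 0"
  proof (rule integral_partial_derivative_eq_0)
    show "continuous_on UNIV (partial_derivative i (\<lambda>x. F x * \<phi> x))"
      unfolding pm by (intro continuous_intros contF F smooth_continuous sm)
    show "norm x \<le> M" if "F x * \<phi> x \<noteq> 0" for x using that M by auto
  qed (intro differentiable_mult F smooth_differentiable sm)
  show ?thesis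
    using zero test_function_mult_continuous_integrable[OF test_function_partial[OF \<phi>] contF]
      test_function_mult_continuous_integrable[OF \<phi> F(2)]
    unfolding pm by (simp add: integral_add)
qed

text \<open>\<open>flat k\<close> is the \<open>k\<close>-th derivative of \<open>exp (- 1 / t)\<close>, continued by \<open>0\<close> to \<open>t \<le> 0\<close>.\<close>

fun flat_poly :: "nat \<Rightarrow> real poly" where
  "flat_poly 0 = 1"
| "flat_poly (Suc k) = monom 1 2 * (flat_poly k - pderiv (flat_poly k))"

definition flat :: "nat \<Rightarrow> real \<Rightarrow> real" where
  "flat k t = (if t > 0 then poly (flat_poly k) (1 / t) * exp (- 1 / t) else 0)"

lemma poly_times_exp_tendsto_0: "((\<lambda>s. poly p s * exp (- s)) \<longlongrightarrow> (0::real)) at_top"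
proof -
  have "((\<lambda>s. \<Sum>i\<le>degree p. coeff p i * (s ^ i / exp s)) \<longlongrightarrow> (\<Sum>i\<le>degree p. coeff p i * 0)) at_top"
    by (intro tendsto_sum tendsto_mult tendsto_const tendsto_power_div_exp_0)
  then show ?thesis
    by (simp add: poly_altdef sum_distrib_right sum_divide_distrib exp_minus field_simps)
qed

text \<open>With \<open>s = 1 / t\<close>, the derivative of \<open>p(s) exp(-s)\<close> in
  \<open>t\<close> is \<open>s^2 (p(s) - p'(s)) exp(-s)\<close>, which is the recursion of
  \<open>flat_poly\<close>. At 0 the right difference quotient is \<open>s p(s) exp(-s)\<close> and
  tends to 0 as \<open>s\<close> grows, while the left one is 0.\<close>

lemma flat_has_derivative: "(flat k has_field_derivative flat (Suc k) t) (at t)"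
proof -
  consider "t > 0" | "t < 0" | "t = 0" by linarith
  then show ?thesis
  proof cases
    case 1
    have "((\<lambda>t. poly (flat_poly k) (1 / t) * exp (- 1 / t)) has_field_derivative flat (Suc k) t) (at t)"
      using 1 by (auto intro!: derivative_eq_intros simp: flat_def poly_monom power2_eq_square field_simps)
    then show ?thesis
      by (rule has_field_derivative_transform_within_open[where S = "{0<..}"])
        (use 1 in \<open>auto simp: flat_def\<close>)
  next
    case 2
    have "((\<lambda>t. 0) has_field_derivative flat (Suc k) t) (at t)"
      using 2 by (auto simp: flat_def)
    then show ?thesis
      by (rule has_field_derivative_transform_within_open[where S = "{..<0}"])
        (use 2 in \<open>auto simp: flat_def\<close>)
  next
    case 3
    have "((\<lambda>h. flat k h / h) \<longlongrightarrow> 0) (at_right 0)"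
    proof (rule Lim_transform_eventually)
      show "((\<lambda>h. poly (pCons 0 (flat_poly k)) (inverse h) * exp (- inverse h)) \<longlongrightarrow> (0::real)) (at_right 0)"
        by (rule filterlim_compose[OF poly_times_exp_tendsto_0 filterlim_inverse_at_top_right])
      show "\<forall>\<^sub>F h in at_right 0. poly (pCons 0 (flat_poly k)) (inverse h) * exp (- inverse h) = flat k h / h"
        by (auto simp: eventually_at_right_less flat_def divide_simps
            intro!: eventually_at_rightI[of 0 1])
    qed
    moreover have "((\<lambda>h. flat k h / h) \<longlongrightarrow> 0) (at_left 0)"
      by (rule Lim_transform_eventually[OF tendsto_const])
        (auto simp: flat_def intro!: eventually_at_leftI[of "-1"])
    ultimately have "((\<lambda>h. flat k h / h) \<longlongrightarrow> 0) (at 0)"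
      by (simp add: filterlim_at_split)
    then show ?thesis using 3 by (simp add: DERIV_def flat_def)
  qed
qed

lemma flat_0: "flat 0 t = (if t > 0 then exp (- 1 / t) else 0)"
  by (simp add: flat_def)

lemma flat_bounds: "0 \<le> flat 0 t" "flat 0 t \<le> 1"
  by (auto simp: flat_0)

lemma smooth_flat: "smooth \<phi> \<Longrightarrow> smooth (\<lambda>x. flat 0 (\<phi> x))"
  by (rule smooth_comp[where h = flat, OF _ flat_has_derivative])

lemma smooth_prod: "(\<And>i. i \<in> I \<Longrightarrow> smooth (\<phi> i)) \<Longrightarrow> smooth (\<lambda>x. \<Prod>i\<in>I. \<phi> i x)"
proof (induction I rule: infinite_finite_induct)
  case (insert j I)
  then show ?case using smooth_mult[of "\<phi> j" "\<lambda>x. \<Prod>i\<in>I. \<phi> i x"] by simp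
qed simp_all

text \<open>In each coordinate a flat step rises from either face, steepened by the factor
  \<open>Suc n\<close>. The product vanishes off the open box, and inside it tends to 1, because
  \<open>exp (- 1 / (Suc n * c))\<close> tends to 1 for \<open>c > 0\<close>.\<close>

lemma box_test_functions:
  fixes a b :: "real^3"
  obtains \<phi> where "\<And>n. test_function (\<phi> n)" "\<And>n x. 0 \<le> \<phi> n x" "\<And>n x. \<phi> n x \<le> indicator (cbox a b) x"
    "\<And>x. (\<lambda>n. \<phi> n x) \<longlonglongrightarrow> indicator (box a b) x"
proof -
  define \<phi> where "\<phi> n x = (\<Prod>i\<in>UNIV. flat 0 (real (Suc n) * (x $ i - a $ i)) * flat 0 (real (Suc n) * (b $ i - x $ i)))"
    for n :: nat and x :: "real^3"
  have zero: "\<phi> n x = 0" if x: "x \<notin> box a b" for n x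
  proof -
    obtain i where "x $ i \<le> a $ i \<or> b $ i \<le> x $ i"
      using x unfolding mem_box_cart by (meson not_le_imp_less)
    then have "flat 0 (real (Suc n) * (x $ i - a $ i)) * flat 0 (real (Suc n) * (b $ i - x $ i)) = 0"
      by (auto simp: flat_0 zero_less_mult_iff)
    then show ?thesis unfolding \<phi>_def by (intro prod_zero) auto
  qed
  have bounds: "0 \<le> \<phi> n x" "\<phi> n x \<le> 1" for n x
    unfolding \<phi>_def by (auto intro!: prod_nonneg prod_le_1 mult_nonneg_nonneg mult_le_one flat_bounds)
  have smooth: "smooth (\<phi> n)" for n
    unfolding \<phi>_def
  proof (intro smooth_prod smooth_mult smooth_flat smooth_const)
    show "smooth (\<lambda>x. x $ i - a $ i)" for i
      using smooth_add[OF smooth_coordinate smooth_const[of "- a $ i"]] by simp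
    show "smooth (\<lambda>x. b $ i - x $ i)" for i
      using smooth_add[OF smooth_const[of "b $ i"] smooth_cmult[OF smooth_coordinate, of "-1"]] by simp
  qed
  show ?thesis
  proof
    show "test_function (\<phi> n)" for n
      unfolding test_function_def
      using smooth bounded_subset[OF bounded_box[of a b], of "{x. \<phi> n x \<noteq> 0}"] zero[of _ n] by blast
    show "0 \<le> \<phi> n x" for n x by (rule bounds)
    show "\<phi> n x \<le> indicator (cbox a b) x" for n x
      using bounds(2)[of n x] zero[of x n] box_subset_cbox[of a b]
      by (cases "x \<in> box a b") (auto simp: indicator_def)
    show "(\<lambda>n. \<phi> n x) \<longlonglongrightarrow> indicator (box a b) x" for x
    proof (cases "x \<in> box a b")
      case True
      have lim: "(\<lambda>n. flat 0 (real (Suc n) * c)) \<longlonglongrightarrow> 1" if "c > 0" for c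
      proof -
        have "(\<lambda>n. exp (- (1 / c) * inverse (real (Suc n)))) \<longlonglongrightarrow> exp (- (1 / c) * 0)"
          by (intro tendsto_intros LIMSEQ_inverse_real_of_nat)
        then show ?thesis using that by (simp add: flat_0 zero_less_mult_iff divide_simps mult.commute)
      qed
      have "(\<lambda>n. \<phi> n x) \<longlonglongrightarrow> (\<Prod>i\<in>(UNIV::3 set). 1 * 1)"
        unfolding \<phi>_def using True by (intro tendsto_prod tendsto_mult lim) (auto simp: mem_box_cart)
      then show ?thesis using True by simp
    next
      case False
      then show ?thesis using zero by simp
    qed
  qed
qed

section \<open>Locally integrable functions that vanish against all test functions\<close>

lemma locally_integrable_iff:
  "locally_integrable F \<longleftrightarrow> (\<forall>K. compact K \<longrightarrow> integrable lebesgue (\<lambda>x. indicator K x *\<^sub>R F x))"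
  by (simp add: locally_integrable_def set_integrable_def)

lemma locally_integrable_measurable:
  fixes F :: "real^3 \<Rightarrow> 'b::euclidean_space"
  assumes "locally_integrable F"
  shows "F \<in> borel_measurable lebesgue"
proof (rule borel_measurable_LIMSEQ_metric)
  show "(\<lambda>x. indicator (cball 0 (real n)) x *\<^sub>R F x) \<in> borel_measurable lebesgue" for n
    using assms unfolding locally_integrable_iff by (intro borel_measurable_integrable) auto
  show "(\<lambda>n. indicator (cball 0 (real n)) x *\<^sub>R F x) \<longlonglongrightarrow> F x" for x
  proof (rule tendsto_eventually)
    show "\<forall>\<^sub>F n in sequentially. indicator (cball 0 (real n)) x *\<^sub>R F x = F x"
      using eventually_ge_at_top[of "nat \<lceil>norm x\<rceil>"]
      by eventually_elim (auto simp: indicator_def nat_ceiling_le_eq)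
  qed
qed

lemma lebesgue_measurable_borel: "f \<in> borel_measurable borel \<Longrightarrow> f \<in> borel_measurable lebesgue"
  by (simp add: borel_measurable_if_lebesgue_on measurable_completion)

lemma locally_integrable_mult:
  fixes F :: "real^3 \<Rightarrow> 'b::euclidean_space"
  assumes F: "locally_integrable F" and [measurable]: "\<phi> \<in> borel_measurable borel"
    and bound: "\<And>x. \<bar>\<phi> x\<bar> \<le> C * indicator (cball 0 M) x"
  shows "integrable lebesgue (\<lambda>x. \<phi> x *\<^sub>R F x)"
proof (rule Bochner_Integration.integrable_bound)
  show "integrable lebesgue (\<lambda>x. C *\<^sub>R (indicator (cball 0 M) x *\<^sub>R F x))"
    using F by (intro integrable_scaleR_right) (auto simp: locally_integrable_iff)
  show "(\<lambda>x. \<phi> x *\<^sub>R F x) \<in> borel_measurable lebesgue"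
    by (intro borel_measurable_scaleR lebesgue_measurable_borel locally_integrable_measurable F) fact
  have "norm (\<phi> x *\<^sub>R F x) \<le> norm (C *\<^sub>R (indicator (cball 0 M) x *\<^sub>R F x))" for x
    using mult_right_mono[OF order_trans[OF bound[of x] abs_ge_self] norm_ge_zero[of "F x"]]
    by (simp add: abs_mult mult.assoc)
  then show "AE x in lebesgue. norm (\<phi> x *\<^sub>R F x) \<le> norm (C *\<^sub>R (indicator (cball 0 M) x *\<^sub>R F x))"
    by simp
qed

lemma test_function_mult_integrable:
  fixes F :: "real^3 \<Rightarrow> 'b::euclidean_space"
  assumes "locally_integrable F" "test_function \<phi>"
  shows "integrable lebesgue (\<lambda>x. \<phi> x *\<^sub>R F x)"
proof -
  obtain C M where "\<And>x. \<bar>\<phi> x\<bar> \<le> C * indicator (cball 0 M) x" using test_function_bound[OF assms(2)] by metis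
  then show ?thesis
    by (rule locally_integrable_mult[OF assms(1) smooth_borel[OF test_function_smooth[OF assms(2)]]])
qed

text \<open>As \<open>ennreal\<close> sends negative numbers to 0, \<open>?P\<close> and
  \<open>?N\<close> have the positive and the negative part of \<open>F\<close> as densities. They
  agree and are finite on boxes, which are closed under intersection and generate the Borel sets, so
  the measures are equal. Hence the two parts of \<open>F\<close> agree almost everywhere, and as
  one of them is 0 at each point, both are.\<close>

lemma AE_eq_0_if_box_integrals_eq_0:
  fixes F :: "real^3 \<Rightarrow> real"
  assumes int: "\<And>a b. integrable lborel (\<lambda>x. indicator (box a b) x * F x)"
    and zero: "\<And>a b. (LINT x|lborel. indicator (box a b) x * F x) = 0"
    and [measurable]: "F \<in> borel_measurable borel"
  shows "AE x in lborel. F x = 0"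
proof -
  let ?P = "density lborel (\<lambda>x. ennreal (F x))" and ?N = "density lborel (\<lambda>x. ennreal (- F x))"
  let ?E = "range (\<lambda>(a, b). box a b :: (real^3) set)"
  have em: "emeasure ?P (box a b) = (\<integral>\<^sup>+x. ennreal (indicator (box a b) x * F x) \<partial>lborel)"
    "emeasure ?N (box a b) = (\<integral>\<^sup>+x. ennreal (- (indicator (box a b) x * F x)) \<partial>lborel)" for a b
    by (auto simp: emeasure_density indicator_def intro!: nn_integral_cong)
  have fin: "emeasure ?P (box a b) \<noteq> \<infinity>" "emeasure ?N (box a b) \<noteq> \<infinity>" for a b
    unfolding em using int[of a b] by (auto simp: real_integrable_def)
  have "?P = ?N"
  proof (rule measure_eqI_generator_eq[where A = "\<lambda>n. box (- (real n *\<^sub>R One)) (real n *\<^sub>R One)" and \<Omega> = UNIV and E = ?E])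
    show "Int_stable ?E"
    proof (unfold Int_stable_def, safe)
      fix a b c d :: "real^3"
      have "box a b \<inter> box c d = box (\<chi> i. max (a $ i) (c $ i)) (\<chi> i. min (b $ i) (d $ i))"
        by (auto simp: mem_box_cart)
      then show "box a b \<inter> box c d \<in> ?E" by auto
    qed
    show "emeasure ?P X = emeasure ?N X" if X_in: "X \<in> ?E" for X
    proof -
      obtain a b where X: "X = box a b"
using X_in by auto
      have "enn2real (emeasure ?P X) = enn2real (emeasure ?N X)"
        using zero[of a b] unfolding real_lebesgue_integral_def[OF int] em X by simp
      then show ?thesis using fin[of a b] unfolding X
        by (metis ennreal_enn2real infinity_ennreal_def less_top)
    qed
    show "sets ?P = sigma_sets UNIV ?E" "sets ?N = sigma_sets UNIV ?E"
      by (auto simp: borel_eq_box)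
    show "(\<Union>n. box (- (real n *\<^sub>R One)) (real n *\<^sub>R One)) = (UNIV :: (real^3) set)"
      by (rule UN_box_eq_UNIV)
    show "emeasure ?P (box (- (real n *\<^sub>R One)) (real n *\<^sub>R One)) \<noteq> \<infinity>" for n
      by (rule fin)
  qed auto
  then have "AE x in lborel. ennreal (F x) = ennreal (- F x)"
    by (subst (asm) sigma_finite_measure.density_unique_iff[OF sigma_finite_lborel]) auto
  then show ?thesis
  proof eventually_elim
    case (elim x)
    show ?case
    proof (cases "F x \<ge> 0")
      case True
      then have "ennreal (F x) = 0" using elim by (simp add: ennreal_neg)
      then show ?thesis using True by simp
    next
      case False
      then have "ennreal (- F x) = 0" using elim by (simp add: ennreal_neg)
      then show ?thesis using False by simp
    qed
  qed
qed

text \<open>The indicator of an open box is a bounded limit of test functions supported in the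
  closed box, so all integrals over boxes vanish. The comparison of measures takes place on Borel
  sets, for which \<open>F\<close> is replaced by a Borel function equal to it almost
  everywhere.\<close>

lemma fundamental_lemma_real:
  fixes F :: "real^3 \<Rightarrow> real"
  assumes F: "locally_integrable F"
    and zero: "\<And>\<phi>. test_function \<phi> \<Longrightarrow> (LINT x|lebesgue. \<phi> x * F x) = 0"
  shows "AE x in lebesgue. F x = 0"
proof -
  have F_meas [measurable]: "F \<in> borel_measurable lebesgue" by (rule locally_integrable_measurable[OF F])
  obtain F' where F' [measurable]: "F' \<in> borel_measurable borel" and ae: "AE x in lborel. F x = F' x"
    using completion_ex_borel_measurable_real[OF F_meas] by auto
  have ae': "AE x in lebesgue. F x = F' x" using ae by (rule AE_completion)
  have box: "integrable lebesgue (\<lambda>x. indicator (box a b) x * F x)"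
    "(LINT x|lebesgue. indicator (box a b) x * F x) = 0" for a b
  proof -
    obtain \<phi> where \<phi>: "\<And>n. test_function (\<phi> n)" "\<And>n x. 0 \<le> \<phi> n x" "\<And>n x. \<phi> n x \<le> indicator (cbox a b) x"
        "\<And>x. (\<lambda>n. \<phi> n x) \<longlonglongrightarrow> indicator (box a b) x"
      using box_test_functions by blast
    have I: "integrable lebesgue (\<lambda>x. \<bar>indicator (cbox a b) x * F x\<bar>)"
      using F by (intro integrable_abs) (auto simp: locally_integrable_iff)
    have *: "(\<lambda>n. LINT x|lebesgue. \<phi> n x * F x) \<longlonglongrightarrow> (LINT x|lebesgue. indicator (box a b) x * F x)"
      "integrable lebesgue (\<lambda>x. indicator (box a b) x * F x)"
    proof (atomize (full), intro conjI)
      have m: "(\<lambda>x. \<phi> n x * F x) \<in> borel_measurable lebesgue" for n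
        by (intro borel_measurable_times lebesgue_measurable_borel smooth_borel test_function_smooth \<phi> F_meas)
      have bd: "\<bar>\<phi> n x * F x\<bar> \<le> \<bar>indicator (cbox a b) x * F x\<bar>" for n x
        using \<phi>(2,3)[of n x] by (auto simp: abs_mult intro!: mult_right_mono)
      have m': "(\<lambda>x. indicator (box a b) x * F x) \<in> borel_measurable lebesgue"
        by (intro borel_measurable_times borel_measurable_indicator) auto
      have l: "(\<lambda>n. \<phi> n x * F x) \<longlonglongrightarrow> indicator (box a b) x * F x" for x
        by (intro tendsto_mult \<phi>(4) tendsto_const)
      show "(\<lambda>n. LINT x|lebesgue. \<phi> n x * F x) \<longlonglongrightarrow> (LINT x|lebesgue. indicator (box a b) x * F x)"
        by (rule integral_dominated_convergence[where w = "\<lambda>x. \<bar>indicator (cbox a b) x * F x\<bar>"]) (use I in \<open>auto simp: l bd m m' intro!: always_eventually\<close>)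
      show "integrable lebesgue (\<lambda>x. indicator (box a b) x * F x)"
        by (rule integrable_dominated_convergence[where w = "\<lambda>x. \<bar>indicator (cbox a b) x * F x\<bar>" and s = "\<lambda>n x. \<phi> n x * F x"]) (use I in \<open>auto simp: l bd m m' intro!: always_eventually\<close>)
    qed
    show "integrable lebesgue (\<lambda>x. indicator (box a b) x * F x)" by (rule *)
    show "(LINT x|lebesgue. indicator (box a b) x * F x) = 0"
      using *(1) zero[OF \<phi>(1)] by (simp add: LIMSEQ_const_iff)
  qed
  have m: "(\<lambda>x. indicator (box a b) x * F' x) \<in> borel_measurable lborel" for a b by measurable
  have "AE x in lborel. F' x = 0"
  proof (rule AE_eq_0_if_box_integrals_eq_0)
    fix a b
    have e: "AE x in lebesgue. indicator (box a b) x * F x = indicator (box a b) x * F' x"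
      using ae' by eventually_elim simp
    have m1: "(\<lambda>x. indicator (box a b) x * F x) \<in> borel_measurable lebesgue" using box(1) by auto
    have m2: "(\<lambda>x. indicator (box a b) x * F' x) \<in> borel_measurable lebesgue"
      using measurable_completion[OF m] .
    show "integrable lborel (\<lambda>x. indicator (box a b) x * F' x)"
      using box(1)[of a b] integrable_cong_AE[OF m1 m2 e] integrable_completion[OF m, of a b] by simp
    show "(LINT x|lborel. indicator (box a b) x * F' x) = 0"
      using box(2)[of a b] integral_cong_AE[OF m1 m2 e] integral_completion[OF m, of a b] by simp
  qed simp
  then have "AE x in lebesgue. F' x = 0" by (rule AE_completion)
  with ae' show ?thesis by eventually_elim simp
qed

section \<open>Radial integrals\<close>

text \<open>On a half-line up to \<open>a\<close> both measures give the volume of the ball of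
  radius \<open>a\<close>. This replaces polar coordinates for all integrands that depend on the
  norm only.\<close>

lemma distr_norm_lborel:
  "distr lborel borel (norm :: real^3 \<Rightarrow> real) =
   density lborel (\<lambda>r. ennreal (4 * pi * r\<^sup>2) * indicator {0..} r)" (is "?L = ?R")
proof (rule measure_eqI_generator_eq[where E = "range atMost" and \<Omega> = UNIV and A = "\<lambda>n. {..real n}"])
  have L: "emeasure ?L {..a} = ennreal (4 * pi * a ^ 3 / 3) * indicator {0..} a" for a
  proof -
    have "emeasure ?L {..a} = emeasure lborel (norm -` {..a} :: (real^3) set)"
      by (subst emeasure_distr) auto
    also have "norm -` {..a} = cball (0::real^3) a" by auto
    also have "emeasure lborel \<dots> = ennreal (4 * pi * a ^ 3 / 3) * indicator {0..} a"
    proof (cases "a \<ge> 0")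
      case True
      then show ?thesis by (simp add: emeasure_cball unit_ball_vol_3)
    qed (auto simp: cball_empty)
    finally show ?thesis .
  qed
  have R: "emeasure ?R {..a} = ennreal (4 * pi * a ^ 3 / 3) * indicator {0..} a" for a
  proof -
    have "emeasure ?R {..a} = (\<integral>\<^sup>+r. ennreal (4 * pi * r\<^sup>2) * indicator {0..a} r \<partial>lborel)"
      by (subst emeasure_density) (auto simp: indicator_def intro!: nn_integral_cong)
    also have "\<dots> = ennreal (4 * pi * a ^ 3 / 3) * indicator {0..} a"
    proof (cases "a \<ge> 0")
      case True
      have "(\<integral>\<^sup>+r. ennreal (4 * pi * r\<^sup>2) * indicator {0..a} r \<partial>lborel) =
          4 * pi * a ^ 3 / 3 - 4 * pi * 0 ^ 3 / 3"
        using True by (intro nn_integral_FTC_Icc) (auto intro!: derivative_eq_intros)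
      then show ?thesis using True by simp
    qed simp
    finally show ?thesis .
  qed
  show "Int_stable (range (atMost :: real \<Rightarrow> _))"
    by (auto simp: Int_stable_def)
  show "emeasure ?L X = emeasure ?R X" if "X \<in> range atMost" for X
    using that L R by auto
  show "emeasure ?L {..real n} \<noteq> \<infinity>" for n
    unfolding L by (simp add: ennreal_mult_eq_top_iff)
  show "sets ?L = sigma_sets UNIV (range atMost)" "sets ?R = sigma_sets UNIV (range atMost)"
    by (auto simp: borel_eq_atMost image_def)
  show "(\<Union>n. {..real n}) = UNIV"
    using real_arch_simple by blast
qed auto

lemma nn_integral_radial:
  fixes h :: "real \<Rightarrow> ennreal"
  assumes [measurable]: "h \<in> borel_measurable borel"
  shows "(\<integral>\<^sup>+x. h (norm (x::real^3)) \<partial>lborel) =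
    (\<integral>\<^sup>+r. ennreal (4 * pi * r\<^sup>2) * indicator {0..} r * h r \<partial>lborel)"
proof -
  have "(\<integral>\<^sup>+x. h (norm (x::real^3)) \<partial>lborel) = (\<integral>\<^sup>+r. h r \<partial>distr lborel borel (norm :: real^3 \<Rightarrow> real))"
    by (simp add: nn_integral_distr)
  also have "\<dots> = (\<integral>\<^sup>+r. ennreal (4 * pi * r\<^sup>2) * indicator {0..} r * h r \<partial>lborel)"
    by (subst distr_norm_lborel, subst nn_integral_density) auto
  finally show ?thesis .
qed

text \<open>The radial density turns the exponent \<open>- s\<close> into \<open>2 - s\<close>,
  which is integrable at 0 precisely for \<open>s < 3\<close>.\<close>

lemma nn_integral_norm_powr_cball:
  assumes "s < 3" "R \<ge> 0"
  shows "(\<integral>\<^sup>+x. ennreal (norm x powr - s) * indicator (cball (0::real^3) R) x \<partial>lborel) =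
    ennreal (4 * pi * R powr (3 - s) / (3 - s))"
proof -
  have "(\<integral>\<^sup>+x. ennreal (norm x powr - s) * indicator (cball (0::real^3) R) x \<partial>lborel) =
      (\<integral>\<^sup>+x. ennreal (norm x powr - s) * indicator {..R} (norm (x::real^3)) \<partial>lborel)"
    by (auto intro!: nn_integral_cong simp: indicator_def)
  also have "\<dots> = (\<integral>\<^sup>+r. ennreal (4 * pi * r\<^sup>2) * indicator {0..} r * (ennreal (r powr - s) * indicator {..R} r) \<partial>lborel)"
    by (rule nn_integral_radial[of "\<lambda>r. ennreal (r powr - s) * indicator {..R} r"]) simp
  also have "\<dots> = (\<integral>\<^sup>+r. ennreal (4 * pi * r powr (2 - s)) * indicator {0..R} r \<partial>lborel)"
  proof (rule nn_integral_cong)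
    fix r :: real
    show "ennreal (4 * pi * r\<^sup>2) * indicator {0..} r * (ennreal (r powr - s) * indicator {..R} r) =
        ennreal (4 * pi * r powr (2 - s)) * indicator {0..R} r"
      by (cases "r > 0")
        (auto simp: indicator_def ennreal_mult'[symmetric] powr_diff powr_minus field_simps powr_numeral
          split: if_splits)
  qed
  also have "\<dots> = ennreal (4 * pi * (R powr (2 - s + 1) / (2 - s + 1)))"
    using nn_integral_has_integral_lebesgue'[where f = "\<lambda>r. 4 * pi * r powr (2 - s)",
        OF _ has_integral_mult_right[OF has_integral_powr_from_0[of "2 - s" R]]] assms
    by simp
  finally show ?thesis by (simp add: algebra_simps)
qed

lemma nn_integral_norm_powr_outside:
  assumes "p > 3" "R > 0"
  shows "(\<integral>\<^sup>+x. ennreal (norm x powr - p) * indicator (- ball (0::real^3) R) x \<partial>lborel) =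
    ennreal (4 * pi * R powr (3 - p) / (p - 3))"
proof -
  have "(\<integral>\<^sup>+x. ennreal (norm x powr - p) * indicator (- ball (0::real^3) R) x \<partial>lborel) =
      (\<integral>\<^sup>+x. ennreal (norm x powr - p) * indicator {R..} (norm (x::real^3)) \<partial>lborel)"
    by (auto intro!: nn_integral_cong simp: indicator_def)
  also have "\<dots> = (\<integral>\<^sup>+r. ennreal (4 * pi * r\<^sup>2) * indicator {0..} r * (ennreal (r powr - p) * indicator {R..} r) \<partial>lborel)"
    by (rule nn_integral_radial[of "\<lambda>r. ennreal (r powr - p) * indicator {R..} r"]) simp
  also have "\<dots> = (\<integral>\<^sup>+r. ennreal (4 * pi * r powr (2 - p)) * indicator {R..} r \<partial>lborel)"
  proof (rule nn_integral_cong)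
    fix r :: real
    show "ennreal (4 * pi * r\<^sup>2) * indicator {0..} r * (ennreal (r powr - p) * indicator {R..} r) =
        ennreal (4 * pi * r powr (2 - p)) * indicator {R..} r"
      using assms(2) by (cases "r > 0")
        (auto simp: indicator_def ennreal_mult'[symmetric] powr_diff powr_minus field_simps powr_numeral
          split: if_splits)
  qed
  also have "\<dots> = ennreal (4 * pi * (- (R powr (2 - p + 1)) / (2 - p + 1)))"
    using nn_integral_has_integral_lebesgue'[where f = "\<lambda>r. 4 * pi * r powr (2 - p)",
        OF _ has_integral_mult_right[OF has_integral_powr_to_inf[of "2 - p" R]]] assms
    by simp
  also have "4 * pi * (- (R powr (2 - p + 1)) / (2 - p + 1)) = 4 * pi * R powr (3 - p) / (p - 3)"
    using assms(1) by (simp add: field_simps)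
  finally show ?thesis .
qed

text \<open>After passing to the radius the integrand is the derivative of
  \<open>r^3 (r^2 + e^2)^(-3/2)\<close>, which rises from 0 to 1. The integrand itself is minus the
  Laplacian of the regularised fundamental solution.\<close>

lemma nn_integral_mollifier:
  assumes "e > 0"
  shows "(\<integral>\<^sup>+x. ennreal (3 * e\<^sup>2 / (4 * pi) * ((norm (x::real^3))\<^sup>2 + e\<^sup>2) powr (- 5 / 2)) \<partial>lborel) = 1"
proof -
  have lim: "((\<lambda>r. (r\<^sup>2 / (r\<^sup>2 + e\<^sup>2)) powr (3 / 2)) \<longlongrightarrow> 1 powr (3/2)) at_top"
  proof (intro tendsto_powr tendsto_const)
    have "((\<lambda>r. 1 / (1 + e\<^sup>2 * inverse r ^ 2)) \<longlongrightarrow> 1 / (1 + e\<^sup>2 * 0 ^ 2)) at_top"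
      by (intro tendsto_intros tendsto_inverse_0_at_top filterlim_ident) auto
    then have "((\<lambda>r. 1 / (1 + e\<^sup>2 * inverse r ^ 2)) \<longlongrightarrow> 1) at_top" by simp
    then show "((\<lambda>r. r\<^sup>2 / (r\<^sup>2 + e\<^sup>2)) \<longlongrightarrow> 1) at_top"
    proof (rule Lim_transform_eventually)
      show "\<forall>\<^sub>F r in at_top. 1 / (1 + e\<^sup>2 * inverse r ^ 2) = r\<^sup>2 / (r\<^sup>2 + e\<^sup>2)"
        using eventually_gt_at_top[of 0]
        by eventually_elim (simp add: field_simps power2_eq_square)
    qed
  qed simp
  define F where "F r = r ^ 3 * (r\<^sup>2 + e\<^sup>2) powr (- 3 / 2)" for r
  have pos: "0 < r\<^sup>2 + e\<^sup>2" for r using assms by (simp add: add_nonneg_pos)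
  have deriv: "DERIV F r :> 3 * e\<^sup>2 * r\<^sup>2 * (r\<^sup>2 + e\<^sup>2) powr (- 5 / 2)" for r
  proof -
    have "DERIV F r :> 3 * r\<^sup>2 * (r\<^sup>2 + e\<^sup>2) powr (- 3 / 2) + r ^ 3 * (- 3 / 2 * (r\<^sup>2 + e\<^sup>2) powr (- 3 / 2 - 1) * (2 * r))"
      unfolding F_def using pos[of r] by (auto intro!: derivative_eq_intros)
    \<comment> \<open>With this common power taken out, the two terms combine by
      \<open>3 r^2 (r^2 + e^2) - 3 r^4 = 3 e^2 r^2\<close>.\<close>
    moreover have "(r\<^sup>2 + e\<^sup>2) powr (- 3 / 2) = (r\<^sup>2 + e\<^sup>2) * (r\<^sup>2 + e\<^sup>2) powr (- 5 / 2)"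
      using pos[of r] powr_add[of "r\<^sup>2 + e\<^sup>2" 1 "- 5 / 2"] by simp
    ultimately show ?thesis by (simp add: algebra_simps power2_eq_square power3_eq_cube)
  qed
  have "(\<integral>\<^sup>+x. ennreal (3 * e\<^sup>2 / (4 * pi) * ((norm (x::real^3))\<^sup>2 + e\<^sup>2) powr (- 5 / 2)) \<partial>lborel) =
     (\<integral>\<^sup>+r. ennreal (4 * pi * r\<^sup>2) * indicator {0..} r * ennreal (3 * e\<^sup>2 / (4 * pi) * (r\<^sup>2 + e\<^sup>2) powr (- 5 / 2)) \<partial>lborel)"
    by (rule nn_integral_radial[of "\<lambda>r. ennreal (3 * e\<^sup>2 / (4 * pi) * (r\<^sup>2 + e\<^sup>2) powr (- 5 / 2))"]) simp
  also have "\<dots> = (\<integral>\<^sup>+r. ennreal (3 * e\<^sup>2 * r\<^sup>2 * (r\<^sup>2 + e\<^sup>2) powr (- 5 / 2)) * indicator {0..} r \<partial>lborel)"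
    by (intro nn_integral_cong) (auto simp: indicator_def ennreal_mult'[symmetric])
  also have "\<dots> = ennreal (1 - F 0)"
  proof (rule nn_integral_FTC_atLeast[OF _ deriv])
    have "((\<lambda>r. (r\<^sup>2 / (r\<^sup>2 + e\<^sup>2)) powr (3 / 2)) \<longlongrightarrow> 1) at_top" using lim by simp
    then show "(F \<longlongrightarrow> 1) at_top"
    proof (rule Lim_transform_eventually)
      show "\<forall>\<^sub>F r in at_top. (r\<^sup>2 / (r\<^sup>2 + e\<^sup>2)) powr (3 / 2) = F r"
        using eventually_gt_at_top[of 0]
      proof eventually_elim
        case (elim r)
        have "(r\<^sup>2) powr (3 / 2) = r ^ 3"
          using elim powr_powr[of r 2 "3/2"] powr_numeral[of r "num.Bit0 num.One"] powr_numeral[of r "num.Bit1 num.One"]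
          by simp
        moreover have "(r\<^sup>2 + e\<^sup>2) powr (- 3 / 2) = 1 / (r\<^sup>2 + e\<^sup>2) powr (3 / 2)"
          using powr_minus_divide[of "r\<^sup>2 + e\<^sup>2" "3/2"] by simp
        ultimately show ?case using elim pos[of r]
          by (simp add: F_def powr_divide)
      qed
    qed
  qed auto
  finally show ?thesis by (simp add: F_def)
qed

section \<open>Convolution with test functions\<close>

text \<open>The fields are Lebesgue measurable and not Borel measurable in general, so Fubini's
  theorem is used for the completed measure; a countable cover for the Borel measure serves the
  completion as well.\<close>

lemma sigma_finite_lebesgue: "sigma_finite_measure (lebesgue :: 'a::euclidean_space measure)"
proof
  obtain A :: "'a set set" where A: "countable A" "A \<subseteq> sets lborel" "\<Union> A = space lborel"
    "\<forall>a\<in>A. emeasure lborel a \<noteq> \<infinity>"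
    using sigma_finite_measure.sigma_finite_countable[OF sigma_finite_lborel] by metis
  show "\<exists>A::'a set set. countable A \<and> A \<subseteq> sets lebesgue \<and> \<Union> A = space lebesgue \<and>
      (\<forall>a\<in>A. emeasure lebesgue a \<noteq> \<infinity>)"
    using A by (intro exI[of _ A]) auto
qed

interpretation leb2: pair_sigma_finite "lebesgue :: (real^3) measure" "lebesgue :: (real^3) measure"
  by (simp add: pair_sigma_finite_def sigma_finite_lebesgue)

lemma borel_pair_lebesgue:
  assumes "k \<in> measurable (borel \<Otimes>\<^sub>M borel) borel"
  shows "k \<in> borel_measurable ((lebesgue :: (real^3) measure) \<Otimes>\<^sub>M (lebesgue :: (real^3) measure))"
proof -
  have id: "(\<lambda>x::real^3. x) \<in> lebesgue \<rightarrow>\<^sub>M borel"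
    using measurable_completion[of "\<lambda>x. x" lborel borel] by simp
  have "(\<lambda>p. (fst p, snd p)) \<in> (lebesgue :: (real^3) measure) \<Otimes>\<^sub>M (lebesgue :: (real^3) measure) \<rightarrow>\<^sub>M borel \<Otimes>\<^sub>M borel"
    by (intro measurable_Pair measurable_compose[OF measurable_fst id] measurable_compose[OF measurable_snd id])
  from measurable_compose[OF this assms] show ?thesis by simp
qed

text \<open>Absolute integrability is demanded as an iterated nonnegative integral, the form in
  which the kernel estimates deliver it.\<close>

lemma Fubini_lebesgue:
  fixes f :: "real^3 \<Rightarrow> real^3 \<Rightarrow> 'b::{banach, second_countable_topology}"
  assumes m: "(\<lambda>(x, y). f x y) \<in> borel_measurable (lebesgue \<Otimes>\<^sub>M lebesgue)"
    and fin: "(\<integral>\<^sup>+x. \<integral>\<^sup>+y. norm (f x y) \<partial>lebesgue \<partial>lebesgue) < \<infinity>"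
  shows "(LINT x|lebesgue. LINT y|lebesgue. f x y) = (LINT y|lebesgue. LINT x|lebesgue. f x y)"
    and "integrable lebesgue (\<lambda>x. LINT y|lebesgue. f x y)"
    and "integrable lebesgue (\<lambda>y. LINT x|lebesgue. f x y)"
proof -
  have "(\<integral>\<^sup>+p. norm (case p of (x, y) \<Rightarrow> f x y) \<partial>(lebesgue \<Otimes>\<^sub>M lebesgue)) < \<infinity>"
    using fin by (subst sigma_finite_measure.nn_integral_fst[OF sigma_finite_lebesgue, symmetric]) (use m in auto)
  then have int: "integrable (lebesgue \<Otimes>\<^sub>M lebesgue) (\<lambda>(x, y). f x y)"
    using m by (intro integrableI_bounded) auto
  show "(LINT x|lebesgue. LINT y|lebesgue. f x y) = (LINT y|lebesgue. LINT x|lebesgue. f x y)"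
    using leb2.Fubini_integral[of f] int by simp
  show "integrable lebesgue (\<lambda>x. LINT y|lebesgue. f x y)"
    using leb2.integrable_fst[OF int] .
  show "integrable lebesgue (\<lambda>y. LINT x|lebesgue. f x y)"
    using leb2.integrable_snd[OF int] .
qed

lemma lebesgue_integral_borel:
  fixes f :: "real^3 \<Rightarrow> 'b::{banach, second_countable_topology}"
  assumes "f \<in> borel_measurable borel"
  shows "(LINT x|lebesgue. f x) = (LINT x|lborel. f x)" "integrable lebesgue f \<longleftrightarrow> integrable lborel f"
  using assms integral_completion[of f lborel] integrable_completion[of f lborel] by simp_all

section \<open>Differentiation of convolutions\<close>

lemma mean_value_nabla:
  assumes "smooth \<phi>"
  shows "\<exists>s. 0 < s \<and> s < 1 \<and> \<phi> (x + h) - \<phi> x = nabla \<phi> (x + s *\<^sub>R h) \<bullet> h"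
  using MVT2[of 0 1 "\<lambda>s. \<phi> (x + s *\<^sub>R h)", OF _ has_real_derivative_line[OF smooth_differentiable[OF assms]]]
  by auto

lemma test_function_Lipschitz:
  assumes "test_function \<phi>"
  obtains L where "L > 0" "\<And>x y. \<bar>\<phi> y - \<phi> x\<bar> \<le> L * norm (y - x)"
proof -
  have "\<exists>C>0. \<forall>x. \<bar>partial_derivative i \<phi> x\<bar> \<le> C" for i
  proof -
    obtain C M where "C > 0" "\<And>x. \<bar>partial_derivative i \<phi> x\<bar> \<le> C * indicator (cball 0 M) x"
      using test_function_bound[OF test_function_partial[OF assms]] by metis
    moreover have "C * indicator (cball 0 M) x \<le> C" for x :: "real^3"
      using \<open>C > 0\<close> by (simp add: indicator_def)
    ultimately show ?thesis by (meson order_trans)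
  qed
  then obtain C where C: "\<And>i. C i > 0" "\<And>i x. \<bar>partial_derivative i \<phi> x\<bar> \<le> C i" by metis
  have nb: "norm (nabla \<phi> x) \<le> (\<Sum>i\<in>UNIV. C i)" for x
  proof -
    have "norm (nabla \<phi> x) \<le> (\<Sum>i\<in>UNIV. \<bar>nabla \<phi> x $ i\<bar>)" by (rule norm_le_l1_cart)
    also have "\<dots> \<le> (\<Sum>i\<in>UNIV. C i)" by (intro sum_mono) (simp add: C)
    finally show ?thesis .
  qed
  have "\<bar>\<phi> y - \<phi> x\<bar> \<le> (\<Sum>i\<in>UNIV. C i) * norm (y - x)" for x y
  proof -
    obtain s where "\<phi> (x + (y - x)) - \<phi> x = nabla \<phi> (x + s *\<^sub>R (y - x)) \<bullet> (y - x)"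
      using mean_value_nabla[OF test_function_smooth[OF assms]] by blast
    then have "\<bar>\<phi> y - \<phi> x\<bar> \<le> norm (nabla \<phi> (x + s *\<^sub>R (y - x))) * norm (y - x)"
      using Cauchy_Schwarz_ineq2 by simp
    also have "\<dots> \<le> (\<Sum>i\<in>UNIV. C i) * norm (y - x)"
      by (intro mult_right_mono nb) auto
    finally show ?thesis .
  qed
  moreover have "(\<Sum>i\<in>UNIV. C i) > 0" using C(1) by (intro sum_pos) auto
  ultimately show ?thesis using that by blast
qed

text \<open>The mean value theorem reduces the remainder to an increment of the gradient, which is
  Lipschitz. For \<open>norm h \<le> 1\<close> the remainder vanishes off a ball independent of
  \<open>h\<close>, and the indicator records this: the bound can be integrated against a function
  that is only locally integrable.\<close>

lemma test_function_Taylor: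
  assumes "test_function \<phi>"
  obtains C M where "\<And>x h. norm h \<le> 1 \<Longrightarrow>
    \<bar>\<phi> (x + h) - \<phi> x - nabla \<phi> x \<bullet> h\<bar> \<le> C * (norm h)\<^sup>2 * indicator (cball 0 M) x"
proof -
  have sm: "smooth \<phi>" by (rule test_function_smooth[OF assms])
  have "\<exists>L>0. \<forall>x y. \<bar>partial_derivative i \<phi> y - partial_derivative i \<phi> x\<bar> \<le> L * norm (y - x)" for i
    using test_function_Lipschitz[OF test_function_partial[OF assms]] by metis
  then obtain L where L: "\<And>i. L i > 0"
    "\<And>i x y. \<bar>partial_derivative i \<phi> y - partial_derivative i \<phi> x\<bar> \<le> L i * norm (y - x)" by metis
  define C where "C = (\<Sum>i\<in>UNIV. L i)"
  have "C > 0" unfolding C_def using L(1) by (intro sum_pos) auto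
  have nb: "norm (nabla \<phi> y - nabla \<phi> x) \<le> C * norm (y - x)" for x y
  proof -
    have "norm (nabla \<phi> y - nabla \<phi> x) \<le> (\<Sum>i\<in>UNIV. \<bar>(nabla \<phi> y - nabla \<phi> x) $ i\<bar>)"
      by (rule norm_le_l1_cart)
    also have "\<dots> \<le> (\<Sum>i\<in>UNIV. L i * norm (y - x))"
      by (intro sum_mono) (simp add: L)
    finally show ?thesis by (simp add: C_def sum_distrib_right)
  qed
  obtain M where "\<And>x. \<phi> x \<noteq> 0 \<Longrightarrow> norm x \<le> M"
    using assms by (auto simp: test_function_def bounded_iff)
  then have M: "{x. \<phi> x \<noteq> 0} \<subseteq> cball 0 M" by auto
  then have M': "closure {x. \<phi> x \<noteq> 0} \<subseteq> cball 0 M" by (intro closure_minimal) auto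
  have zero: "\<phi> x = 0" "nabla \<phi> x = 0" if "norm x > M" for x
    using that M M' partial_derivative_support[OF sm, of _ x] by (force simp: vec_eq_iff)+
  have "\<bar>\<phi> (x + h) - \<phi> x - nabla \<phi> x \<bullet> h\<bar> \<le> C * (norm h)\<^sup>2 * indicator (cball 0 (M + 1)) x"
    if h: "norm h \<le> 1" for x h
  proof (cases "norm x \<le> M + 1")
    case True
    obtain s where s: "0 < s" "s < 1" "\<phi> (x + h) - \<phi> x = nabla \<phi> (x + s *\<^sub>R h) \<bullet> h"
      using mean_value_nabla[OF sm] by blast
    have "\<bar>\<phi> (x + h) - \<phi> x - nabla \<phi> x \<bullet> h\<bar> = \<bar>(nabla \<phi> (x + s *\<^sub>R h) - nabla \<phi> x) \<bullet> h\<bar>"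
      using s by (simp add: inner_diff_left)
    also have "\<dots> \<le> norm (nabla \<phi> (x + s *\<^sub>R h) - nabla \<phi> x) * norm h"
      by (rule Cauchy_Schwarz_ineq2)
    also have "\<dots> \<le> C * norm (s *\<^sub>R h) * norm h"
      using nb[of "x + s *\<^sub>R h" x] by (intro mult_right_mono) auto
    also have "\<dots> \<le> C * norm h * norm h"
      using s \<open>C > 0\<close> by (intro mult_right_mono mult_left_mono) (auto simp: mult_left_le_one_le)
    finally show ?thesis using True by (simp add: power2_eq_square)
  next
    case False
    then have "norm (x + h) > M" using norm_triangle_ineq4[of "x + h" h] h by simp
    then show ?thesis using False zero by simp
  qed
  then show ?thesis using that by blast
qed

definition conv :: "(real^3 \<Rightarrow> real) \<Rightarrow> (real^3 \<Rightarrow> real) \<Rightarrow> real^3 \<Rightarrow> real" where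
  "conv v \<phi> x = (LINT z|lebesgue. \<phi> (x - z) * v z)"

lemma test_function_reflect: "test_function \<phi> \<Longrightarrow> test_function (\<lambda>z. \<phi> (x - z))"
  using test_function_affine[of \<phi> "-1" x] by simp

lemma conv_integrable:
  assumes "locally_integrable v" "test_function \<phi>"
  shows "integrable lebesgue (\<lambda>z. \<phi> (x - z) * v z)"
  using test_function_mult_integrable[OF assms(1) test_function_reflect[OF assms(2)]] by simp

lemma has_derivative_if_quadratic_remainder:
  fixes f :: "'a::real_normed_vector \<Rightarrow> real"
  assumes "bounded_linear D" "\<And>h. norm h \<le> 1 \<Longrightarrow> \<bar>f (x + h) - f x - D h\<bar> \<le> K * (norm h)\<^sup>2"
  shows "(f has_derivative D) (at x)"
  unfolding has_derivative_at
proof (intro conjI assms(1))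
  show "(\<lambda>h. norm (f (x + h) - f x - D h) / norm h) \<midarrow>0\<rightarrow> 0"
  proof (rule tendsto_sandwich[where f = "\<lambda>h. 0" and h = "\<lambda>h. \<bar>K\<bar> * norm h"])
    show "((\<lambda>h::'a. \<bar>K\<bar> * norm h) \<longlongrightarrow> 0) (at 0)"
      by (rule tendsto_mult_right_zero[OF tendsto_norm_zero[OF tendsto_ident_at]])
    have "norm (f (x + h) - f x - D h) / norm h \<le> \<bar>K\<bar> * norm h" if h: "norm h < 1" for h
    proof (cases "h = 0")
      case False
      have "norm (f (x + h) - f x - D h) \<le> \<bar>K\<bar> * (norm h)\<^sup>2"
        using order_trans[OF assms(2)[of h] mult_right_mono[OF abs_ge_self[of K]]] h by simp
      then show ?thesis using False by (simp add: divide_simps power2_eq_square mult.assoc)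
    qed simp
    then show "\<forall>\<^sub>F h in at 0. norm (f (x + h) - f x - D h) / norm h \<le> \<bar>K\<bar> * norm h"
      unfolding eventually_at by (intro exI[of _ 1]) auto
  qed auto
qed

text \<open>The Taylor remainder of \<phi>, integrated against \<open>v\<close>, stays quadratic in
  \<open>h\<close>: its support is confined to one ball, over which \<open>v\<close> is integrable.
  The derivative falls entirely on \<phi>.\<close>

lemma conv_has_derivative:
  assumes v: "locally_integrable v" and \<phi>: "test_function \<phi>"
  shows "(conv v \<phi> has_derivative (\<lambda>h. \<Sum>i\<in>UNIV. h $ i * conv v (partial_derivative i \<phi>) x)) (at x)"
proof -
  obtain C M where CM: "\<And>x h. norm h \<le> 1 \<Longrightarrow>
    \<bar>\<phi> (x + h) - \<phi> x - nabla \<phi> x \<bullet> h\<bar> \<le> C * (norm h)\<^sup>2 * indicator (cball 0 M) x"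
    using test_function_Taylor[OF \<phi>] by metis
  define B where "B = (LINT z|lebesgue. \<bar>indicator (cball x M) z * v z\<bar>)"
  have intB: "integrable lebesgue (\<lambda>z. \<bar>indicator (cball x M) z * v z\<bar>)"
    using v by (intro integrable_abs) (simp add: locally_integrable_iff)
  show ?thesis
  proof (rule has_derivative_if_quadratic_remainder)
    show "bounded_linear (\<lambda>h. \<Sum>i\<in>UNIV. h $ i * conv v (partial_derivative i \<phi>) x)"
      by (intro bounded_linear_sum bounded_linear_mult_const bounded_linear_vec_nth)
    fix h :: "real^3" assume h: "norm h \<le> 1"
    define r where "r y = \<phi> (y + h) - \<phi> y - nabla \<phi> y \<bullet> h" for y
    have I: "integrable lebesgue (\<lambda>z. partial_derivative i \<phi> (x - z) * v z)" for i
      by (rule conv_integrable[OF v test_function_partial[OF \<phi>]])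
    have "(\<Sum>i\<in>UNIV. h $ i * conv v (partial_derivative i \<phi>) x) =
        (LINT z|lebesgue. (\<Sum>i\<in>UNIV. h $ i * (partial_derivative i \<phi> (x - z) * v z)))"
      unfolding conv_def using I by (subst Bochner_Integration.integral_sum) auto
    moreover have "(\<lambda>z. (\<Sum>i\<in>UNIV. h $ i * (partial_derivative i \<phi> (x - z) * v z))) =
        (\<lambda>z. (nabla \<phi> (x - z) \<bullet> h) * v z)"
      by (auto simp: inner_vec_def sum_distrib_left sum_distrib_right mult_ac)
    moreover have "integrable lebesgue (\<lambda>z. (\<Sum>i\<in>UNIV. h $ i * (partial_derivative i \<phi> (x - z) * v z)))"
      using I by (intro Bochner_Integration.integrable_sum) auto
    ultimately have D: "(\<Sum>i\<in>UNIV. h $ i * conv v (partial_derivative i \<phi>) x) =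
        (LINT z|lebesgue. (nabla \<phi> (x - z) \<bullet> h) * v z)"
        "integrable lebesgue (\<lambda>z. (nabla \<phi> (x - z) \<bullet> h) * v z)" by simp_all
    have ints: "integrable lebesgue (\<lambda>z. \<phi> (x + h - z) * v z)" "integrable lebesgue (\<lambda>z. \<phi> (x - z) * v z)"
      by (intro conv_integrable v \<phi>)+
    have int_diff: "integrable lebesgue (\<lambda>z. \<phi> (x + h - z) * v z - \<phi> (x - z) * v z)"
      by (intro Bochner_Integration.integrable_diff ints)
    have r_eq: "\<phi> (x + h - z) * v z - \<phi> (x - z) * v z - (nabla \<phi> (x - z) \<bullet> h) * v z = r (x - z) * v z" for z
      unfolding r_def by (simp add: algebra_simps)
    have r_int: "integrable lebesgue (\<lambda>z. r (x - z) * v z)"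
      using Bochner_Integration.integrable_diff[OF int_diff D(2)] by (simp only: r_eq)
    have "conv v \<phi> (x + h) - conv v \<phi> x - (\<Sum>i\<in>UNIV. h $ i * conv v (partial_derivative i \<phi>) x) =
        (LINT z|lebesgue. r (x - z) * v z)"
      unfolding D(1) unfolding conv_def Bochner_Integration.integral_diff[OF ints, symmetric] Bochner_Integration.integral_diff[OF int_diff D(2), symmetric]
      by (simp only: r_eq)
    also have "\<bar>\<dots>\<bar> \<le> (LINT z|lebesgue. \<bar>r (x - z) * v z\<bar>)"
      by (rule integral_abs_bound)
    also have "\<dots> \<le> (LINT z|lebesgue. C * (norm h)\<^sup>2 * \<bar>indicator (cball x M) z * v z\<bar>)"
    proof (rule integral_mono)
      show "\<bar>r (x - z) * v z\<bar> \<le> C * (norm h)\<^sup>2 * \<bar>indicator (cball x M) z * v z\<bar>" for z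
      proof -
        have "\<bar>r (x - z)\<bar> \<le> C * (norm h)\<^sup>2 * indicator (cball 0 M) (x - z)"
          unfolding r_def by (rule CM[OF h])
        also have "indicator (cball 0 M) (x - z) = (indicator (cball x M) z :: real)"
          by (auto simp: indicator_def dist_norm norm_minus_commute)
        finally show ?thesis
          using mult_right_mono[of "\<bar>r (x - z)\<bar>" _ "\<bar>v z\<bar>"] by (fastforce simp: abs_mult mult.assoc)
      qed
    qed (use intB r_int in auto)
    also have "\<dots> = (C * B) * (norm h)\<^sup>2" by (simp add: B_def)
    finally show "\<bar>conv v \<phi> (x + h) - conv v \<phi> x - (\<Sum>i\<in>UNIV. h $ i * conv v (partial_derivative i \<phi>) x)\<bar>
        \<le> C * B * (norm h)\<^sup>2" .
  qed
qed

lemma partial_derivative_conv: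
  assumes "locally_integrable v" "test_function \<phi>"
  shows "partial_derivative i (conv v \<phi>) = conv v (partial_derivative i \<phi>)"
  by (rule ext, subst partial_derivative_eq[OF conv_has_derivative[OF assms]])
    (simp add: axis_def if_distrib[where f = "\<lambda>x. x * _"] cong: if_cong)

lemma smooth_conv:
  assumes "locally_integrable v" "test_function \<phi>"
  shows "smooth (conv v \<phi>)"
proof (rule smooth_coinduct[where P = "\<lambda>\<psi>. \<exists>\<phi>. test_function \<phi> \<and> \<psi> = conv v \<phi>"])
  show "\<psi> differentiable (at x)" if "\<exists>\<phi>. test_function \<phi> \<and> \<psi> = conv v \<phi>" for \<psi> x
    using that conv_has_derivative[OF assms(1)] unfolding differentiable_def by blast
  show "\<exists>\<phi>'. test_function \<phi>' \<and> partial_derivative i \<psi> = conv v \<phi>'"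
    if "\<exists>\<phi>. test_function \<phi> \<and> \<psi> = conv v \<phi>" for \<psi> i
    using that partial_derivative_conv[OF assms(1)] test_function_partial by blast
qed (use assms in blast)

text \<open>The integrals of the test functions approximating a unit cube tend to its volume 1. One
  of them is therefore positive, and dividing by it normalises the function.\<close>

lemma ex_test_function_integral_1: "\<exists>\<eta>. test_function \<eta> \<and> (LINT x|lebesgue. \<eta> x) = 1"
proof -
  obtain \<phi> where \<phi>: "\<And>n. test_function (\<phi> n)" "\<And>n x. 0 \<le> \<phi> n x"
    "\<And>n x. \<phi> n x \<le> indicator (cbox 0 (1::real^3)) x"
    "\<And>x. (\<lambda>n. \<phi> n x) \<longlonglongrightarrow> indicator (box 0 (1::real^3)) x"
    using box_test_functions[of 0 1] by metis
  have "(\<lambda>n. LINT x|lborel. \<phi> n x) \<longlonglongrightarrow> (LINT x|lborel. indicator (box 0 (1::real^3)) x)"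
  proof (rule integral_dominated_convergence[where w = "indicator (cbox 0 (1::real^3))"])
    show "\<phi> n \<in> borel_measurable lborel" for n
      using smooth_borel[OF test_function_smooth[OF \<phi>(1)]] by simp
    show "integrable lborel (indicator (cbox 0 (1::real^3)) :: _ \<Rightarrow> real)"
      by (intro integrable_real_indicator) (auto simp: emeasure_lborel_cbox_eq)
  qed (use \<phi> in auto)
  moreover have "(LINT x|lborel. indicator (box 0 (1::real^3)) x) = (1::real)"
  proof -
    have "(LINT x|lborel. indicator (box 0 (1::real^3)) x) = measure lborel (box 0 (1::real^3))" by simp
    also have "\<dots> = (\<Prod>b\<in>Basis. (1 - 0) \<bullet> (b::real^3))"
      by (subst measure_lborel_box_eq) (auto simp: Basis_vec_def inner_axis)
    also have "\<dots> = 1" by (rule prod.neutral) (auto simp: Basis_vec_def inner_axis)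
    finally show ?thesis .
  qed
  ultimately have "\<forall>\<^sub>F n in sequentially. (LINT x|lborel. \<phi> n x) > 0"
    by (simp add: order_tendstoD)
  then obtain n where n: "(LINT x|lborel. \<phi> n x) > 0" by (auto simp: eventually_sequentially)
  show ?thesis
  proof (intro exI[of _ "\<lambda>x. inverse (LINT x|lborel. \<phi> n x) * \<phi> n x"] conjI test_function_cmult \<phi>)
    show "(LINT x|lebesgue. inverse (LINT x|lborel. \<phi> n x) * \<phi> n x) = 1"
      using n lebesgue_integral_borel(1)[OF smooth_borel[OF test_function_smooth[OF \<phi>(1)[of n]]]] by simp
  qed
qed

text \<open>All derivatives of \<open>conv v \<phi>\<close> pair \<open>v\<close> with a derivative
  of a test function, so \<open>conv v \<phi>\<close> is constant. With a test function \<eta> of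
  integral 1, Fubini's theorem gives \<open>conv v \<phi> 0 = \<integral> \<eta> (conv v \<phi>) =
  \<integral> \<phi>(x) (conv v \<eta>')(- x) dx\<close>, where \<eta>' is the reflection of \<eta>;
  the inner convolution is again a constant \<open>c\<close>. So \<open>v - c\<close> vanishes
  against all test functions.\<close>

lemma weak_gradient_0_imp_constant:
  fixes v :: "real^3 \<Rightarrow> real"
  assumes v: "locally_integrable v"
    and zero: "\<And>\<phi> i. test_function \<phi> \<Longrightarrow> (LINT x|lebesgue. partial_derivative i \<phi> x * v x) = 0"
  shows "\<exists>c. AE x in lebesgue. v x = c"
proof -
  have const: "conv v \<phi> x = conv v \<phi> 0" if \<phi>: "test_function \<phi>" for \<phi> x
  proof -
    have "conv v (partial_derivative i \<phi>) x = 0" for i x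
    proof -
      have "partial_derivative i (\<lambda>z. \<phi> (x - z)) = (\<lambda>z. - partial_derivative i \<phi> (x - z))"
        using partial_derivative_affine(1)[OF smooth_differentiable[OF test_function_smooth[OF \<phi>]], of i "-1" x]
        by simp
      then show ?thesis
        using zero[OF test_function_reflect[OF \<phi>], of i x] by (simp add: conv_def)
    qed
    then have "(conv v \<phi> has_derivative (\<lambda>h. 0)) (at x within UNIV)" for x
      using conv_has_derivative[OF v \<phi>, of x] by simp
    then have "\<exists>c. \<forall>x\<in>UNIV. conv v \<phi> x = c"
      by (intro has_derivative_zero_constant) auto
    then show ?thesis by auto
  qed
  \<comment> \<open>The sign \<open>s\<close> covers both uses of Fubini's theorem, before the
    substitution with \<open>s = 1\<close> and after it with \<open>s = -1\<close>.\<close>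
  have swap: "(LINT x|lebesgue. LINT z|lebesgue. \<eta> x * (\<psi> (s *\<^sub>R x - z) * v z)) =
      (LINT z|lebesgue. LINT x|lebesgue. \<eta> x * (\<psi> (s *\<^sub>R x - z) * v z))"
    if \<eta>: "test_function \<eta>" and \<psi>: "test_function \<psi>" and s: "\<bar>s\<bar> = 1" for \<eta> \<psi> s
  proof -
    obtain C M where CM: "C > 0" "M > 0" "\<And>x. \<bar>\<eta> x\<bar> \<le> C * indicator (cball 0 M) x"
      using test_function_bound[OF \<eta>] by metis
    obtain C' M' where CM': "C' > 0" "M' > 0" "\<And>x. \<bar>\<psi> x\<bar> \<le> C' * indicator (cball 0 M') x"
      using test_function_bound[OF \<psi>] by metis
    have mb [measurable]: "\<eta> \<in> borel_measurable borel" "\<psi> \<in> borel_measurable borel"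
      using \<eta> \<psi> by (auto intro: smooth_borel test_function_smooth)
    have vm: "v \<in> borel_measurable lebesgue" by (rule locally_integrable_measurable[OF v])
    let ?J = "\<integral>\<^sup>+z. ennreal \<bar>indicator (cball 0 (M + M')) z * v z\<bar> \<partial>lebesgue"
    have "integrable lebesgue (\<lambda>z. \<bar>indicator (cball 0 (M + M')) z * v z\<bar>)"
      using v by (intro integrable_abs) (simp add: locally_integrable_iff)
    then have J: "?J < \<infinity>" by (simp add: integrable_iff_bounded)
    \<comment> \<open>Where neither test function vanishes, \<open>z\<close> is confined to the ball
      of radius \<open>M + M'\<close>, since \<open>s *\<^sub>R x\<close> has the norm of
      \<open>x\<close>.\<close>
    have bd: "norm (\<eta> x * (\<psi> (s *\<^sub>R x - z) * v z)) \<le>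
        C * indicator (cball 0 M) x * (C' * \<bar>indicator (cball 0 (M + M')) z * v z\<bar>)" for x z
    proof (cases "norm x \<le> M \<and> norm (s *\<^sub>R x - z) \<le> M'")
      case True
      then have "norm z \<le> M + M'" using norm_triangle_ineq4[of "s *\<^sub>R x" "s *\<^sub>R x - z"] s by simp
      moreover have "\<bar>\<eta> x\<bar> \<le> C" "\<bar>\<psi> (s *\<^sub>R x - z)\<bar> \<le> C'"
        using CM(3)[of x] CM'(3)[of "s *\<^sub>R x - z"] True by (auto simp: indicator_def)
      ultimately show ?thesis using True CM CM'
        by (auto simp: abs_mult intro!: mult_mono)
    next
      case False
      then have "\<eta> x = 0 \<or> \<psi> (s *\<^sub>R x - z) = 0"
        using CM(3)[of x] CM'(3)[of "s *\<^sub>R x - z"] by auto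
      then show ?thesis using CM CM' by (auto intro!: mult_nonneg_nonneg)
    qed
    show ?thesis
    proof (rule Fubini_lebesgue(1))
      have "(\<lambda>(x, z). \<eta> x * (\<psi> (s *\<^sub>R x - z) * v z)) =
          (\<lambda>p. (case p of (x, z) \<Rightarrow> \<eta> x * \<psi> (s *\<^sub>R x - z)) * v (snd p))" by (auto simp: fun_eq_iff)
      moreover have "(\<lambda>p. (case p of (x, z) \<Rightarrow> \<eta> x * \<psi> (s *\<^sub>R x - z)) * v (snd p)) \<in> borel_measurable (lebesgue \<Otimes>\<^sub>M lebesgue)"
        by (intro borel_measurable_times borel_pair_lebesgue measurable_compose[OF measurable_snd vm]) simp
      ultimately show "(\<lambda>(x, z). \<eta> x * (\<psi> (s *\<^sub>R x - z) * v z)) \<in> borel_measurable (lebesgue \<Otimes>\<^sub>M lebesgue)"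
        by simp
      have "(\<integral>\<^sup>+x. \<integral>\<^sup>+z. ennreal (norm (\<eta> x * (\<psi> (s *\<^sub>R x - z) * v z))) \<partial>lebesgue \<partial>lebesgue)
        \<le> (\<integral>\<^sup>+x. \<integral>\<^sup>+z. ennreal (C * indicator (cball 0 M) (x::real^3) * (C' * \<bar>indicator (cball 0 (M + M')) z * v z\<bar>)) \<partial>lebesgue \<partial>lebesgue)"
        by (intro nn_integral_mono ennreal_leI bd)
      also have "\<dots> = (\<integral>\<^sup>+x. ennreal (C * C' * indicator (cball 0 M) (x::real^3)) * ?J \<partial>lebesgue)"
      proof (rule nn_integral_cong)
        fix x :: "real^3"
        have "(\<integral>\<^sup>+z. ennreal (C * indicator (cball 0 M) x * (C' * \<bar>indicator (cball 0 (M + M')) z * v z\<bar>)) \<partial>lebesgue) =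
          (\<integral>\<^sup>+z. ennreal (C * C' * indicator (cball 0 M) x) * ennreal \<bar>indicator (cball 0 (M + M')) z * v z\<bar> \<partial>lebesgue)"
          using CM CM' by (intro nn_integral_cong) (simp add: ennreal_mult'[symmetric] mult_ac)
        also have "\<dots> = ennreal (C * C' * indicator (cball 0 M) x) * ?J"
          by (rule nn_integral_cmult)
            (intro measurable_compose[OF _ measurable_ennreal] borel_measurable_abs borel_measurable_times vm
              borel_measurable_indicator, simp)
        finally show "(\<integral>\<^sup>+z. ennreal (C * indicator (cball 0 M) x * (C' * \<bar>indicator (cball 0 (M + M')) z * v z\<bar>)) \<partial>lebesgue) =
          ennreal (C * C' * indicator (cball 0 M) x) * ?J" .
      qed
      also have "\<dots> = (\<integral>\<^sup>+x. ennreal (norm (C * C' * indicator (cball 0 M) (x::real^3))) \<partial>lborel) * ?J"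
      proof -
        have "(\<integral>\<^sup>+x. ennreal (C * C' * indicator (cball 0 M) (x::real^3)) * ?J \<partial>lebesgue) =
            (\<integral>\<^sup>+x. ennreal (norm (C * C' * indicator (cball 0 M) (x::real^3))) * ?J \<partial>lborel)"
          unfolding nn_integral_completion using CM(1) CM'(1) by (intro nn_integral_cong) simp
        also have "\<dots> = (\<integral>\<^sup>+x. ennreal (norm (C * C' * indicator (cball 0 M) (x::real^3))) \<partial>lborel) * ?J"
          using measurable_compose[OF measurable_compose[OF borel_measurable_integrable[OF
            integrable_indicator_cball[of "C * C'" M]] borel_measurable_norm] measurable_ennreal]
          by (rule nn_integral_multc)
        finally show ?thesis .
      qed
      also have "\<dots> < \<infinity>"
        using J integrable_indicator_cball[of "C * C'" M] unfolding integrable_iff_bounded infinity_ennreal_def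
        by (intro ennreal_mult_less_top[THEN iffD2] disjI2 conjI) auto
      finally show "(\<integral>\<^sup>+x. \<integral>\<^sup>+z. ennreal (norm (\<eta> x * (\<psi> (s *\<^sub>R x - z) * v z))) \<partial>lebesgue \<partial>lebesgue) < \<infinity>" .
    qed
  qed
  obtain \<eta> where \<eta>: "test_function \<eta>" "(LINT x|lebesgue. \<eta> x) = 1"
    using ex_test_function_integral_1 by blast
  define \<eta>' where "\<eta>' z = \<eta> (- z)" for z
  have \<eta>': "test_function \<eta>'" using test_function_reflect[OF \<eta>(1), of 0] by (simp add: \<eta>'_def[abs_def])
  define c where "c = conv v \<eta>' 0"
  have main: "conv v \<phi> 0 = c * (LINT x|lebesgue. \<phi> x)" if \<phi>: "test_function \<phi>" for \<phi>
  proof -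
    have mb [measurable]: "\<eta> \<in> borel_measurable borel" "\<phi> \<in> borel_measurable borel"
      using \<eta> \<phi> by (auto intro: smooth_borel test_function_smooth)
    have "(\<lambda>x. \<eta> x * conv v \<phi> x) = (\<lambda>x. \<eta> x * conv v \<phi> 0)"
      by (intro ext arg_cong[where f = "times _"] const \<phi>)
    then have "conv v \<phi> 0 = (LINT x|lebesgue. \<eta> x * conv v \<phi> x)"
      using \<eta>(2) by simp
    also have "\<dots> = (LINT x|lebesgue. LINT z|lebesgue. \<eta> x * (\<phi> (1 *\<^sub>R x - z) * v z))"
      by (simp add: conv_def)
    also have "\<dots> = (LINT z|lebesgue. LINT x|lebesgue. \<eta> x * (\<phi> (1 *\<^sub>R x - z) * v z))"
      by (rule swap[OF \<eta>(1) \<phi>]) simp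
    \<comment> \<open>The substitution of \<open>z + x\<close> for \<open>x\<close> removes the
      shift from \<phi> and puts it into \<eta>, which becomes the reflected function at
      \<open>- x - z\<close>.\<close>
    also have "\<dots> = (LINT z|lebesgue. LINT x|lebesgue. \<phi> x * (\<eta>' (-1 *\<^sub>R x - z) * v z))"
    proof (rule Bochner_Integration.integral_cong[OF refl])
      fix z
      have "(LINT x|lebesgue. \<eta> x * (\<phi> (1 *\<^sub>R x - z) * v z)) = (LINT x|lborel. \<eta> x * (\<phi> (1 *\<^sub>R x - z) * v z))"
        by (rule lebesgue_integral_borel) simp
      also have "\<dots> = (LINT x|lborel. \<eta> (z + 1 *\<^sub>R x) * (\<phi> (1 *\<^sub>R (z + 1 *\<^sub>R x) - z) * v z))"
        by (rule lborel_integral_affine(1)[symmetric]) auto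
      also have "\<dots> = (LINT x|lborel. \<phi> x * (\<eta>' (-1 *\<^sub>R x - z) * v z))"
        by (intro Bochner_Integration.integral_cong) (auto simp: \<eta>'_def add.commute mult_ac)
      also have "\<dots> = (LINT x|lebesgue. \<phi> x * (\<eta>' (-1 *\<^sub>R x - z) * v z))"
        by (rule lebesgue_integral_borel(1)[symmetric]) (simp add: \<eta>'_def)
      finally show "(LINT x|lebesgue. \<eta> x * (\<phi> (1 *\<^sub>R x - z) * v z)) =
        (LINT x|lebesgue. \<phi> x * (\<eta>' (-1 *\<^sub>R x - z) * v z))" .
    qed
    also have "\<dots> = (LINT x|lebesgue. LINT z|lebesgue. \<phi> x * (\<eta>' (-1 *\<^sub>R x - z) * v z))"
      by (rule swap[OF \<phi> \<eta>', symmetric]) simp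
    also have "\<dots> = (LINT x|lebesgue. \<phi> x * conv v \<eta>' (- x))"
      by (simp add: conv_def)
    also have "\<dots> = (LINT x|lebesgue. \<phi> x * c)"
      unfolding c_def
      by (intro Bochner_Integration.integral_cong refl arg_cong[where f = "times _"] const \<eta>')
    finally show ?thesis by simp
  qed
  have loc_c: "locally_integrable (\<lambda>x. c)"
    unfolding locally_integrable_def by (auto intro!: absolutely_integrable_on_const lmeasurable_compact)
  have "AE x in lebesgue. v x - c = 0"
  proof (rule fundamental_lemma_real)
    show "locally_integrable (\<lambda>x. v x - c)"
      using v loc_c unfolding locally_integrable_def by (auto intro: set_integral_diff)
    fix \<phi> :: "real^3 \<Rightarrow> real" assume \<phi>: "test_function \<phi>"
    have I: "integrable lebesgue (\<lambda>x. \<phi> x * v x)" "integrable lebesgue (\<lambda>x. \<phi> x * c)"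
      using test_function_mult_integrable[OF v \<phi>] test_function_mult_integrable[OF loc_c \<phi>] by simp_all
    have b: "\<phi> \<in> borel_measurable borel" by (intro smooth_borel test_function_smooth \<phi>)
    have "(LINT x|lebesgue. \<phi> x * v x) = conv v (\<lambda>z. \<phi> (0 - z)) 0"
      by (simp add: conv_def)
    also have "\<dots> = c * (LINT x|lebesgue. \<phi> (0 - x))"
      by (rule main[OF test_function_reflect[OF \<phi>]])
    also have "(LINT x|lebesgue. \<phi> (0 - x)) = (LINT x|lborel. \<phi> (0 + (-1) *\<^sub>R x))"
      using b by (subst lebesgue_integral_borel(1)) auto
    also have "\<dots> = (LINT x|lborel. \<phi> x)"
      by (rule lborel_integral_affine(1)[OF b]) simp
    also have "\<dots> = (LINT x|lebesgue. \<phi> x)" by (rule lebesgue_integral_borel(1)[OF b, symmetric])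
    finally show "(LINT x|lebesgue. \<phi> x * (v x - c)) = 0"
      using I by (simp add: right_diff_distrib)
  qed
  then show ?thesis by (intro exI[of _ c]) (auto elim: eventually_mono)
qed

section \<open>The fundamental solution of the Laplacian\<close>

definition fund :: "real^3 \<Rightarrow> real" where "fund z = 1 / (4 * pi * norm z)"

text \<open>The classical gradient of \<open>fund\<close> away from 0. At 0 both kernels take the
  value 0, by division by 0.\<close>

definition fund_grad :: "real^3 \<Rightarrow> real^3" where "fund_grad z = - (1 / (4 * pi * norm z ^ 3)) *\<^sub>R z"

lemma borel_measurable_vec_nth [measurable]: "(\<lambda>z::real^3. z $ i) \<in> borel_measurable borel"
  by (intro borel_measurable_continuous_onI continuous_intros)

lemma borel_measurable_indicator_cball [measurable]:
  "(indicator (cball (0::real^3) M) :: _ \<Rightarrow> real) \<in> borel_measurable borel"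
  by (intro borel_measurable_indicator) simp

lemma newton_kernel_fund: "newton_kernel x y = fund (x - y)"
  by (simp add: newton_kernel_def fund_def)

lemma borel_measurable_fund [measurable]: "fund \<in> borel_measurable borel"
  unfolding fund_def[abs_def] by measurable

lemma borel_measurable_fund_grad [measurable]: "fund_grad \<in> borel_measurable borel"
  unfolding fund_grad_def[abs_def] by measurable

lemma fund_nonneg: "0 \<le> fund z" by (simp add: fund_def)

text \<open>As a power of the norm the kernel falls under the integrability results for
  \<open>norm z powr - s\<close>. The equation includes \<open>z = 0\<close>, where both sides are
  0.\<close>

lemma fund_powr: "fund z = norm z powr - 1 / (4 * pi)"
  using powr_minus_divide[of "norm z" 1] by (cases "z = 0") (simp_all add: fund_def)

lemma norm_fund_grad: "norm (fund_grad z) = norm z powr - 2 / (4 * pi)"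
proof (cases "z = 0")
  case False
  then have "norm z powr - 2 = 1 / (norm z)\<^sup>2"
    using powr_minus_divide[of "norm z" 2] by simp
  then show ?thesis using False
    by (simp add: fund_grad_def power3_eq_cube power2_eq_square field_simps)
qed (simp add: fund_grad_def)

lemma fund_grad_nth: "fund_grad z $ i = - (z $ i) / (4 * pi * norm z ^ 3)"
  by (simp add: fund_grad_def)

lemma abs_fund_grad_le: "\<bar>fund_grad z $ i\<bar> \<le> norm z powr - 2 / (4 * pi)"
  using component_le_norm_cart[of "fund_grad z" i] by (simp add: norm_fund_grad)

lemma norm_powr_integrable_cball:
  assumes "s < 3"
  shows "integrable lborel (\<lambda>z::real^3. norm z powr - s * indicator (cball 0 M) z)"
proof (cases "M \<ge> 0")
  case True
  have "(\<integral>\<^sup>+z. ennreal (norm (norm z powr - s * indicator (cball (0::real^3) M) z)) \<partial>lborel) =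
      (\<integral>\<^sup>+z. ennreal (norm z powr - s) * indicator (cball (0::real^3) M) z \<partial>lborel)"
    by (intro nn_integral_cong) (auto simp: indicator_def)
  then show ?thesis
    using nn_integral_norm_powr_cball[OF assms True] by (intro integrableI_bounded) auto
qed (simp add: cball_empty)

lemma norm_powr_mult_integrable:
  assumes s: "s < 3" and m: "h \<in> borel_measurable borel" and b: "\<And>z. \<bar>h z\<bar> \<le> C * indicator (cball (0::real^3) M) z"
  shows "integrable lborel (\<lambda>z. norm z powr - s * h z)"
proof (rule Bochner_Integration.integrable_bound)
  show "integrable lborel (\<lambda>z::real^3. C * (norm z powr - s * indicator (cball 0 M) z))"
    by (intro integrable_mult_right norm_powr_integrable_cball s)
  show "(\<lambda>z. norm z powr - s * h z) \<in> borel_measurable lborel" using m by simp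
  have "norm (norm z powr - s * h z) \<le> norm (C * (norm z powr - s * indicator (cball 0 M) z))" for z
    using mult_left_mono[OF order_trans[OF b[of z] abs_ge_self], of "norm z powr - s"]
    by (simp add: abs_mult mult_ac)
  then show "AE z in lborel. norm (norm z powr - s * h z) \<le> norm (C * (norm z powr - s * indicator (cball 0 M) z))"
    by simp
qed

lemma test_function_norm_powr_integrable:
  assumes "s < 3" "test_function \<phi>"
  shows "integrable lborel (\<lambda>z. norm z powr - s * \<phi> z)"
proof -
  obtain C M where "\<And>x. \<bar>\<phi> x\<bar> \<le> C * indicator (cball 0 M) x" using test_function_bound[OF assms(2)] by metis
  from norm_powr_mult_integrable[OF assms(1) smooth_borel[OF test_function_smooth[OF assms(2)]] this] show ?thesis .
qed

lemma locally_integrable_fund: "locally_integrable fund"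
  unfolding locally_integrable_iff
proof (intro allI impI)
  fix K :: "(real^3) set" assume K: "compact K"
  then obtain M where "\<And>x. x \<in> K \<Longrightarrow> norm x \<le> M" by (meson bounded_iff compact_imp_bounded)
  then have "\<And>z. \<bar>indicator K z\<bar> \<le> (1::real) * indicator (cball 0 M) z" by (auto simp: indicator_def)
  from norm_powr_mult_integrable[OF _ _ this, of 1]
  have "integrable lborel (\<lambda>z::real^3. norm z powr - 1 * indicator K z)"
    using borel_measurable_indicator[OF borel_compact[OF K]] by simp
  then have "integrable lborel (\<lambda>z::real^3. norm z powr - 1 * indicator K z / (4 * pi))"
    by (rule integrable_divide_zero)
  then have "integrable lborel (\<lambda>x. indicator K x *\<^sub>R fund x)"
    by (simp add: fund_powr mult.commute)
  then show "integrable lebesgue (\<lambda>x. indicator K x *\<^sub>R fund x)"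
    using K by (subst lebesgue_integral_borel(2)) (auto intro: borel_compact)
qed

section \<open>The regularised kernel and its limit\<close>

lemma lborel_integral_scale:
  fixes f :: "real^3 \<Rightarrow> real"
  assumes [measurable]: "f \<in> borel_measurable borel" and e: "e > 0"
  shows "(LINT x|lborel. f x) = e ^ 3 * (LINT x|lborel. f (e *\<^sub>R x))"
proof -
  have "(LINT x|lborel. f x) = (LINT x|density (distr lborel borel (\<lambda>x::real^3. 0 + e *\<^sub>R x)) (\<lambda>_. ennreal (\<bar>e\<bar> ^ DIM(real^3))). f x)"
    using lborel_affine[of e "0::real^3"] e by simp
  also have "\<dots> = (LINT x|distr lborel borel (\<lambda>x::real^3. 0 + e *\<^sub>R x). \<bar>e\<bar> ^ 3 * f x)"
    by (subst integral_density) auto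
  also have "\<dots> = (LINT x|lborel. \<bar>e\<bar> ^ 3 * f (e *\<^sub>R x))"
    by (subst integral_distr) auto
  finally show ?thesis using e by simp
qed

text \<open>\<open>reg e\<close> is \<open>fund\<close> with \<open>norm z\<close> replaced by \<open>sqrt ((norm z)\<^sup>2 + e\<^sup>2)\<close>, and \<open>mollifier e\<close> is minus its Laplacian.\<close>

definition reg :: "real \<Rightarrow> real^3 \<Rightarrow> real" where
  "reg e z = ((norm z)\<^sup>2 + e\<^sup>2) powr (- 1 / 2) / (4 * pi)"

definition mollifier :: "real \<Rightarrow> real^3 \<Rightarrow> real" where
  "mollifier e z = 3 * e\<^sup>2 / (4 * pi) * ((norm z)\<^sup>2 + e\<^sup>2) powr (- 5 / 2)"

lemma reg_derivatives:
  assumes "e > 0"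
  shows "reg e differentiable (at z)"
    and "partial_derivative i (reg e) = (\<lambda>z. - (z $ i * ((norm z)\<^sup>2 + e\<^sup>2) powr (- 3 / 2) / (4 * pi)))"
    and "partial_derivative i (reg e) differentiable (at z)"
    and "partial_derivative i (partial_derivative i (reg e)) =
      (\<lambda>z. - (((norm z)\<^sup>2 + e\<^sup>2) powr (- 3 / 2) - 3 * (z $ i)\<^sup>2 * ((norm z)\<^sup>2 + e\<^sup>2) powr (- 5 / 2)) / (4 * pi))"
    and "continuous_on UNIV (partial_derivative i (partial_derivative i (reg e)))"
proof -
  have pos: "0 < (norm z)\<^sup>2 + e\<^sup>2" for z :: "real^3" using assms by (simp add: add_nonneg_pos)
  have q: "((\<lambda>z::real^3. (norm z)\<^sup>2 + e\<^sup>2) has_derivative (\<lambda>h. 2 * (z \<bullet> h))) (at z)" for z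
    unfolding power2_norm_eq_inner by (auto intro!: derivative_eq_intros simp: inner_commute)
  have qp: "((\<lambda>z::real^3. ((norm z)\<^sup>2 + e\<^sup>2) powr r) has_derivative
      (\<lambda>h. r * ((norm z)\<^sup>2 + e\<^sup>2) powr (r - 1) * (2 * (z \<bullet> h)))) (at z)" for r z
    using has_derivative_compose[OF q[of z], of "\<lambda>t. t powr r" "times (r * ((norm z)\<^sup>2 + e\<^sup>2) powr (r - 1))"]
      has_real_derivative_powr[OF pos[of z], of r]
    by (simp add: has_field_derivative_def)
  have d0: "(reg e has_derivative (\<lambda>h. - ((z \<bullet> h) * ((norm z)\<^sup>2 + e\<^sup>2) powr (- 3 / 2) / (4 * pi)))) (at z)" for z
    unfolding reg_def[abs_def]
    by (rule has_derivative_eq_rhs[OF has_derivative_divide[OF qp[of "- 1 / 2"] has_derivative_const]])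
      (auto simp: fun_eq_iff field_simps)
  then show "reg e differentiable (at z)" unfolding differentiable_def by blast
  show p: "partial_derivative i (reg e) = (\<lambda>z. - (z $ i * ((norm z)\<^sup>2 + e\<^sup>2) powr (- 3 / 2) / (4 * pi)))" for i
    by (rule ext, subst partial_derivative_eq[OF d0]) (simp add: inner_axis)
  have d1: "(partial_derivative i (reg e) has_derivative (\<lambda>h. - ((z $ i * (- 3 / 2 * ((norm z)\<^sup>2 + e\<^sup>2) powr (- 5 / 2) * (2 * (z \<bullet> h)))
      + h $ i * ((norm z)\<^sup>2 + e\<^sup>2) powr (- 3 / 2)) / (4 * pi)))) (at z)" for z
    unfolding p
    using has_derivative_minus[OF has_derivative_divide[OF has_derivative_mult[OF
      bounded_linear_imp_has_derivative[OF bounded_linear_vec_nth[of i]] qp[of "- 3 / 2"]] has_derivative_const[of "4 * pi"]]]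
    by (rule has_derivative_eq_rhs) (auto simp: fun_eq_iff field_simps)
  then show "partial_derivative i (reg e) differentiable (at z)" unfolding differentiable_def by blast
  show pp: "partial_derivative i (partial_derivative i (reg e)) =
      (\<lambda>z. - (((norm z)\<^sup>2 + e\<^sup>2) powr (- 3 / 2) - 3 * (z $ i)\<^sup>2 * ((norm z)\<^sup>2 + e\<^sup>2) powr (- 5 / 2)) / (4 * pi))"
  proof
    fix z :: "real^3"
    have e: "z \<bullet> axis i 1 = z $ i" "axis i (1::real) $ i = 1" by (simp_all add: inner_axis)
    have alg: "- ((a * (- 3 / 2 * p * (2 * a)) + q) / (4 * pi)) = - (q - 3 * a\<^sup>2 * p) / (4 * pi)" for a p q :: real
    proof -
      have "a * (- 3 / 2 * p * (2 * a)) + q = q - 3 * a\<^sup>2 * p" by (simp add: power2_eq_square)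
      then show ?thesis by (simp only: minus_divide_left)
    qed
    show "partial_derivative i (partial_derivative i (reg e)) z =
      - (((norm z)\<^sup>2 + e\<^sup>2) powr (- 3 / 2) - 3 * (z $ i)\<^sup>2 * ((norm z)\<^sup>2 + e\<^sup>2) powr (- 5 / 2)) / (4 * pi)"
      unfolding partial_derivative_eq[OF d1] e mult_1_left by (rule alg)
  qed
  show "continuous_on UNIV (partial_derivative i (partial_derivative i (reg e)))"
    unfolding pp using pos by (intro continuous_intros ballI less_imp_neq[symmetric]) auto
qed

text \<open>With \<open>q = |z|^2 + e^2\<close> the sum is
  \<open>3 q^(-5/2) (|z|^2 - q) / (4 pi)\<close>, and \<open>|z|^2 - q = - e^2\<close>.\<close>

lemma sum_partial_reg:
  assumes "e > 0"
  shows "(\<Sum>i\<in>UNIV. partial_derivative i (partial_derivative i (reg e)) z) = - mollifier e z"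
proof -
  let ?q = "(norm z)\<^sup>2 + e\<^sup>2"
  have pos: "0 < ?q" using assms by (simp add: add_nonneg_pos)
  have n: "(norm z)\<^sup>2 = (\<Sum>i\<in>UNIV. (z $ i)\<^sup>2)"
    by (simp add: norm_vec_def L2_set_def sum_nonneg)
  have "(\<Sum>i\<in>UNIV. partial_derivative i (partial_derivative i (reg e)) z) =
      (\<Sum>i\<in>UNIV. 3 * ?q powr (- 5 / 2) / (4 * pi) * (z $ i)\<^sup>2 - ?q powr (- 3 / 2) / (4 * pi))"
    unfolding reg_derivatives(4)[OF assms] by (intro sum.cong) (auto simp: field_simps)
  also have "\<dots> = 3 * ?q powr (- 5 / 2) / (4 * pi) * (norm z)\<^sup>2 - 3 * ?q powr (- 3 / 2) / (4 * pi)"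
    unfolding sum_subtractf n by (simp add: sum_distrib_left)
  also have "?q powr (- 3 / 2) = ?q * ?q powr (- 5 / 2)"
    using pos powr_add[of ?q 1 "- 5 / 2"] by simp
  finally show ?thesis by (simp add: mollifier_def field_simps)
qed

text \<open>The bounds do not depend on \<open>e\<close>, and they are locally integrable in three
  dimensions, so they dominate as \<open>e\<close> tends to 0.\<close>

lemma reg_bounds:
  assumes "z \<noteq> 0"
  shows "\<bar>reg e z\<bar> \<le> fund z" "\<bar>z $ i * ((norm z)\<^sup>2 + e\<^sup>2) powr (- 3 / 2) / (4 * pi)\<bar> \<le> norm z powr - 2 / (4 * pi)"
proof -
  have n: "norm z > 0" using assms by simp
  have pw: "((norm z)\<^sup>2) powr r = norm z powr (2 * r)" for r
    using n powr_powr[of "norm z" 2 r] by simp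
  have "((norm z)\<^sup>2 + e\<^sup>2) powr r \<le> ((norm z)\<^sup>2) powr r" if "r \<le> 0" for r
    using n that by (intro powr_mono2') auto
  then have le: "((norm z)\<^sup>2 + e\<^sup>2) powr r \<le> norm z powr (2 * r)" if "r \<le> 0" for r using that pw by simp
  show "\<bar>reg e z\<bar> \<le> fund z"
    using divide_right_mono[OF le[of "- 1 / 2"], of "4 * pi"] by (simp add: reg_def fund_powr)
  have "\<bar>z $ i\<bar> * ((norm z)\<^sup>2 + e\<^sup>2) powr (- 3 / 2) \<le> norm z * norm z powr (2 * (- 3 / 2))"
    by (intro mult_mono le component_le_norm_cart) auto
  also have "\<dots> = norm z powr - 2"
    using n powr_add[of "norm z" 1 "-3"] by simp
  finally show "\<bar>z $ i * ((norm z)\<^sup>2 + e\<^sup>2) powr (- 3 / 2) / (4 * pi)\<bar> \<le> norm z powr - 2 / (4 * pi)"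
    by (simp add: abs_mult divide_right_mono)
qed

lemma reg_limits:
  assumes "z \<noteq> 0"
  shows "(\<lambda>n. reg (1 / real (Suc n)) z) \<longlonglongrightarrow> fund z"
    and "(\<lambda>n. - (z $ i * ((norm z)\<^sup>2 + (1 / real (Suc n))\<^sup>2) powr (- 3 / 2) / (4 * pi))) \<longlonglongrightarrow> fund_grad z $ i"
proof -
  have n: "norm z > 0" using assms by simp
  have pw: "((norm z)\<^sup>2) powr r = norm z powr (2 * r)" for r
    using n powr_powr[of "norm z" 2 r] by simp
  have "(\<lambda>n. ((norm z)\<^sup>2 + (inverse (real (Suc n)))\<^sup>2) powr r) \<longlonglongrightarrow> ((norm z)\<^sup>2 + 0\<^sup>2) powr r" for r
    using n by (intro tendsto_intros LIMSEQ_inverse_real_of_nat) auto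
  then have lim: "(\<lambda>n. ((norm z)\<^sup>2 + (1 / real (Suc n))\<^sup>2) powr r) \<longlonglongrightarrow> norm z powr (2 * r)" for r
    by (simp add: pw inverse_eq_divide)
  show "(\<lambda>n. reg (1 / real (Suc n)) z) \<longlonglongrightarrow> fund z"
    unfolding reg_def fund_powr using lim[of "- 1 / 2"] by (intro tendsto_divide tendsto_const) auto
  have "fund_grad z $ i = - (z $ i * norm z powr (2 * (- 3 / 2)) / (4 * pi))"
    using n powr_minus_divide[of "norm z" 3] by (simp add: fund_grad_nth field_simps)
  then show "(\<lambda>n. - (z $ i * ((norm z)\<^sup>2 + (1 / real (Suc n))\<^sup>2) powr (- 3 / 2) / (4 * pi))) \<longlonglongrightarrow> fund_grad z $ i"
    using lim[of "- 3 / 2"] by (auto intro!: tendsto_intros)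
qed

lemma AE_lborel_nonzero: "AE z in lborel. z \<noteq> (0::real^3)"
  by (rule AE_lborel_singleton)

lemma reg_integral_limits:
  assumes \<phi>: "test_function \<phi>"
  shows "(\<lambda>n. LINT z|lborel. reg (1 / real (Suc n)) z * \<phi> z) \<longlonglongrightarrow> (LINT z|lborel. fund z * \<phi> z)"
    and "(\<lambda>n. LINT z|lborel. partial_derivative i (reg (1 / real (Suc n))) z * \<phi> z)
      \<longlonglongrightarrow> (LINT z|lborel. fund_grad z $ i * \<phi> z)"
proof -
  have [measurable]: "\<phi> \<in> borel_measurable borel" by (intro smooth_borel test_function_smooth \<phi>)
  have I: "integrable lborel (\<lambda>z. \<bar>norm z powr - s * \<phi> z / (4 * pi)\<bar>)" if "s < 3" for s
    by (intro integrable_abs integrable_divide_zero test_function_norm_powr_integrable \<phi> that)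
  show "(\<lambda>n. LINT z|lborel. reg (1 / real (Suc n)) z * \<phi> z) \<longlonglongrightarrow> (LINT z|lborel. fund z * \<phi> z)"
  proof (rule integral_dominated_convergence[OF _ _ I[of 1]])
    show "AE z in lborel. (\<lambda>n. reg (1 / real (Suc n)) z * \<phi> z) \<longlonglongrightarrow> fund z * \<phi> z"
      using AE_lborel_nonzero by eventually_elim (intro tendsto_mult tendsto_const reg_limits)
    show "AE z in lborel. norm (reg (1 / real (Suc n)) z * \<phi> z) \<le> \<bar>norm z powr - 1 * \<phi> z / (4 * pi)\<bar>" for n
      using AE_lborel_nonzero
    proof eventually_elim
      case (elim z)
      show ?case using mult_right_mono[OF reg_bounds(1)[OF elim], of "\<bar>\<phi> z\<bar>" "1 / real (Suc n)"]
        by (simp add: abs_mult fund_powr)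
    qed
  qed (auto simp: reg_def)
  have p: "partial_derivative i (reg (1 / real (Suc n))) =
     (\<lambda>z. - (z $ i * ((norm z)\<^sup>2 + (1 / real (Suc n))\<^sup>2) powr (- 3 / 2) / (4 * pi)))" for n
    by (rule reg_derivatives) simp
  show "(\<lambda>n. LINT z|lborel. partial_derivative i (reg (1 / real (Suc n))) z * \<phi> z)
      \<longlonglongrightarrow> (LINT z|lborel. fund_grad z $ i * \<phi> z)"
    unfolding p
  proof (rule integral_dominated_convergence[OF _ _ I[of 2]])
    show "AE z in lborel. (\<lambda>n. - (z $ i * ((norm z)\<^sup>2 + (1 / real (Suc n))\<^sup>2) powr (- 3 / 2) / (4 * pi)) * \<phi> z)
        \<longlonglongrightarrow> fund_grad z $ i * \<phi> z"
      using AE_lborel_nonzero by eventually_elim (intro tendsto_mult tendsto_const reg_limits)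
    show "AE z in lborel. norm (- (z $ i * ((norm z)\<^sup>2 + (1 / real (Suc n))\<^sup>2) powr (- 3 / 2) / (4 * pi)) * \<phi> z)
        \<le> \<bar>norm z powr - 2 * \<phi> z / (4 * pi)\<bar>" for n
      using AE_lborel_nonzero
    proof eventually_elim
      case (elim z)
      show ?case using mult_right_mono[OF reg_bounds(2)[OF elim], of "\<bar>\<phi> z\<bar>" i "1 / real (Suc n)"]
        by (simp add: abs_mult)
    qed
  qed auto
qed

text \<open>For the regularised kernel integration by parts produces no boundary term. Both sides
  pass to the limit, because \<open>|z|^(-1)\<close> and \<open>|z|^(-2)\<close> are integrable near
  0.\<close>

lemma fund_partial:
  assumes "test_function \<phi>"
  shows "(LINT z|lborel. fund z * partial_derivative i \<phi> z) = - (LINT z|lborel. fund_grad z $ i * \<phi> z)"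
proof -
  have parts: "(LINT z|lborel. reg (1 / real (Suc n)) z * partial_derivative i \<phi> z) =
      - (LINT z|lborel. partial_derivative i (reg (1 / real (Suc n))) z * \<phi> z)" for n
    by (intro integral_partial_by_parts reg_derivatives assms continuous_at_imp_continuous_on ballI
        differentiable_imp_continuous_within) auto
  have "(\<lambda>n. LINT z|lborel. reg (1 / real (Suc n)) z * partial_derivative i \<phi> z)
      \<longlonglongrightarrow> (LINT z|lborel. fund z * partial_derivative i \<phi> z)"
    by (intro reg_integral_limits test_function_partial assms)
  moreover have "(\<lambda>n. LINT z|lborel. reg (1 / real (Suc n)) z * partial_derivative i \<phi> z)
      \<longlonglongrightarrow> - (LINT z|lborel. fund_grad z $ i * \<phi> z)"
    unfolding parts by (intro tendsto_minus reg_integral_limits assms)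
  ultimately show ?thesis by (rule LIMSEQ_unique)
qed

lemma mollifier_integral:
  assumes "e > 0"
  shows "integrable lborel (mollifier e)" "(LINT z|lborel. mollifier e z) = 1"
proof -
  have nn: "(\<integral>\<^sup>+z. ennreal (mollifier e z) \<partial>lborel) = 1"
    unfolding mollifier_def by (rule nn_integral_mollifier[OF assms])
  have pos: "0 \<le> mollifier e z" for z by (simp add: mollifier_def)
  have [measurable]: "mollifier e \<in> borel_measurable borel" unfolding mollifier_def[abs_def] by measurable
  show "integrable lborel (mollifier e)"
    by (rule integrableI_nonneg) (auto simp: nn pos)
  show "(LINT z|lborel. mollifier e z) = 1"
    by (subst integral_eq_nn_integral) (auto simp: nn pos)
qed

text \<open>The scaling \<open>e^3 * mollifier e (e z) = mollifier 1 z\<close> moves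
  \<open>e\<close> into the argument of \<phi>. The integrands are then dominated by a multiple of
  the single integrable function \<open>mollifier 1\<close>, and they converge by continuity of
  \<phi> at 0.\<close>

lemma mollifier_limit:
  assumes \<phi>: "test_function \<phi>"
  shows "(\<lambda>n. LINT z|lborel. mollifier (1 / real (Suc n)) z * \<phi> z) \<longlonglongrightarrow> \<phi> 0"
proof -
  obtain C M where CM: "\<And>x. \<bar>\<phi> x\<bar> \<le> C * indicator (cball 0 M) x" "C > 0"
    using test_function_bound[OF \<phi>] by metis
  have C: "\<bar>\<phi> x\<bar> \<le> C" for x using CM(1)[of x] CM(2) by (cases "norm x \<le> M") auto
  have [measurable]: "\<phi> \<in> borel_measurable borel" by (intro smooth_borel test_function_smooth \<phi>)
  have m [measurable]: "mollifier e \<in> borel_measurable borel" for e unfolding mollifier_def[abs_def] by measurable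
  have scale: "(LINT z|lborel. mollifier e z * \<phi> z) = (LINT z|lborel. mollifier 1 z * \<phi> (e *\<^sub>R z))" if "e > 0" for e
  proof -
    have "e ^ 3 * mollifier e (e *\<^sub>R z) = mollifier 1 z" for z
    proof -
      have "(norm (e *\<^sub>R z))\<^sup>2 + e\<^sup>2 = e\<^sup>2 * ((norm z)\<^sup>2 + 1\<^sup>2)" by (simp add: power_mult_distrib algebra_simps)
      moreover have "(e\<^sup>2) powr (- 5 / 2) = 1 / e ^ 5"
        using that powr_powr[of e 2 "- 5 / 2"] powr_minus_divide[of e 5] by simp
      ultimately show ?thesis using that
        by (simp add: mollifier_def powr_mult power2_eq_square power3_eq_cube eval_nat_numeral)
    qed
    then have "(\<lambda>z. e ^ 3 * (mollifier e (e *\<^sub>R z) * \<phi> (e *\<^sub>R z))) = (\<lambda>z. mollifier 1 z * \<phi> (e *\<^sub>R z))"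
      by (simp add: mult.assoc[symmetric])
    then show ?thesis
      using lborel_integral_scale[of "\<lambda>z. mollifier e z * \<phi> z", OF _ that]
      by (simp flip: integral_mult_right_zero)
  qed
  have "(\<lambda>n. LINT z|lborel. mollifier 1 z * \<phi> ((1 / real (Suc n)) *\<^sub>R z)) \<longlonglongrightarrow> (LINT z|lborel. mollifier 1 z * \<phi> 0)"
  proof (rule integral_dominated_convergence[where w = "\<lambda>z. C * mollifier 1 z"])
    show "AE z in lborel. (\<lambda>n. mollifier 1 z * \<phi> ((1 / real (Suc n)) *\<^sub>R z)) \<longlonglongrightarrow> mollifier 1 z * \<phi> 0"
    proof (intro always_eventually allI tendsto_mult tendsto_const)
      fix z :: "real^3"
      have "(\<lambda>n. inverse (real (Suc n)) *\<^sub>R z) \<longlonglongrightarrow> 0 *\<^sub>R z"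
        by (intro tendsto_scaleR tendsto_const LIMSEQ_inverse_real_of_nat)
      then have "(\<lambda>n. (1 / real (Suc n)) *\<^sub>R z) \<longlonglongrightarrow> 0"
        by (simp only: inverse_eq_divide scaleR_zero_left)
      moreover have "isCont \<phi> 0"
        using smooth_differentiable[OF test_function_smooth[OF \<phi>]] by (rule differentiable_imp_continuous_within)
      ultimately show "(\<lambda>n. \<phi> ((1 / real (Suc n)) *\<^sub>R z)) \<longlonglongrightarrow> \<phi> 0"
        by (rule isCont_tendsto_compose[rotated])
    qed
    show "integrable lborel (\<lambda>z. C * mollifier 1 z)"
      using mollifier_integral(1)[of 1] by simp
    have pos: "0 \<le> mollifier 1 z" for z by (simp add: mollifier_def)
    have "norm (mollifier 1 z * \<phi> y) \<le> C * mollifier 1 z" for y z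
      using mult_left_mono[OF C[of y] pos[of z]] pos[of z] by (simp add: abs_mult mult.commute)
    then show "AE z in lborel. norm (mollifier 1 z * \<phi> ((1 / real (Suc n)) *\<^sub>R z)) \<le> C * mollifier 1 z" for n
      by simp
  qed auto
  then show ?thesis using mollifier_integral[of 1] by (simp add: scale)
qed

lemma test_function_add:
  assumes "test_function \<phi>" "test_function \<psi>"
  shows "test_function (\<lambda>x. \<phi> x + \<psi> x)"
proof -
  have "{x. \<phi> x + \<psi> x \<noteq> 0} \<subseteq> {x. \<phi> x \<noteq> 0} \<union> {x. \<psi> x \<noteq> 0}" by auto
  then have "bounded {x. \<phi> x + \<psi> x \<noteq> 0}"
    by (rule bounded_subset[rotated]) (use assms in \<open>auto simp: test_function_def\<close>)
  then show ?thesis using assms by (auto simp: test_function_def intro: smooth_add)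
qed

lemma test_function_sum: "(\<And>i. i \<in> I \<Longrightarrow> test_function (\<phi> i)) \<Longrightarrow> test_function (\<lambda>x. \<Sum>i\<in>I. \<phi> i x)"
proof (induction I rule: infinite_finite_induct)
  case (insert j I)
  then show ?case using test_function_add[of "\<phi> j" "\<lambda>x. \<Sum>i\<in>I. \<phi> i x"] by simp
qed (simp_all add: test_function_def)

text \<open>Two integrations by parts turn the Laplacian of \<phi> against \<open>reg e\<close> into
  \<phi> against \<open>- mollifier e\<close>. The individual second derivatives of
  \<open>fund\<close> are of order \<open>|z|^(-3)\<close> and not integrable at 0, so the limit is
  taken on the two sides of this identity separately: on one side no derivative is on the kernel, on
  the other the mollifier concentrates at 0.\<close>

lemma fund_laplacian:
  assumes "test_function \<phi>"
  shows "(LINT z|lborel. fund z * (\<Sum>i\<in>UNIV. partial_derivative i (partial_derivative i \<phi>) z)) = - \<phi> 0"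
proof -
  have sm: "test_function (partial_derivative i \<phi>)" "test_function (partial_derivative i (partial_derivative i \<phi>))" for i
    using assms by (auto intro: test_function_partial)
  let ?e = "\<lambda>n. 1 / real (Suc n)"
  have e: "?e n > 0" for n by simp
  have cont: "continuous_on UNIV (reg (?e n))" "continuous_on UNIV (partial_derivative i (reg (?e n)))" for n i
    using reg_derivatives(1,3)[OF e]
    by (auto intro!: continuous_at_imp_continuous_on differentiable_imp_continuous_within)
  have parts: "(LINT z|lborel. reg (?e n) z * partial_derivative i (partial_derivative i \<phi>) z) =
      (LINT z|lborel. partial_derivative i (partial_derivative i (reg (?e n))) z * \<phi> z)" for n i
    using integral_partial_by_parts[OF reg_derivatives(1)[OF e] cont(2) sm(1), of n i i]
      integral_partial_by_parts[OF reg_derivatives(3)[OF e] reg_derivatives(5)[OF e] assms, of i n]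
    by simp
  note int = test_function_mult_continuous_integrable
  have key: "(LINT z|lborel. reg (?e n) z * (\<Sum>i\<in>UNIV. partial_derivative i (partial_derivative i \<phi>) z)) =
      - (LINT z|lborel. mollifier (?e n) z * \<phi> z)" for n
  proof -
    have "(LINT z|lborel. reg (?e n) z * (\<Sum>i\<in>UNIV. partial_derivative i (partial_derivative i \<phi>) z)) =
       (\<Sum>i\<in>UNIV. LINT z|lborel. reg (?e n) z * partial_derivative i (partial_derivative i \<phi>) z)"
      unfolding sum_distrib_left by (rule Bochner_Integration.integral_sum) (intro int cont sm)
    also have "\<dots> = (\<Sum>i\<in>UNIV. LINT z|lborel. partial_derivative i (partial_derivative i (reg (?e n))) z * \<phi> z)"
      by (simp only: parts)
    also have "\<dots> = (LINT z|lborel. (\<Sum>i\<in>UNIV. partial_derivative i (partial_derivative i (reg (?e n))) z * \<phi> z))"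
      by (rule Bochner_Integration.integral_sum[symmetric]) (intro int reg_derivatives(5) e assms)
    also have "\<dots> = (LINT z|lborel. - (mollifier (?e n) z * \<phi> z))"
      unfolding sum_distrib_right[symmetric] sum_partial_reg[OF e] by simp
    finally show ?thesis by simp
  qed
  have "(\<lambda>n. LINT z|lborel. reg (?e n) z * (\<Sum>i\<in>UNIV. partial_derivative i (partial_derivative i \<phi>) z))
      \<longlonglongrightarrow> (LINT z|lborel. fund z * (\<Sum>i\<in>UNIV. partial_derivative i (partial_derivative i \<phi>) z))"
  proof (rule reg_integral_limits(1))
    show "test_function (\<lambda>z. \<Sum>i\<in>UNIV. partial_derivative i (partial_derivative i \<phi>) z)"
      by (intro test_function_sum sm)
  qed
  moreover have "(\<lambda>n. LINT z|lborel. reg (?e n) z * (\<Sum>i\<in>UNIV. partial_derivative i (partial_derivative i \<phi>) z)) \<longlonglongrightarrow> - \<phi> 0"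
    unfolding key by (intro tendsto_minus mollifier_limit assms)
  ultimately show ?thesis by (rule LIMSEQ_unique)
qed

text \<open>Where \<open>|x - z| \<le> M\<close>, the number \<open>1 + |x|\<close> is comparable to
  \<open>max 1 |z|\<close>. Outside the unit ball the factor \<open>(1 + |x|)^p\<close> is therefore
  cancelled by \<open>|z|^(-p)\<close>, up to a constant; inside it stays bounded, and
  \<open>|z|^(-p)\<close> is integrable since \<open>p < 3\<close>.\<close>

lemma decay_bound:
  fixes x :: "real^3"
  assumes p: "0 \<le> p" "p < 3"
  shows "\<exists>B>0. \<forall>x::real^3. (1 + norm x) powr p * (LINT z|lborel. indicator (cball 0 M) (x - z) * norm z powr - p) \<le> B"
proof -
  define J where "J = (LINT z|lborel. norm (z::real^3) powr - p * indicator (cball 0 1) z)"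
  \<comment> \<open>From \<open>1 + |x| \<le> (1 + |M|) (1 + |z|) \<le> (1 + |M|) * 2 * max 1
    |z|\<close>.\<close>
  define W where "W = ((1 + \<bar>M\<bar>) * 2) powr p"
  define B where "B = W * (measure lborel (cball (0::real^3) M) + J) + 1"
  have W: "W > 0" by (auto simp: W_def)
  have vol: "integrable lborel (\<lambda>z. indicator (cball 0 M) (x - z) :: real)"
     "(LINT z|lborel. indicator (cball 0 M) (x - z)) = measure lborel (cball (0::real^3) M)" for x :: "real^3"
    using lborel_integral_affine(1,2)[of "indicator (cball (0::real^3) M) :: _ \<Rightarrow> real" "-1" x]
      integrable_indicator_cball[of 1 M] by auto
  have "(1 + norm x) powr p * (LINT z|lborel. indicator (cball 0 M) (x - z) * norm z powr - p) \<le> B" for x :: "real^3"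
  proof -
    have Iz: "integrable lborel (\<lambda>z. norm z powr - p * indicator (cball 0 M) (x - z))"
    proof (rule norm_powr_mult_integrable[OF p(2), where C = 1 and M = "norm x + M"])
      show "\<bar>indicator (cball 0 M) (x - z) :: real\<bar> \<le> 1 * indicator (cball 0 (norm x + M)) z" for z
        using norm_triangle_ineq4[of x "x - z"] by (auto simp: indicator_def)
    qed auto
    have "(1 + norm x) powr p * (LINT z|lborel. indicator (cball 0 M) (x - z) * norm z powr - p) =
        (LINT z|lborel. (1 + norm x) powr p * (norm z powr - p * indicator (cball 0 M) (x - z)))"
      by (simp add: mult.commute)
    also have "\<dots> \<le> (LINT z|lborel. W * (indicator (cball 0 M) (x - z) + norm z powr - p * indicator (cball 0 1) z))"
    proof (rule integral_mono)
      show "integrable lborel (\<lambda>z. (1 + norm x) powr p * (norm z powr - p * indicator (cball 0 M) (x - z)))"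
        by (intro integrable_mult_right Iz)
      show "integrable lborel (\<lambda>z. W * (indicator (cball 0 M) (x - z) + norm z powr - p * indicator (cball 0 1) z))"
        by (intro integrable_mult_right Bochner_Integration.integrable_add vol norm_powr_integrable_cball p)
      fix z
      show "(1 + norm x) powr p * (norm z powr - p * indicator (cball 0 M) (x - z)) \<le>
          W * (indicator (cball 0 M) (x - z) + norm z powr - p * indicator (cball 0 1) z)"
      proof (cases "norm (x - z) \<le> M \<and> z \<noteq> 0")
        case True
        have "norm x \<le> M + norm z" using norm_triangle_ineq[of "x - z" z] True by simp
        then have "1 + norm x \<le> (1 + \<bar>M\<bar>) * (1 + norm z)"
          using mult_nonneg_nonneg[OF abs_ge_zero[of M] norm_ge_zero[of z]]
          unfolding ring_distribs mult_1_left mult_1_right by linarith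
        also have "\<dots> \<le> (1 + \<bar>M\<bar>) * (2 * max 1 (norm z))"
          by (intro mult_left_mono) auto
        finally have "1 + norm x \<le> (1 + \<bar>M\<bar>) * 2 * max 1 (norm z)" by (simp only: mult.assoc)
        then have "(1 + norm x) powr p \<le> ((1 + \<bar>M\<bar>) * 2 * max 1 (norm z)) powr p"
          by (rule powr_mono2[OF p(1), rotated]) simp
        also have "\<dots> = W * max 1 (norm z) powr p"
          by (subst powr_mult) (auto simp: W_def)
        finally have "(1 + norm x) powr p * norm z powr - p \<le> W * (max 1 (norm z) powr p * norm z powr - p)"
          by (simp add: mult_right_mono mult.assoc[symmetric])
        also have "\<dots> \<le> W * (1 + norm z powr - p * indicator (cball 0 1) z)"
        proof (intro mult_left_mono)
          show "max 1 (norm z) powr p * norm z powr - p \<le> 1 + norm z powr - p * indicator (cball 0 1) z"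
          proof (cases "norm z \<le> 1")
            case False
            then have "z \<noteq> 0" by auto
            then have "norm z powr p * norm z powr - p = 1"
              using powr_add[of "norm z" p "-p"] by simp
            then show ?thesis using False by (simp add: max_def)
          qed (simp add: max_def)
        qed (use W in auto)
        finally show ?thesis using True by simp
      next
        case False
        then show ?thesis using W by (auto simp: indicator_def)
      qed
    qed
    also have "\<dots> = W * (measure lborel (cball (0::real^3) M) + J)"
      using vol[of x] norm_powr_integrable_cball[OF p(2), of 1] by (simp add: J_def)
    also have "\<dots> \<le> B" by (simp add: B_def)
    finally show ?thesis .
  qed
  moreover have "B > 0"
  proof -
    have "0 \<le> J" unfolding J_def by (intro integral_nonneg_AE) auto
    then show ?thesis using W by (simp add: B_def add_nonneg_pos)
  qed
  ultimately show ?thesis by blast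
qed

section \<open>Kernel estimates\<close>

lemma nn_integral_reflect:
  assumes "h \<in> borel_measurable borel"
  shows "(\<integral>\<^sup>+y. h (x - y) \<partial>lborel) = (\<integral>\<^sup>+y. h (y :: real^3) \<partial>lborel)"
  using lborel_integral_affine(3)[OF borel_measurable_const[of "0::real"] _ assms, of "-1" x] by simp

text \<open>Split the space at distance \<open>norm x / 2\<close> from the two singularities.\<close>

lemma nn_integral_two_powers:
  assumes s: "1 < s" "s < 3"
  shows "\<exists>C>0. \<forall>x::real^3. x \<noteq> 0 \<longrightarrow>
    (\<integral>\<^sup>+y. ennreal (norm y powr - s * norm (x - y) powr - 2) \<partial>lborel) \<le> ennreal (C * norm x powr (1 - s))"
proof -
  \<comment> \<open>With \<open>r = |x| / 2\<close>, the three terms come from the ball of radius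
    \<open>r\<close> about 0, the ball of radius \<open>r\<close> about \<open>x\<close>, and the
    remaining region, each after division by \<open>r^(1 - s)\<close>.\<close>
  define c where "c = 4 * pi / (3 - s) + 4 * pi + 9 * (4 * pi / (s - 1))"
  have c: "c > 0" using s by (auto simp: c_def intro!: add_pos_pos)
  have "(\<integral>\<^sup>+y. ennreal (norm y powr - s * norm (x - y) powr - 2) \<partial>lborel) \<le> ennreal (c * 2 powr (s - 1) * norm x powr (1 - s))"
    if x: "x \<noteq> 0" for x :: "real^3"
  proof -
    define r where "r = norm x / 2"
    have r: "r > 0" using x by (simp add: r_def)
    let ?a = "\<lambda>y::real^3. ennreal (norm y powr - s) * indicator (cball 0 r) y"
    let ?b = "\<lambda>y::real^3. ennreal (norm y powr - 2) * indicator (cball 0 r) y"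
    let ?c = "\<lambda>y::real^3. ennreal (norm y powr - (s + 2)) * indicator (- ball 0 r) y"
    have [measurable]: "?a \<in> borel_measurable borel" "?b \<in> borel_measurable borel" "?c \<in> borel_measurable borel"
    proof -
      have m: "(\<lambda>y::real^3. ennreal (norm y powr t)) \<in> borel_measurable borel" for t by measurable
      show "?a \<in> borel_measurable borel" "?b \<in> borel_measurable borel" "?c \<in> borel_measurable borel"
        by (rule borel_measurable_times_ennreal[OF m borel_measurable_indicator], simp)+
    qed
    have b': "(\<lambda>y. ?b (x - y)) \<in> borel_measurable lborel"
      by (rule measurable_compose[of "\<lambda>y. x - y" _ borel]) auto
    have ptw: "ennreal (norm y powr - s * norm (x - y) powr - 2) \<le>
        ennreal (r powr - 2) * ?a y + ennreal (r powr - s) * ?b (x - y) + 9 * ?c y" for y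
    proof -
      have tri: "norm x \<le> norm y + norm (x - y)" "norm y \<le> norm x + norm (x - y)"
        using norm_triangle_ineq[of y "x - y"] norm_triangle_ineq4[of x "x - y"] by auto
      consider "norm y \<le> r" | "norm y > r" "norm (x - y) \<le> r" | "norm y > r" "norm (x - y) > r" by linarith
      then show ?thesis
      proof cases
        case 1
        then have "r \<le> norm (x - y)" using tri by (simp add: r_def)
        then have "norm (x - y) powr - 2 \<le> r powr - 2" using r by (intro powr_mono2') auto
        then have "ennreal (norm y powr - s * norm (x - y) powr - 2) \<le> ennreal (norm y powr - s * r powr - 2)"
          by (intro ennreal_leI mult_left_mono) auto
        also have "\<dots> = ennreal (r powr - 2) * ?a y"
          using 1 by (simp add: ennreal_mult' mult.commute)
        also have "\<dots> \<le> ennreal (r powr - 2) * ?a y + ennreal (r powr - s) * ?b (x - y) + 9 * ?c y"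
          unfolding add.assoc by (rule add_increasing2[OF zero_le order_refl])
        finally show ?thesis .
      next
        case 2
        then have "norm y powr - s \<le> r powr - s" using r s by (intro powr_mono2') auto
        then have "ennreal (norm y powr - s * norm (x - y) powr - 2) \<le> ennreal (r powr - s * norm (x - y) powr - 2)"
          by (intro ennreal_leI mult_right_mono) auto
        also have "\<dots> = ennreal (r powr - s) * ?b (x - y)"
          using 2 by (simp add: ennreal_mult')
        also have "\<dots> \<le> ennreal (r powr - 2) * ?a y + ennreal (r powr - s) * ?b (x - y) + 9 * ?c y"
          by (simp add: add_increasing add_increasing2)
        finally show ?thesis .
      next
        case 3
        \<comment> \<open>Here \<open>|x| = 2 r < 2 |x - y|\<close>. Both singularities may now be
          measured by \<open>|y|\<close>, at the cost of the factor \<open>3^2 = 9\<close>.\<close>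
        then have "norm y \<le> 3 * norm (x - y)" using tri by (simp add: r_def)
        then have "(3 * norm (x - y)) powr - 2 \<le> norm y powr - 2" using 3 r by (intro powr_mono2') auto
        moreover have "(3 * norm (x - y)) powr - 2 = norm (x - y) powr - 2 / 9"
          using powr_minus_divide[of "3 :: real" 2] by (simp add: powr_mult)
        ultimately have "norm (x - y) powr - 2 \<le> 9 * norm y powr - 2" by simp
        then have "norm y powr - s * norm (x - y) powr - 2 \<le> norm y powr - s * (9 * norm y powr - 2)"
          by (intro mult_left_mono) auto
        also have "\<dots> = 9 * norm y powr - (s + 2)"
          using powr_add[of "norm y" "- s" "- 2"] by simp
        finally have "ennreal (norm y powr - s * norm (x - y) powr - 2) \<le> ennreal (9 * norm y powr - (s + 2))"
          by (rule ennreal_leI)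
        also have "\<dots> = 9 * ?c y"
          using 3 by (simp add: ennreal_mult')
        also have "\<dots> \<le> ennreal (r powr - 2) * ?a y + ennreal (r powr - s) * ?b (x - y) + 9 * ?c y"
          by (rule add_increasing[OF zero_le order_refl])
        finally show ?thesis .
      qed
    qed
    have "(\<integral>\<^sup>+y. ennreal (norm y powr - s * norm (x - y) powr - 2) \<partial>lborel) \<le>
       (\<integral>\<^sup>+y. ennreal (r powr - 2) * ?a y + ennreal (r powr - s) * ?b (x - y) + 9 * ?c y \<partial>lborel)"
      by (intro nn_integral_mono ptw)
    also have "\<dots> = ennreal (r powr - 2) * (\<integral>\<^sup>+y. ?a y \<partial>lborel) + ennreal (r powr - s) * (\<integral>\<^sup>+y. ?b (x - y) \<partial>lborel)
        + 9 * (\<integral>\<^sup>+y. ?c y \<partial>lborel)"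
      using b' by (simp add: nn_integral_add nn_integral_cmult)
    also have "(\<integral>\<^sup>+y. ?b (x - y) \<partial>lborel) = (\<integral>\<^sup>+y. ?b y \<partial>lborel)"
      by (rule nn_integral_reflect) measurable
    also have "ennreal (r powr - 2) * (\<integral>\<^sup>+y. ?a y \<partial>lborel) + ennreal (r powr - s) * (\<integral>\<^sup>+y. ?b y \<partial>lborel)
        + 9 * (\<integral>\<^sup>+y. ?c y \<partial>lborel) = ennreal (c * r powr (1 - s))"
    proof -
      define A B C where "A = 4 * pi * r powr (3 - s) / (3 - s)" and "B = 4 * pi * r powr (3 - 2) / (3 - 2)"
        and "C = 4 * pi * r powr (3 - (s + 2)) / (s + 2 - 3)"
      have pos: "A \<ge> 0" "B \<ge> 0" "C \<ge> 0" using s by (auto simp: A_def B_def C_def)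
      have ints: "(\<integral>\<^sup>+y. ?a y \<partial>lborel) = ennreal A" "(\<integral>\<^sup>+y. ?b y \<partial>lborel) = ennreal B" "(\<integral>\<^sup>+y. ?c y \<partial>lborel) = ennreal C"
        unfolding A_def B_def C_def
        by (rule nn_integral_norm_powr_cball nn_integral_norm_powr_outside; use s r in simp)+
      have "ennreal p * ennreal A + ennreal q * ennreal B + 9 * ennreal C = ennreal (p * A + q * B + 9 * C)"
        if "p \<ge> 0" "q \<ge> 0" for p q
        using pos that by (simp add: ennreal_mult ennreal_plus)
      then have "ennreal (r powr - 2) * (\<integral>\<^sup>+y. ?a y \<partial>lborel) + ennreal (r powr - s) * (\<integral>\<^sup>+y. ?b y \<partial>lborel)
        + 9 * (\<integral>\<^sup>+y. ?c y \<partial>lborel) = ennreal (r powr - 2 * A + r powr - s * B + 9 * C)"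
        unfolding ints by simp
      moreover have e: "r powr - 2 * r powr (3 - s) = r powr (1 - s)" "r powr - s * r = r powr (1 - s)"
        using powr_add[of r "- 2" "3 - s"] powr_add[of r "- s" 1] r by (simp_all add: add.commute)
      have "r powr - 2 * A + r powr - s * B + 9 * C =
        (r powr - 2 * r powr (3 - s)) * (4 * pi / (3 - s)) + (r powr - s * r) * (4 * pi)
          + r powr (1 - s) * (9 * (4 * pi / (s - 1)))"
        using r by (simp add: A_def B_def C_def mult_ac)
      then have "r powr - 2 * A + r powr - s * B + 9 * C = c * r powr (1 - s)"
        unfolding e c_def by (simp only: ring_distribs mult_ac)
      ultimately show ?thesis by simp
    qed
    also have "r powr (1 - s) = norm x powr (1 - s) * 2 powr (s - 1)"
      using x powr_minus_divide[of 2 "s - 1"] by (simp add: r_def powr_divide)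
    finally show ?thesis by (simp add: mult_ac)
  qed
  then show ?thesis using c by (intro exI[of _ "c * 2 powr (s - 1)"]) auto
qed

section \<open>Integral operators with a difference kernel\<close>

lemma measurable_lebesgue_pair_borel:
  fixes k :: "real^3 \<Rightarrow> 'b::topological_space"
  assumes "k \<in> borel_measurable borel"
  shows "(\<lambda>p. k (fst p - snd p)) \<in> borel_measurable ((lebesgue :: (real^3) measure) \<Otimes>\<^sub>M (lebesgue :: (real^3) measure))"
  by (rule borel_pair_lebesgue) (use assms in measurable)

text \<open>The kernel is scalar and acts on fields of any dimension; a vector kernel such as
  \<open>fund_grad\<close> enters through its coordinates.\<close>

definition kernel_op :: "(real^3 \<Rightarrow> real) \<Rightarrow> (real^3 \<Rightarrow> 'b::euclidean_space) \<Rightarrow> real^3 \<Rightarrow> 'b" where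
  "kernel_op k F x = (LINT y|lebesgue. k (x - y) *\<^sub>R F y)"

lemma kernel_integrand_measurable:
  fixes F :: "real^3 \<Rightarrow> 'b::euclidean_space"
  assumes "k \<in> borel_measurable borel" "F \<in> borel_measurable lebesgue"
  shows "(\<lambda>p. k (fst p - snd p) *\<^sub>R F (snd p)) \<in> borel_measurable ((lebesgue :: (real^3) measure) \<Otimes>\<^sub>M lebesgue)"
  by (intro borel_measurable_scaleR measurable_lebesgue_pair_borel assms measurable_compose[OF measurable_snd assms(2)])

lemma kernel_op_measurable:
  fixes F :: "real^3 \<Rightarrow> 'b::euclidean_space"
  assumes "k \<in> borel_measurable borel" "F \<in> borel_measurable lebesgue"
  shows "kernel_op k F \<in> borel_measurable lebesgue"
  unfolding kernel_op_def[abs_def]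
  using sigma_finite_measure.borel_measurable_lebesgue_integral[OF sigma_finite_lebesgue,
      of "\<lambda>x y. k (x - y) *\<^sub>R F y" lebesgue] kernel_integrand_measurable[OF assms]
  by (simp add: case_prod_beta)

lemma Tonelli_lebesgue:
  fixes f :: "real^3 \<Rightarrow> real^3 \<Rightarrow> ennreal"
  assumes "(\<lambda>p. f (fst p) (snd p)) \<in> borel_measurable (lebesgue \<Otimes>\<^sub>M lebesgue)"
  shows "(\<integral>\<^sup>+x. \<integral>\<^sup>+y. f x y \<partial>lebesgue \<partial>lebesgue) = (\<integral>\<^sup>+y. \<integral>\<^sup>+x. f x y \<partial>lebesgue \<partial>lebesgue)"
  using leb2.Fubini[OF assms] by simp

text \<open>Schur's test with the weight \<open>norm y powr (5 / 2)\<close>.\<close>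

lemma Stein_Weiss_borel:
  fixes f :: "real^3 \<Rightarrow> real"
  assumes [measurable]: "f \<in> borel_measurable borel" and f: "\<And>y. f y \<ge> 0"
    and fin: "(\<integral>\<^sup>+y. ennreal ((norm y)\<^sup>2 * (f y)\<^sup>2) \<partial>lborel) < \<infinity>"
  shows "(\<integral>\<^sup>+x. (\<integral>\<^sup>+y. ennreal (norm (x - y) powr - 2 * f y) \<partial>lborel)\<^sup>2 \<partial>lborel) < \<infinity>"
proof -
  \<comment> \<open>The first estimate leaves the power \<open>- 3 / 2\<close>, to which the second
    applies after the order of integration is exchanged. It leaves \<open>- 1 / 2\<close>, and
    \<open>5 / 2 - 1 / 2 = 2\<close> is the exponent in the assumption on \<open>f\<close>.\<close>
  obtain C1 where C1: "C1 > 0" "\<And>x::real^3. x \<noteq> 0 \<Longrightarrow>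
    (\<integral>\<^sup>+y. ennreal (norm y powr - (5 / 2) * norm (x - y) powr - 2) \<partial>lborel) \<le> ennreal (C1 * norm x powr (- 3 / 2))"
    using nn_integral_two_powers[of "5 / 2"] by auto
  obtain C2 where C2: "C2 > 0" "\<And>x::real^3. x \<noteq> 0 \<Longrightarrow>
    (\<integral>\<^sup>+y. ennreal (norm y powr - (3 / 2) * norm (x - y) powr - 2) \<partial>lborel) \<le> ennreal (C2 * norm x powr (- 1 / 2))"
    using nn_integral_two_powers[of "3 / 2"] by auto
  have sq: "(t powr r)\<^sup>2 = t powr (2 * r)" for t r :: real
    using powr_add[of t r r] by (simp add: power2_eq_square)
  define h where "h x y = (f y)\<^sup>2 * norm y powr (5 / 2) * norm (x - y) powr - 2" for x y
  have h_meas [measurable]: "case_prod h \<in> borel_measurable (borel \<Otimes>\<^sub>M borel)"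
    unfolding h_def by measurable
  have inner: "(\<integral>\<^sup>+y. ennreal (norm (x - y) powr - 2 * f y) \<partial>lborel)\<^sup>2 \<le>
      (\<integral>\<^sup>+y. ennreal (h x y) \<partial>lborel) * ennreal (C1 * norm x powr (- 3 / 2))" if "x \<noteq> 0" for x
  proof -
    \<comment> \<open>The two factors share the kernel evenly and carry the powers
      \<open>5 / 4\<close> and \<open>- 5 / 4\<close> of \<open>|y|\<close>. After squaring, the
      first gives \<open>h\<close> and the second the integrand bounded with
      \<open>C1\<close>.\<close>
    let ?a = "\<lambda>y. ennreal (f y * norm y powr (5 / 4) * norm (x - y) powr - 1)"
    let ?b = "\<lambda>y. ennreal (norm y powr - (5 / 4) * norm (x - y) powr - 1)"
    have "(\<integral>\<^sup>+y. ennreal (norm (x - y) powr - 2 * f y) \<partial>lborel) = (\<integral>\<^sup>+y. ?a y * ?b y \<partial>lborel)"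
    proof (rule nn_integral_cong_AE)
      show "AE y in lborel. ennreal (norm (x - y) powr - 2 * f y) = ?a y * ?b y"
        using AE_lborel_nonzero
      proof eventually_elim
        case (elim y)
        have "norm y powr (5 / 4) * norm y powr - (5 / 4) = 1"
          using powr_add[of "norm y" "5 / 4" "- (5 / 4)"] elim by simp
        moreover have "norm (x - y) powr - 1 * norm (x - y) powr - 1 = norm (x - y) powr - 2"
          using powr_add[of "norm (x - y)" "- 1" "- 1"] by simp
        moreover have "f y * norm y powr (5 / 4) * norm (x - y) powr - 1 * (norm y powr - (5 / 4) * norm (x - y) powr - 1)
            = (norm (x - y) powr - 1 * norm (x - y) powr - 1) * f y * (norm y powr (5 / 4) * norm y powr - (5 / 4))"
          by (simp only: mult_ac)
        ultimately have "f y * norm y powr (5 / 4) * norm (x - y) powr - 1 * (norm y powr - (5 / 4) * norm (x - y) powr - 1)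
            = norm (x - y) powr - 2 * f y"
          by (simp only: mult_1_right)
        then show ?case using f[of y] by (subst ennreal_mult[symmetric]) auto
      qed
    qed
    then have "(\<integral>\<^sup>+y. ennreal (norm (x - y) powr - 2 * f y) \<partial>lborel)\<^sup>2 = (\<integral>\<^sup>+y. ?a y * ?b y \<partial>lborel)\<^sup>2"
      by (simp only:)
    also have "\<dots> \<le> (\<integral>\<^sup>+y. (?a y)\<^sup>2 \<partial>lborel) * (\<integral>\<^sup>+y. (?b y)\<^sup>2 \<partial>lborel)"
      by (rule Cauchy_Schwarz_nn_integral) measurable
    also have "(\<lambda>y. (?a y)\<^sup>2) = (\<lambda>y. ennreal (h x y))"
    proof
      fix y
      have "(f y * norm y powr (5 / 4) * norm (x - y) powr - 1)\<^sup>2 = h x y"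
        using sq[of "norm y" "5 / 4"] sq[of "norm (x - y)" "- 1"] unfolding h_def power_mult_distrib by simp
      then show "(?a y)\<^sup>2 = ennreal (h x y)" using f by (subst ennreal_power) auto
    qed
    also have "(\<lambda>y. (?b y)\<^sup>2) = (\<lambda>y. ennreal (norm y powr - (5 / 2) * norm (x - y) powr - 2))"
    proof
      fix y
      have "(norm y powr - (5 / 4) * norm (x - y) powr - 1)\<^sup>2 = norm y powr - (5 / 2) * norm (x - y) powr - 2"
        using sq[of "norm y" "- (5 / 4)"] sq[of "norm (x - y)" "- 1"] unfolding power_mult_distrib by simp
      then show "(?b y)\<^sup>2 = ennreal (norm y powr - (5 / 2) * norm (x - y) powr - 2)" by (subst ennreal_power) auto
    qed
    also have "(\<integral>\<^sup>+y. ennreal (h x y) \<partial>lborel) * (\<integral>\<^sup>+y. ennreal (norm y powr - (5 / 2) * norm (x - y) powr - 2) \<partial>lborel)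
       \<le> (\<integral>\<^sup>+y. ennreal (h x y) \<partial>lborel) * ennreal (C1 * norm x powr (- 3 / 2))"
      by (intro mult_left_mono C1 that) auto
    finally show ?thesis .
  qed
  have "(\<integral>\<^sup>+x. (\<integral>\<^sup>+y. ennreal (norm (x - y) powr - 2 * f y) \<partial>lborel)\<^sup>2 \<partial>lborel) \<le>
      (\<integral>\<^sup>+x. (\<integral>\<^sup>+y. ennreal (h x y) \<partial>lborel) * ennreal (C1 * norm x powr (- 3 / 2)) \<partial>lborel)"
    by (intro nn_integral_mono_AE eventually_mono[OF AE_lborel_nonzero] inner)
  also have "\<dots> = (\<integral>\<^sup>+x. \<integral>\<^sup>+y. ennreal (C1 * norm x powr (- 3 / 2) * h x y) \<partial>lborel \<partial>lborel)"
  proof (rule nn_integral_cong)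
    fix x :: "real^3"
    have "(\<integral>\<^sup>+y. ennreal (h x y) \<partial>lborel) * ennreal (C1 * norm x powr (- 3 / 2)) =
        (\<integral>\<^sup>+y. ennreal (h x y) * ennreal (C1 * norm x powr (- 3 / 2)) \<partial>lborel)"
      by (rule nn_integral_multc[symmetric]) (simp add: h_def)
    also have "\<dots> = (\<integral>\<^sup>+y. ennreal (C1 * norm x powr (- 3 / 2) * h x y) \<partial>lborel)"
      using C1(1) by (intro nn_integral_cong) (subst ennreal_mult[symmetric], auto simp: h_def mult.commute)
    finally show "(\<integral>\<^sup>+y. ennreal (h x y) \<partial>lborel) * ennreal (C1 * norm x powr (- 3 / 2)) =
      (\<integral>\<^sup>+y. ennreal (C1 * norm x powr (- 3 / 2) * h x y) \<partial>lborel)" .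
  qed
  also have "\<dots> = (\<integral>\<^sup>+y. \<integral>\<^sup>+x. ennreal (C1 * norm x powr (- 3 / 2) * h x y) \<partial>lborel \<partial>lborel)"
    by (rule lborel_pair.Fubini'[symmetric]) (simp add: h_def)
  also have "\<dots> \<le> (\<integral>\<^sup>+y. ennreal (C1 * C2) * ennreal ((norm y)\<^sup>2 * (f y)\<^sup>2) \<partial>lborel)"
  proof (rule nn_integral_mono_AE)
    show "AE y in lborel. (\<integral>\<^sup>+x. ennreal (C1 * norm x powr (- 3 / 2) * h x y) \<partial>lborel) \<le>
        ennreal (C1 * C2) * ennreal ((norm y)\<^sup>2 * (f y)\<^sup>2)"
      using AE_lborel_nonzero
    proof eventually_elim
      case (elim y)
      have "(\<integral>\<^sup>+x. ennreal (C1 * norm x powr (- 3 / 2) * h x y) \<partial>lborel) =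
         (\<integral>\<^sup>+x. ennreal (C1 * (f y)\<^sup>2 * norm y powr (5 / 2)) * ennreal (norm x powr - (3 / 2) * norm (y - x) powr - 2) \<partial>lborel)"
        using C1(1) by (intro nn_integral_cong) (subst ennreal_mult[symmetric], auto simp: h_def mult_ac norm_minus_commute)
      also have "\<dots> = ennreal (C1 * (f y)\<^sup>2 * norm y powr (5 / 2)) * (\<integral>\<^sup>+x. ennreal (norm x powr - (3 / 2) * norm (y - x) powr - 2) \<partial>lborel)"
        by (rule nn_integral_cmult) measurable
      also have "\<dots> \<le> ennreal (C1 * (f y)\<^sup>2 * norm y powr (5 / 2)) * ennreal (C2 * norm y powr (- 1 / 2))"
        by (intro mult_left_mono C2 elim) auto
      also have "\<dots> = ennreal (C1 * C2) * ennreal ((norm y)\<^sup>2 * (f y)\<^sup>2)"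
      proof -
        have p: "norm y powr (5 / 2) * norm y powr (- 1 / 2) = (norm y)\<^sup>2"
          using powr_add[of "norm y" "5 / 2" "- 1 / 2"] elim by simp
        have "C1 * (f y)\<^sup>2 * norm y powr (5 / 2) * (C2 * norm y powr (- 1 / 2)) = C1 * C2 * ((norm y)\<^sup>2 * (f y)\<^sup>2)"
          unfolding p[symmetric] by (simp only: mult_ac)
        then show ?thesis
          using C1(1) C2(1) by (simp add: ennreal_mult[symmetric] del: ennreal_mult'' ennreal_mult')
      qed
      finally show ?case .
    qed
  qed
  also have "\<dots> = ennreal (C1 * C2) * (\<integral>\<^sup>+y. ennreal ((norm y)\<^sup>2 * (f y)\<^sup>2) \<partial>lborel)"
    by (rule nn_integral_cmult) measurable
  also have "\<dots> < \<infinity>" using fin by (simp add: ennreal_mult_less_top)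
  finally show ?thesis .
qed

lemma nonneg_borel_version:
  fixes F :: "real^3 \<Rightarrow> 'b::euclidean_space"
  assumes F: "F \<in> borel_measurable lebesgue"
  obtains f :: "real^3 \<Rightarrow> real" where "f \<in> borel_measurable borel" "\<And>y. f y \<ge> 0" "AE y in lebesgue. norm (F y) = f y"
proof -
  obtain f0 where f0: "f0 \<in> borel_measurable lborel" "AE y in lborel. norm (F y) = f0 y"
    using completion_ex_borel_measurable_real[of "\<lambda>y. norm (F y)" lborel] measurable_compose[OF F borel_measurable_norm]
    by blast
  show ?thesis
  proof
    show "(\<lambda>y. \<bar>f0 y\<bar>) \<in> borel_measurable borel" using f0(1) by simp
    have "AE y in lborel. norm (F y) = \<bar>f0 y\<bar>"
      using f0(2) by eventually_elim (metis abs_norm_cancel)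
    then show "AE y in lebesgue. norm (F y) = \<bar>f0 y\<bar>" by (rule AE_completion)
  qed simp
qed

text \<open>Integrability does not have to be assumed: without it the integral is 0 by convention,
  and the bound is trivial.\<close>

lemma norm_kernel_op_le:
  assumes k: "\<And>z. \<bar>k z\<bar> \<le> g z"
  shows "ennreal (norm (kernel_op k F x)) \<le> (\<integral>\<^sup>+y. ennreal (g (x - y) * norm (F y)) \<partial>lebesgue)"
proof (cases "integrable lebesgue (\<lambda>y. k (x - y) *\<^sub>R F y)")
  case True
  then have "ennreal (norm (kernel_op k F x)) \<le> (\<integral>\<^sup>+y. ennreal (norm (k (x - y) *\<^sub>R F y)) \<partial>lebesgue)"
    unfolding kernel_op_def by (rule integral_norm_bound_ennreal)
  also have "\<dots> \<le> (\<integral>\<^sup>+y. ennreal (g (x - y) * norm (F y)) \<partial>lebesgue)"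
    by (intro nn_integral_mono ennreal_leI) (auto intro!: mult_right_mono k)
  finally show ?thesis .
qed (simp add: kernel_op_def not_integrable_integral_eq)

lemma Stein_Weiss:
  fixes F :: "real^3 \<Rightarrow> 'b::euclidean_space"
  assumes F: "F \<in> borel_measurable lebesgue"
    and fin: "(\<integral>\<^sup>+y. ennreal ((norm y)\<^sup>2 * (norm (F y))\<^sup>2) \<partial>lebesgue) < \<infinity>"
  shows "(\<integral>\<^sup>+x. (\<integral>\<^sup>+y. ennreal (norm (x - y) powr - 2 * norm (F y)) \<partial>lebesgue)\<^sup>2 \<partial>lebesgue) < \<infinity>"
proof -
  obtain f where f: "f \<in> borel_measurable borel" "\<And>y. f y \<ge> 0" "AE y in lebesgue. norm (F y) = f y"
    using nonneg_borel_version[OF F] by blast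
  have "(\<integral>\<^sup>+y. ennreal ((norm y)\<^sup>2 * (norm (F y))\<^sup>2) \<partial>lebesgue) = (\<integral>\<^sup>+y. ennreal ((norm y)\<^sup>2 * (f y)\<^sup>2) \<partial>lebesgue)"
    by (rule nn_integral_cong_AE) (use f(3) in eventually_elim, simp)
  moreover have "(\<integral>\<^sup>+y. ennreal (norm (x - y) powr - 2 * norm (F y)) \<partial>lebesgue) =
      (\<integral>\<^sup>+y. ennreal (norm (x - y) powr - 2 * f y) \<partial>lebesgue)" for x
    by (rule nn_integral_cong_AE) (use f(3) in eventually_elim, simp)
  ultimately show ?thesis
    using Stein_Weiss_borel[OF f(1,2)] fin by (simp add: nn_integral_completion)
qed

lemma L2_kernel_op:
  fixes F :: "real^3 \<Rightarrow> 'b::euclidean_space"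
  assumes F: "F \<in> borel_measurable lebesgue"
    and fin: "(\<integral>\<^sup>+y. ennreal ((norm y)\<^sup>2 * (norm (F y))\<^sup>2) \<partial>lebesgue) < \<infinity>"
    and k: "k \<in> borel_measurable borel" "\<And>z. \<bar>k z\<bar> \<le> norm z powr - 2"
  shows "integrable lebesgue (\<lambda>x. (norm (kernel_op k F x))\<^sup>2)"
proof (rule integrableI_nonneg)
  have "(\<integral>\<^sup>+x. ennreal ((norm (kernel_op k F x))\<^sup>2) \<partial>lebesgue) \<le>
      (\<integral>\<^sup>+x. (\<integral>\<^sup>+y. ennreal (norm (x - y) powr - 2 * norm (F y)) \<partial>lebesgue)\<^sup>2 \<partial>lebesgue)"
    unfolding ennreal_power[OF norm_ge_zero, symmetric]
    by (intro nn_integral_mono power_mono norm_kernel_op_le k) auto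
  also have "\<dots> < \<infinity>" by (rule Stein_Weiss[OF F fin])
  finally show "(\<integral>\<^sup>+x. ennreal ((norm (kernel_op k F x))\<^sup>2) \<partial>lebesgue) < \<infinity>" .
  show "(\<lambda>x. (norm (kernel_op k F x))\<^sup>2) \<in> borel_measurable lebesgue"
    by (intro borel_measurable_power measurable_compose[OF kernel_op_measurable borel_measurable_norm] k F)
qed simp

section \<open>Weighted square-integrable functions\<close>

abbreviation weight :: "real \<Rightarrow> real^3 \<Rightarrow> real" where
  "weight \<gamma> x \<equiv> 1 + norm x powr \<gamma>"

lemma weight_ge:
  assumes "0 \<le> s" "s \<le> \<gamma>"
  shows "norm x powr s \<le> weight \<gamma> x"
proof (cases "norm x \<le> 1")
  case True
  then have "norm x powr s \<le> 1 powr s" using assms by (intro powr_mono2) auto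
  then show ?thesis by (simp add: add_increasing2)
next
  case False
  then have "norm x powr s \<le> norm x powr \<gamma>" using assms by (intro powr_mono) auto
  then show ?thesis by simp
qed

lemma weight_pos: "0 < weight \<gamma> x" by (simp add: add_pos_nonneg)

text \<open>The weight is at least \<open>|y|^(3/2)\<close>, as \<open>3 / 2\<close> lies between 0
  and \<gamma>. The integral is thus bounded by the two-power integral with
  \<open>s = 3 / 2\<close>, whose bound tends to 0 at infinity; this is the source of the decay of
  the potential \<open>u\<close>. At \<open>x = 0\<close> the two singularities coincide and that
  estimate says nothing, so finiteness is checked there separately.\<close>

lemma inverse_weight_kernel:
  assumes "\<gamma> > 2"
  shows "(\<integral>\<^sup>+y. ennreal (norm (x - y) powr - 2 / weight \<gamma> y) \<partial>lborel) < \<infinity>"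
    and "\<exists>C>0. \<forall>x::real^3. x \<noteq> 0 \<longrightarrow>
      (\<integral>\<^sup>+y. ennreal (norm (x - y) powr - 2 / weight \<gamma> y) \<partial>lborel) \<le> ennreal (C * norm x powr (- 1 / 2))"
proof -
  obtain C where C: "C > 0" "\<And>x::real^3. x \<noteq> 0 \<Longrightarrow>
    (\<integral>\<^sup>+y. ennreal (norm y powr - (3 / 2) * norm (x - y) powr - 2) \<partial>lborel) \<le> ennreal (C * norm x powr (- 1 / 2))"
    using nn_integral_two_powers[of "3 / 2"] by auto
  have inv: "1 / weight \<gamma> y \<le> norm y powr - (3 / 2)" if "y \<noteq> 0" for y :: "real^3"
  proof -
    have "1 / weight \<gamma> y \<le> 1 / norm y powr (3 / 2)"
      using weight_ge[of "3 / 2" \<gamma> y] assms that by (intro divide_left_mono) (auto simp: add_pos_nonneg)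
    then show ?thesis by (simp add: powr_minus_divide)
  qed
  have bound: "(\<integral>\<^sup>+y. ennreal (norm (x - y) powr - 2 / weight \<gamma> y) \<partial>lborel) \<le> ennreal (C * norm x powr (- 1 / 2))"
    if "x \<noteq> 0" for x :: "real^3"
  proof -
    have "(\<integral>\<^sup>+y. ennreal (norm (x - y) powr - 2 / weight \<gamma> y) \<partial>lborel) \<le>
        (\<integral>\<^sup>+y. ennreal (norm y powr - (3 / 2) * norm (x - y) powr - 2) \<partial>lborel)"
    proof (intro nn_integral_mono_AE eventually_mono[OF AE_lborel_nonzero] ennreal_leI)
      show "norm (x - y) powr - 2 / weight \<gamma> y \<le> norm y powr - (3 / 2) * norm (x - y) powr - 2" if "y \<noteq> 0" for y
        using mult_right_mono[OF inv[OF that], of "norm (x - y) powr - 2"] by simp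
    qed
    also have "\<dots> \<le> ennreal (C * norm x powr (- 1 / 2))" by (rule C(2)[OF that])
    finally show ?thesis .
  qed
  show "\<exists>C>0. \<forall>x::real^3. x \<noteq> 0 \<longrightarrow>
      (\<integral>\<^sup>+y. ennreal (norm (x - y) powr - 2 / weight \<gamma> y) \<partial>lborel) \<le> ennreal (C * norm x powr (- 1 / 2))"
    using bound C(1) by blast
  show "(\<integral>\<^sup>+y. ennreal (norm (x - y) powr - 2 / weight \<gamma> y) \<partial>lborel) < \<infinity>"
  proof (cases "x = 0")
    case True
    let ?a = "\<lambda>y::real^3. ennreal (norm y powr - 2) * indicator (cball 0 1) y"
    \<comment> \<open>Beyond the unit ball the kernel contributes the exponent 2 and the weight
      \<open>3 / 2\<close>; their sum exceeds 3.\<close>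
    let ?b = "\<lambda>y::real^3. ennreal (norm y powr - (7 / 2)) * indicator (- ball 0 1) y"
    have m: "(\<lambda>y::real^3. ennreal (norm y powr t)) \<in> borel_measurable borel" for t by measurable
    have "?a \<in> borel_measurable borel" "?b \<in> borel_measurable borel"
      by (rule borel_measurable_times_ennreal[OF m borel_measurable_indicator], simp)+
    then have meas: "?a \<in> borel_measurable lborel" "?b \<in> borel_measurable lborel" by simp_all
    have "(\<integral>\<^sup>+y. ennreal (norm (x - y) powr - 2 / weight \<gamma> y) \<partial>lborel) \<le> (\<integral>\<^sup>+y. ?a y + ?b y \<partial>lborel)"
    proof (intro nn_integral_mono_AE eventually_mono[OF AE_lborel_nonzero])
      fix y :: "real^3" assume y: "y \<noteq> 0"
      show "ennreal (norm (x - y) powr - 2 / weight \<gamma> y) \<le> ?a y + ?b y"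
      proof (cases "norm y \<le> 1")
        case True
        have "norm y powr - 2 / weight \<gamma> y \<le> norm y powr - 2 / 1"
          by (intro divide_left_mono) (auto simp: add_pos_nonneg)
        then have "ennreal (norm (x - y) powr - 2 / weight \<gamma> y) \<le> ?a y"
          using True \<open>x = 0\<close> by (simp add: ennreal_leI)
        then show ?thesis by (rule add_increasing2[OF zero_le])
      next
        case False
        have "norm y powr - 2 / weight \<gamma> y \<le> norm y powr - 2 * norm y powr - (3 / 2)"
          using mult_left_mono[OF inv[OF y], of "norm y powr - 2"] by simp
        also have "\<dots> = norm y powr - (7 / 2)" using powr_add[of "norm y" "- 2" "- (3 / 2)"] by simp
        finally have "ennreal (norm (x - y) powr - 2 / weight \<gamma> y) \<le> ?b y"
          using False \<open>x = 0\<close> by (simp add: ennreal_leI)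
        then show ?thesis by (rule add_increasing[OF zero_le])
      qed
    qed
    also have "\<dots> = (\<integral>\<^sup>+y. ?a y \<partial>lborel) + (\<integral>\<^sup>+y. ?b y \<partial>lborel)" by (rule nn_integral_add[OF meas])
    also have "\<dots> < \<infinity>"
      using nn_integral_norm_powr_cball[of 2 1] nn_integral_norm_powr_outside[of "7 / 2" 1] by simp
    finally show ?thesis .
  next
    case False
    show ?thesis by (rule le_less_trans[OF bound[OF False]]) simp
  qed
qed

text \<open>Young's inequality with a free parameter replaces the product of norms: completing a
  square gives \<open>2 |k| |F| \<le> d w |F|^2 + k^2 / (d w)\<close> pointwise. This one inequality
  yields both integrability and a bound; a small \<open>d\<close> makes the contribution of
  \<open>F\<close> small uniformly in the kernel.\<close>

lemma weighted_Cauchy_Schwarz: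
  fixes F :: "real^3 \<Rightarrow> 'b::euclidean_space"
  assumes F: "F \<in> borel_measurable lebesgue" "integrable lebesgue (\<lambda>y. w y * (norm (F y))\<^sup>2)"
    and w: "w \<in> borel_measurable borel" "\<And>y. w y > 0"
    and k: "k \<in> borel_measurable borel" "(\<integral>\<^sup>+y. ennreal ((k y)\<^sup>2 / w y) \<partial>lborel) < \<infinity>"
  shows "integrable lebesgue (\<lambda>y. k y *\<^sub>R F y)"
    and "d > 0 \<Longrightarrow> (LINT y|lebesgue. \<bar>k y\<bar> * norm (F y)) \<le>
      d * (LINT y|lebesgue. w y * (norm (F y))\<^sup>2) + enn2real (\<integral>\<^sup>+y. ennreal ((k y)\<^sup>2 / w y) \<partial>lborel) / d"
proof -
  have m: "(\<lambda>y. (k y)\<^sup>2 / w y) \<in> borel_measurable borel" using k w by measurable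
  have i: "integrable lborel (\<lambda>y. (k y)\<^sup>2 / w y)"
    using m k(2) w(2) by (intro integrableI_nonneg) (auto simp: less_imp_le)
  then have i': "integrable lebesgue (\<lambda>y. (k y)\<^sup>2 / w y)" using lebesgue_integral_borel(2)[OF m] by simp
  have young: "\<bar>k y\<bar> * norm (F y) \<le> d * (w y * (norm (F y))\<^sup>2) + (k y)\<^sup>2 / w y / d" if "d > 0" for y d
  proof -
    have p: "sqrt (d * w y) > 0" using w(2)[of y] that by simp
    have sq: "(sqrt (d * w y))\<^sup>2 = d * w y" using w(2)[of y] that by simp
    have "0 \<le> (sqrt (d * w y) * norm (F y) - \<bar>k y\<bar> / sqrt (d * w y))\<^sup>2" by simp
    also have "\<dots> = (sqrt (d * w y))\<^sup>2 * (norm (F y))\<^sup>2 + (k y)\<^sup>2 / (sqrt (d * w y))\<^sup>2 - 2 * (\<bar>k y\<bar> * norm (F y))"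
      using p w(2)[of y] that by (simp add: power2_diff power_mult_distrib power_divide)
    also have "\<dots> = d * (w y * (norm (F y))\<^sup>2) + (k y)\<^sup>2 / w y / d - 2 * (\<bar>k y\<bar> * norm (F y))"
      unfolding sq by (simp add: mult_ac)
    finally have "2 * (\<bar>k y\<bar> * norm (F y)) \<le> d * (w y * (norm (F y))\<^sup>2) + (k y)\<^sup>2 / w y / d" by simp
    moreover have "0 \<le> \<bar>k y\<bar> * norm (F y)" by simp
    ultimately show ?thesis by linarith
  qed
  show int: "integrable lebesgue (\<lambda>y. k y *\<^sub>R F y)"
  proof (rule Bochner_Integration.integrable_bound)
    show "integrable lebesgue (\<lambda>y. 1 * (w y * (norm (F y))\<^sup>2) + (k y)\<^sup>2 / w y / 1)"
      using F(2) i' by simp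
    show "(\<lambda>y. k y *\<^sub>R F y) \<in> borel_measurable lebesgue"
      by (intro borel_measurable_scaleR lebesgue_measurable_borel k F)
    show "AE y in lebesgue. norm (k y *\<^sub>R F y) \<le> norm (1 * (w y * (norm (F y))\<^sup>2) + (k y)\<^sup>2 / w y / 1)"
    proof (intro always_eventually allI)
      fix y
      have "norm (k y *\<^sub>R F y) \<le> 1 * (w y * (norm (F y))\<^sup>2) + (k y)\<^sup>2 / w y / 1" using young[of 1 y] by simp
      also have "\<dots> \<le> norm \<dots>" by simp
      finally show "norm (k y *\<^sub>R F y) \<le> norm (1 * (w y * (norm (F y))\<^sup>2) + (k y)\<^sup>2 / w y / 1)" .
    qed
  qed
  show "(LINT y|lebesgue. \<bar>k y\<bar> * norm (F y)) \<le>
      d * (LINT y|lebesgue. w y * (norm (F y))\<^sup>2) + enn2real (\<integral>\<^sup>+y. ennreal ((k y)\<^sup>2 / w y) \<partial>lborel) / d" if "d > 0"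
  proof -
    have j: "integrable lebesgue (\<lambda>y. d * (w y * (norm (F y))\<^sup>2))" "integrable lebesgue (\<lambda>y. (k y)\<^sup>2 / w y / d)"
      using integrable_divide_zero[OF i'] integrable_mult_right[OF F(2)] by auto
    have "(LINT y|lebesgue. \<bar>k y\<bar> * norm (F y)) \<le> (LINT y|lebesgue. d * (w y * (norm (F y))\<^sup>2) + (k y)\<^sup>2 / w y / d)"
      using integrable_norm[OF int] by (intro integral_mono young that Bochner_Integration.integrable_add j) simp
    also have "\<dots> = (LINT y|lebesgue. d * (w y * (norm (F y))\<^sup>2)) + (LINT y|lebesgue. (k y)\<^sup>2 / w y / d)"
      by (rule Bochner_Integration.integral_add[OF j])
    also have "\<dots> = d * (LINT y|lebesgue. w y * (norm (F y))\<^sup>2) + (LINT y|lebesgue. (k y)\<^sup>2 / w y) / d"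
      by (simp only: integral_mult_right_zero integral_divide_zero)
    also have "(LINT y|lebesgue. (k y)\<^sup>2 / w y) = (LINT y|lborel. (k y)\<^sup>2 / w y)"
      by (rule lebesgue_integral_borel(1)[OF m])
    also have "\<dots> = enn2real (\<integral>\<^sup>+y. ennreal ((k y)\<^sup>2 / w y) \<partial>lborel)"
      using m w(2) by (intro integral_eq_nn_integral) (auto simp: less_imp_le)
    finally show ?thesis .
  qed
qed

abbreviation L2w :: "real \<Rightarrow> (real^3 \<Rightarrow> 'b::euclidean_space) set" where
  "L2w \<gamma> \<equiv> L2_weighted (weight \<gamma>)"

lemma L2w_D:
  fixes F :: "real^3 \<Rightarrow> 'b::euclidean_space"
  assumes "F \<in> L2w \<gamma>"
  shows "F \<in> borel_measurable lebesgue" "integrable lebesgue (\<lambda>y. weight \<gamma> y * (norm (F y))\<^sup>2)"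
  using assms by (auto simp: L2_weighted_def)

lemma weight_borel: "weight \<gamma> \<in> borel_measurable borel" by measurable

lemma norm_square_measurable:
  fixes F :: "real^3 \<Rightarrow> 'b::euclidean_space"
  assumes "F \<in> borel_measurable lebesgue"
  shows "(\<lambda>y. (norm (F y))\<^sup>2) \<in> borel_measurable lebesgue"
  by (intro borel_measurable_power measurable_compose[OF assms borel_measurable_norm])

lemma L2w_mult_le:
  fixes F :: "real^3 \<Rightarrow> 'b::euclidean_space"
  assumes "F \<in> L2w \<gamma>" "0 \<le> s" "s \<le> \<gamma>"
  shows "integrable lebesgue (\<lambda>y. norm y powr s * (norm (F y))\<^sup>2)" "integrable lebesgue (\<lambda>y. (norm (F y))\<^sup>2)"
proof -
  have b: "(\<lambda>y::real^3. norm y powr s) \<in> borel_measurable borel" by measurable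
  note m = norm_square_measurable[OF L2w_D(1)[OF assms(1)]]
  show "integrable lebesgue (\<lambda>y. norm y powr s * (norm (F y))\<^sup>2)"
    by (rule Bochner_Integration.integrable_bound[OF L2w_D(2)[OF assms(1)]])
      (auto intro!: always_eventually mult_right_mono weight_ge assms borel_measurable_times m
        lebesgue_measurable_borel[OF b] simp: abs_mult add_nonneg_nonneg)
  show "integrable lebesgue (\<lambda>y. (norm (F y))\<^sup>2)"
    by (rule Bochner_Integration.integrable_bound[OF L2w_D(2)[OF assms(1)]])
      (use m in \<open>auto intro!: always_eventually simp: abs_mult algebra_simps\<close>)
qed

lemma L2w_fin:
  fixes F :: "real^3 \<Rightarrow> 'b::euclidean_space"
  assumes "F \<in> L2w \<gamma>" "\<gamma> > 2"
  shows "(\<integral>\<^sup>+y. ennreal ((norm y)\<^sup>2 * (norm (F y))\<^sup>2) \<partial>lebesgue) < \<infinity>"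
proof -
  have e: "norm y powr 2 = (norm y)\<^sup>2" for y :: "real^3" by (cases "y = 0") auto
  show ?thesis
    using L2w_mult_le(1)[OF assms(1), of 2] assms(2) unfolding integrable_iff_bounded e by simp
qed

text \<open>The conditions on the kernels \<open>fund (x - y)\<close> and
  \<open>(1 + |y|)^(-1)\<close> in the weighted Cauchy-Schwarz estimate. Their squares are at most
  \<open>|x - y|^(-2)\<close>, as \<open>4 pi \<ge> 1\<close>, and \<open>|y|^(-2)\<close>.\<close>

lemma fund_weight_fin:
  assumes "\<gamma> > 2"
  shows "(\<integral>\<^sup>+y. ennreal ((fund (x - y))\<^sup>2 / weight \<gamma> y) \<partial>lborel) < \<infinity>"
    and "(\<integral>\<^sup>+y. ennreal ((fund (x - y))\<^sup>2 / weight \<gamma> y) \<partial>lborel) \<le> (\<integral>\<^sup>+y. ennreal (norm (x - y) powr - 2 / weight \<gamma> y) \<partial>lborel)"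
    and "(\<integral>\<^sup>+y. ennreal (((1 + norm y) powr - 1)\<^sup>2 / weight \<gamma> (y::real^3)) \<partial>lborel) < \<infinity>"
proof -
  have sq: "(t powr - 1)\<^sup>2 = t powr - 2" for t :: real
    using powr_add[of t "-1" "-1"] by (simp add: power2_eq_square)
  have "(fund z)\<^sup>2 \<le> norm z powr - 2" for z
  proof -
    have "1 \<le> 4 * pi" using pi_gt3 by simp
    then have "1 \<le> (4 * pi)\<^sup>2" by (rule one_le_power)
    then show ?thesis unfolding fund_powr power_divide sq
      by (simp add: divide_le_eq mult_le_cancel_left1)
  qed
  then show le: "(\<integral>\<^sup>+y. ennreal ((fund (x - y))\<^sup>2 / weight \<gamma> y) \<partial>lborel) \<le> (\<integral>\<^sup>+y. ennreal (norm (x - y) powr - 2 / weight \<gamma> y) \<partial>lborel)"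
    by (intro nn_integral_mono ennreal_leI divide_right_mono) (auto simp: add_nonneg_nonneg)
  show "(\<integral>\<^sup>+y. ennreal ((fund (x - y))\<^sup>2 / weight \<gamma> y) \<partial>lborel) < \<infinity>"
    using le inverse_weight_kernel(1)[OF assms, of x] by (rule le_less_trans)
  have "(\<integral>\<^sup>+y. ennreal (((1 + norm y) powr - 1)\<^sup>2 / weight \<gamma> (y::real^3)) \<partial>lborel) \<le>
      (\<integral>\<^sup>+y. ennreal (norm (0 - y) powr - 2 / weight \<gamma> y) \<partial>lborel)"
  proof (intro nn_integral_mono_AE eventually_mono[OF AE_lborel_nonzero] ennreal_leI divide_right_mono)
    show "((1 + norm y) powr - 1)\<^sup>2 \<le> norm (0 - y) powr - 2" if "y \<noteq> 0" for y :: "real^3"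
      unfolding sq using that by (intro powr_mono2') auto
  qed (auto simp: add_nonneg_nonneg)
  then show "(\<integral>\<^sup>+y. ennreal (((1 + norm y) powr - 1)\<^sup>2 / weight \<gamma> (y::real^3)) \<partial>lborel) < \<infinity>"
    using inverse_weight_kernel(1)[OF assms, of 0] by (rule le_less_trans)
qed

lemma L2w_fund_integrable:
  fixes F :: "real^3 \<Rightarrow> 'b::euclidean_space"
  assumes "F \<in> L2w \<gamma>" "\<gamma> > 2"
  shows "integrable lebesgue (\<lambda>y. fund (x - y) *\<^sub>R F y)"
  by (rule weighted_Cauchy_Schwarz(1)[OF L2w_D[OF assms(1)] weight_borel weight_pos _ fund_weight_fin(1)[OF assms(2)]])
    measurable

text \<open>The two rates are those of a potential and of its gradient.
  \<open>(1 + |y|)^(-2)\<close> is square-integrable, so it can be paired with any square-integrable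
  field. The square of \<open>(1 + |y|)^(-1)\<close> becomes integrable only after division by the
  weight, so this rate calls for a weighted field.\<close>

lemma decay_integrable:
  fixes F :: "real^3 \<Rightarrow> 'b::euclidean_space"
  shows "F \<in> L2w \<gamma> \<Longrightarrow> \<gamma> > 2 \<Longrightarrow> integrable lebesgue (\<lambda>y. (1 + norm y) powr - 1 *\<^sub>R F y)"
    and "F \<in> borel_measurable lebesgue \<Longrightarrow> integrable lebesgue (\<lambda>y. (norm (F y))\<^sup>2) \<Longrightarrow>
      integrable lebesgue (\<lambda>y. (1 + norm y) powr - 2 *\<^sub>R F y)"
proof -
  show "integrable lebesgue (\<lambda>y. (1 + norm y) powr - 1 *\<^sub>R F y)" if "F \<in> L2w \<gamma>" "\<gamma> > 2"
    by (rule weighted_Cauchy_Schwarz(1)[OF L2w_D[OF that(1)] weight_borel weight_pos _ fund_weight_fin(3)[OF that(2)]])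
      measurable
  assume F: "F \<in> borel_measurable lebesgue" "integrable lebesgue (\<lambda>y. (norm (F y))\<^sup>2)"
  have sq: "(t powr - 2)\<^sup>2 = t powr - 4" for t :: real
    using powr_add[of t "-2" "-2"] by (simp add: power2_eq_square)
  let ?a = "\<lambda>y::real^3. indicator (cball 0 1) y :: ennreal"
  let ?b = "\<lambda>y::real^3. ennreal (norm y powr - 4) * indicator (- ball 0 1) y"
  have m: "(\<lambda>y::real^3. ennreal (norm y powr t)) \<in> borel_measurable borel" for t by measurable
  have "?a \<in> borel_measurable borel"
    by (rule borel_measurable_indicator) simp
  moreover have "?b \<in> borel_measurable borel"
    by (rule borel_measurable_times_ennreal[OF m borel_measurable_indicator]) simp
  ultimately have meas: "?a \<in> borel_measurable lborel" "?b \<in> borel_measurable lborel" by simp_all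
  have "(\<integral>\<^sup>+y. ennreal (((1 + norm (y::real^3)) powr - 2)\<^sup>2 / 1) \<partial>lborel) \<le> (\<integral>\<^sup>+y. ?a y + ?b y \<partial>lborel)"
  proof (intro nn_integral_mono)
    fix y :: "real^3"
    show "ennreal (((1 + norm y) powr - 2)\<^sup>2 / 1) \<le> ?a y + ?b y"
    proof (cases "norm y \<le> 1")
      case True
      have "(1 + norm y) powr - 4 \<le> 1 powr - 4" by (intro powr_mono2') auto
      then have "ennreal (((1 + norm y) powr - 2)\<^sup>2 / 1) \<le> ?a y"
        using True unfolding sq by simp
      then show ?thesis by (rule add_increasing2[OF zero_le])
    next
      case False
      have "(1 + norm y) powr - 4 \<le> norm y powr - 4" using False by (intro powr_mono2') auto
      then have "ennreal (((1 + norm y) powr - 2)\<^sup>2 / 1) \<le> ?b y"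
        using False unfolding sq by (simp add: ennreal_leI)
      then show ?thesis by (rule add_increasing[OF zero_le])
    qed
  qed
  also have "\<dots> = (\<integral>\<^sup>+y. ?a y \<partial>lborel) + (\<integral>\<^sup>+y. ?b y \<partial>lborel)" by (rule nn_integral_add[OF meas])
  also have "\<dots> < \<infinity>"
    using nn_integral_norm_powr_outside[of 4 1] emeasure_lborel_cball_finite[of "0::real^3" 1] by simp
  finally have "(\<integral>\<^sup>+y. ennreal (((1 + norm (y::real^3)) powr - 2)\<^sup>2 / 1) \<partial>lborel) < \<infinity>" .
  then show "integrable lebesgue (\<lambda>y. (1 + norm y) powr - 2 *\<^sub>R F y)"
    using F by (intro weighted_Cauchy_Schwarz(1)[where w = "\<lambda>_. 1"]) auto
qed

section \<open>Potentials of test functions\<close>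

lemma decay_bound_nn:
  assumes p: "0 \<le> p" "p < 3"
  obtains B where "B > 0" "\<And>y::real^3. (\<integral>\<^sup>+x. ennreal (indicator (cball 0 M) x * norm (x - y) powr - p) \<partial>lborel)
    \<le> ennreal (B * (1 + norm y) powr - p)"
proof -
  obtain B where B: "B > 0" "\<And>x::real^3. (1 + norm x) powr p * (LINT z|lborel. indicator (cball 0 M) (x - z) * norm z powr - p) \<le> B"
    using decay_bound[OF p] by blast
  have "(\<integral>\<^sup>+x. ennreal (indicator (cball 0 M) x * norm (x - y) powr - p) \<partial>lborel) \<le> ennreal (B * (1 + norm y) powr - p)"
    for y :: "real^3"
  proof -
    have m: "(\<lambda>x::real^3. indicator (cball 0 M) x * norm (x - y) powr - p) \<in> borel_measurable borel" by measurable
    have I: "integrable lborel (\<lambda>z. indicator (cball 0 M) (y - z) * norm z powr - p)"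
    proof -
      have "\<bar>indicator (cball 0 M) (y - z) :: real\<bar> \<le> 1 * indicator (cball 0 (norm y + M)) z" for z
        using norm_triangle_ineq4[of y "y - z"] by (auto simp: indicator_def)
      from norm_powr_mult_integrable[OF p(2) _ this] show ?thesis by (simp add: mult.commute)
    qed
    have "(\<integral>\<^sup>+x. ennreal (indicator (cball 0 M) x * norm (x - y) powr - p) \<partial>lborel) =
        (\<integral>\<^sup>+z. ennreal (indicator (cball 0 M) (y - z) * norm ((y - z) - y) powr - p) \<partial>lborel)"
      using m by (intro nn_integral_reflect[symmetric, of "\<lambda>x. ennreal (indicator (cball 0 M) x * norm (x - y) powr - p)"]) simp
    also have "\<dots> = (\<integral>\<^sup>+z. ennreal (indicator (cball 0 M) (y - z) * norm z powr - p) \<partial>lborel)"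
      by simp
    also have "\<dots> = ennreal (LINT z|lborel. indicator (cball 0 M) (y - z) * norm z powr - p)"
      using I by (intro nn_integral_eq_integral) auto
    also have "\<dots> \<le> ennreal (B * (1 + norm y) powr - p)"
    proof (rule ennreal_leI)
      have "1 + norm y > 0" by (simp add: add_pos_nonneg)
      then show "(LINT z|lborel. indicator (cball 0 M) (y - z) * norm z powr - p) \<le> B * (1 + norm y) powr - p"
        using B(2)[of y] by (simp add: powr_minus_divide pos_le_divide_eq mult.commute)
    qed
    finally show ?thesis .
  qed
  then show ?thesis using that B(1) by blast
qed

text \<open>A bounded function of compact support, integrated against \<open>k (x - y)\<close>,
  decays in \<open>y\<close> like \<open>|y|^(-p)\<close>, and against this rate \<open>F\<close> is
  integrable by assumption. \<phi> is only required to be Borel and bounded with bounded support, so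
  that it may also be the indicator of a compact set; this yields local integrability of
  \<open>kernel_op k F\<close>.\<close>

lemma kernel_op_Fubini:
  fixes F :: "real^3 \<Rightarrow> 'b::euclidean_space"
  assumes p: "0 \<le> p" "p < 3"
    and k: "k \<in> borel_measurable borel" "\<And>z. \<bar>k z\<bar> \<le> norm z powr - p"
    and \<phi>: "\<phi> \<in> borel_measurable borel" "\<And>x. \<bar>\<phi> x\<bar> \<le> C * indicator (cball 0 M) x"
    and F: "F \<in> borel_measurable lebesgue" "integrable lebesgue (\<lambda>y. (1 + norm y) powr - p *\<^sub>R F y)"
  shows "(LINT x|lebesgue. \<phi> x *\<^sub>R kernel_op k F x) = (LINT y|lebesgue. (LINT x|lborel. \<phi> x * k (x - y)) *\<^sub>R F y)"
    and "integrable lebesgue (\<lambda>x. \<phi> x *\<^sub>R kernel_op k F x)"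
proof -
  let ?f = "\<lambda>x y. (\<phi> x * k (x - y)) *\<^sub>R F y"
  obtain B where B: "B > 0" "\<And>y::real^3. (\<integral>\<^sup>+x. ennreal (indicator (cball 0 M) x * norm (x - y) powr - p) \<partial>lborel)
    \<le> ennreal (B * (1 + norm y) powr - p)" using decay_bound_nn[OF p] by blast
  have C: "C \<ge> 0" if "\<phi> x \<noteq> 0" for x
    using \<phi>(2)[of x] that by (cases "norm x \<le> M") auto
  have mk: "(\<lambda>p. \<phi> (fst p) * k (fst p - snd p)) \<in> borel_measurable (borel \<Otimes>\<^sub>M borel)"
    using \<phi>(1) k(1) by measurable
  have meas: "(\<lambda>(x, y). ?f x y) \<in> borel_measurable (lebesgue \<Otimes>\<^sub>M lebesgue)"
    using borel_measurable_scaleR[OF borel_pair_lebesgue[OF mk] measurable_compose[OF measurable_snd F(1)]]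
    by (simp add: case_prod_beta)
  have nm: "(\<lambda>p. ennreal (norm (?f (fst p) (snd p)))) \<in> borel_measurable (lebesgue \<Otimes>\<^sub>M lebesgue)"
    using measurable_compose[OF measurable_compose[OF meas borel_measurable_norm] measurable_ennreal]
    by (simp add: case_prod_beta)
  have "(\<integral>\<^sup>+x. \<integral>\<^sup>+y. ennreal (norm (?f x y)) \<partial>lebesgue \<partial>lebesgue) =
      (\<integral>\<^sup>+y. \<integral>\<^sup>+x. ennreal (norm (?f x y)) \<partial>lebesgue \<partial>lebesgue)"
    by (rule Tonelli_lebesgue[OF nm])
  also have "\<dots> \<le> (\<integral>\<^sup>+y. ennreal (\<bar>C\<bar> * B) * ennreal (norm ((1 + norm y) powr - p *\<^sub>R F y)) \<partial>lebesgue)"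
  proof (rule nn_integral_mono)
    fix y :: "real^3"
    let ?h = "\<lambda>x. ennreal (indicator (cball 0 M) x * norm (x - y) powr - p)"
    have mh: "?h \<in> borel_measurable lborel" by measurable
    have "(\<integral>\<^sup>+x. ennreal (norm (?f x y)) \<partial>lebesgue) \<le> (\<integral>\<^sup>+x. ennreal (\<bar>C\<bar> * norm (F y)) * ?h x \<partial>lebesgue)"
    proof (rule nn_integral_mono)
      fix x
      have "\<bar>\<phi> x\<bar> * \<bar>k (x - y)\<bar> \<le> (\<bar>C\<bar> * indicator (cball 0 M) x) * norm (x - y) powr - p"
        by (intro mult_mono k order_trans[OF \<phi>(2)] mult_right_mono) auto
      then have "norm (?f x y) \<le> (\<bar>C\<bar> * indicator (cball 0 M) x * norm (x - y) powr - p) * norm (F y)"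
        by (simp add: abs_mult mult_right_mono)
      also have "\<dots> = (\<bar>C\<bar> * norm (F y)) * (indicator (cball 0 M) x * norm (x - y) powr - p)"
        by (simp only: mult_ac)
      finally have "ennreal (norm (?f x y)) \<le> ennreal ((\<bar>C\<bar> * norm (F y)) * (indicator (cball 0 M) x * norm (x - y) powr - p))"
        by (rule ennreal_leI)
      then show "ennreal (norm (?f x y)) \<le> ennreal (\<bar>C\<bar> * norm (F y)) * ?h x"
        by (subst ennreal_mult[symmetric]) auto
    qed
    also have "\<dots> = ennreal (\<bar>C\<bar> * norm (F y)) * (\<integral>\<^sup>+x. ?h x \<partial>lborel)"
      unfolding nn_integral_completion by (rule nn_integral_cmult[OF mh])
    also have "\<dots> \<le> ennreal (\<bar>C\<bar> * norm (F y)) * ennreal (B * (1 + norm y) powr - p)"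
      by (intro mult_left_mono B) auto
    also have "\<dots> = ennreal (\<bar>C\<bar> * B) * ennreal (norm ((1 + norm y) powr - p *\<^sub>R F y))"
      using B(1) by (subst (1 2) ennreal_mult[symmetric]) (auto simp: mult_ac)
    finally show "(\<integral>\<^sup>+x. ennreal (norm (?f x y)) \<partial>lebesgue) \<le>
      ennreal (\<bar>C\<bar> * B) * ennreal (norm ((1 + norm y) powr - p *\<^sub>R F y))" .
  qed
  also have "\<dots> = ennreal (\<bar>C\<bar> * B) * (\<integral>\<^sup>+y. ennreal (norm ((1 + norm y) powr - p *\<^sub>R F y)) \<partial>lebesgue)"
    using F(2) by (intro nn_integral_cmult measurable_compose[OF measurable_compose[OF _ borel_measurable_norm] measurable_ennreal])
      (rule borel_measurable_integrable)
  also have "\<dots> < \<infinity>"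
    using F(2) unfolding integrable_iff_bounded by (simp add: ennreal_mult_less_top)
  finally have fin: "(\<integral>\<^sup>+x. \<integral>\<^sup>+y. ennreal (norm (?f x y)) \<partial>lebesgue \<partial>lebesgue) < \<infinity>" .
  have e: "\<phi> x *\<^sub>R kernel_op k F x = (LINT y|lebesgue. ?f x y)" for x
  proof (cases "\<phi> x = 0")
    case False
    then show ?thesis unfolding kernel_op_def by (simp flip: scaleR_scaleR)
  qed simp
  have e': "(LINT x|lebesgue. ?f x y) = (LINT x|lborel. \<phi> x * k (x - y)) *\<^sub>R F y" for y
  proof -
    have m: "(\<lambda>x. \<phi> x * k (x - y)) \<in> borel_measurable borel" using \<phi>(1) k(1) by measurable
    then have "(LINT x|lebesgue. ?f x y) = (LINT x|lborel. ?f x y)"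
      by (intro lebesgue_integral_borel(1) borel_measurable_scaleR borel_measurable_const)
    also have "\<dots> = (LINT x|lborel. \<phi> x * k (x - y)) *\<^sub>R F y"
    proof (cases "F y = 0")
      case False
      \<comment> \<open>Scaling by \<open>F y\<close> has a bounded left inverse, the inner product
        with \<open>F y\<close> divided by \<open>F y \<bullet> F y\<close>. The factor can
        therefore be taken out of the integral without knowing that the scalar integrand is
        integrable.\<close>
      show ?thesis
        by (rule integral_bounded_linear'[OF bounded_linear_scaleR_left
              bounded_linear_compose[OF bounded_linear_divide[of "F y \<bullet> F y"] bounded_linear_inner_left[of "F y"]]])
          (use False in simp)
    qed simp
    finally show ?thesis .
  qed
  show "(LINT x|lebesgue. \<phi> x *\<^sub>R kernel_op k F x) = (LINT y|lebesgue. (LINT x|lborel. \<phi> x * k (x - y)) *\<^sub>R F y)"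
    unfolding e using Fubini_lebesgue(1)[OF meas fin] by (simp add: e')
  show "integrable lebesgue (\<lambda>x. \<phi> x *\<^sub>R kernel_op k F x)"
    unfolding e by (rule Fubini_lebesgue(2)[OF meas fin])
qed

lemma locally_integrable_kernel_op:
  fixes F :: "real^3 \<Rightarrow> 'b::euclidean_space"
  assumes p: "0 \<le> p" "p < 3"
    and k: "k \<in> borel_measurable borel" "\<And>z. \<bar>k z\<bar> \<le> norm z powr - p"
    and F: "F \<in> borel_measurable lebesgue" "integrable lebesgue (\<lambda>y. (1 + norm y) powr - p *\<^sub>R F y)"
  shows "locally_integrable (kernel_op k F)"
  unfolding locally_integrable_iff
proof (intro allI impI)
  fix K :: "(real^3) set" assume K: "compact K"
  then obtain M where M: "\<And>x. x \<in> K \<Longrightarrow> norm x \<le> M" by (meson bounded_iff compact_imp_bounded)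
  show "integrable lebesgue (\<lambda>x. indicator K x *\<^sub>R kernel_op k F x)"
  proof (rule kernel_op_Fubini(2)[OF p k _ _ F])
    show "(indicator K :: _ \<Rightarrow> real) \<in> borel_measurable borel"
      using borel_measurable_indicator[OF borel_compact[OF K]] .
    show "\<bar>indicator K x :: real\<bar> \<le> 1 * indicator (cball 0 M) x" for x
      using M by (auto simp: indicator_def)
  qed
qed

lemma fund_le: "\<bar>fund z\<bar> \<le> norm z powr - 1"
proof -
  have "\<bar>fund z\<bar> = norm z powr - 1 / (4 * pi)"
    unfolding abs_of_nonneg[OF fund_nonneg] by (rule fund_powr)
  also have "\<dots> \<le> norm z powr - 1 / 1"
    using pi_gt3 by (intro divide_left_mono) auto
  finally show ?thesis by (simp only: div_by_1)
qed

lemma fund_grad_le: "\<bar>fund_grad z $ i\<bar> \<le> norm z powr - 2"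
proof -
  have "1 \<le> 4 * pi" using pi_gt3 by simp
  then have "norm z powr - 2 / (4 * pi) \<le> norm z powr - 2" by (simp add: divide_le_eq mult_le_cancel_left1)
  then show ?thesis using abs_fund_grad_le[of z i] by linarith
qed

lemma borel_measurable_fund_grad_nth [measurable]: "(\<lambda>z. fund_grad z $ i) \<in> borel_measurable borel"
  by (rule measurable_compose[OF borel_measurable_fund_grad borel_measurable_vec_nth])

lemma fund_minus: "fund (- z) = fund z" by (simp add: fund_def)

lemma fund_grad_minus: "fund_grad (- z) = - fund_grad z" by (simp add: fund_grad_def)

section \<open>The potential of a test function and its decay\<close>

definition pot :: "(real^3 \<Rightarrow> real) \<Rightarrow> real^3 \<Rightarrow> real" where "pot \<phi> = conv fund \<phi>"

lemma pot_eq: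
  assumes "test_function \<phi>"
  shows "pot \<phi> x = (LINT z|lborel. fund z * \<phi> (x - z))"
proof -
  have [measurable]: "\<phi> \<in> borel_measurable borel" by (intro smooth_borel test_function_smooth assms)
  have "(LINT z|lebesgue. \<phi> (x - z) * fund z) = (LINT z|lborel. \<phi> (x - z) * fund z)"
    by (rule lebesgue_integral_borel(1)) measurable
  then show ?thesis by (simp add: pot_def conv_def mult.commute)
qed

lemma smooth_pot: "test_function \<phi> \<Longrightarrow> smooth (pot \<phi>)"
  unfolding pot_def by (rule smooth_conv[OF locally_integrable_fund])

lemma partial_derivative_pot:
  "test_function \<phi> \<Longrightarrow> partial_derivative i (pot \<phi>) = pot (partial_derivative i \<phi>)"
  unfolding pot_def by (rule partial_derivative_conv[OF locally_integrable_fund])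

lemma partial_derivative_reflect:
  assumes "smooth \<phi>"
  shows "partial_derivative i (\<lambda>z. \<phi> (x - z)) = (\<lambda>z. - partial_derivative i \<phi> (x - z))"
  using partial_derivative_affine(1)[OF smooth_differentiable[OF assms], of i "-1" x] by simp

lemma pot_laplacian:
  assumes \<phi>: "test_function \<phi>"
  shows "(\<Sum>i\<in>UNIV. pot (partial_derivative i (partial_derivative i \<phi>)) x) = - \<phi> x"
proof -
  have t: "test_function (partial_derivative i (partial_derivative i \<phi>))" for i
    by (intro test_function_partial \<phi>)
  have s: "smooth \<phi>" "smooth (partial_derivative i \<phi>)" for i
    by (intro smooth_partial test_function_smooth \<phi>)+
  have "partial_derivative i (partial_derivative i (\<lambda>z. \<phi> (x - z))) =
      (\<lambda>z. partial_derivative i (partial_derivative i \<phi>) (x - z))" for i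
  proof
    fix z
    have "partial_derivative i (\<lambda>z. - 1 * partial_derivative i \<phi> (x - z)) z =
        - 1 * partial_derivative i (\<lambda>z. partial_derivative i \<phi> (x - z)) z"
      by (rule partial_derivative_cmult)
        (use partial_derivative_affine(2)[OF smooth_differentiable[OF s(2)], where c = "-1" and b = x] in simp)
    then show "partial_derivative i (partial_derivative i (\<lambda>z. \<phi> (x - z))) z =
       partial_derivative i (partial_derivative i \<phi>) (x - z)"
      by (simp add: partial_derivative_reflect s)
  qed
  then have "(LINT z|lborel. fund z * (\<Sum>i\<in>UNIV. partial_derivative i (partial_derivative i \<phi>) (x - z))) = - \<phi> x"
    using fund_laplacian[OF test_function_reflect[OF \<phi>, of x]] by simp
  moreover have "integrable lborel (\<lambda>z. fund z * partial_derivative i (partial_derivative i \<phi>) (x - z))" for i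
  proof -
    have [measurable]: "partial_derivative i (partial_derivative i \<phi>) \<in> borel_measurable borel"
      by (intro smooth_borel test_function_smooth t)
    have "(\<lambda>z. partial_derivative i (partial_derivative i \<phi>) (x - z) * fund z) \<in> borel_measurable borel" by measurable
    from lebesgue_integral_borel(2)[OF this] show ?thesis
      using conv_integrable[OF locally_integrable_fund t] by (simp add: mult.commute)
  qed
  ultimately show ?thesis
    by (simp add: pot_eq[OF t] sum_distrib_left Bochner_Integration.integral_sum)
qed

text \<open>The derivative is moved from \<phi> to the kernel, where it gains one power of decay:
  the gradient of the potential is of order \<open>1 / |x|^2\<close>, not merely
  \<open>1 / |x|\<close>.\<close>

lemma pot_partial_eq:
  assumes \<phi>: "test_function \<phi>"
  shows "pot (partial_derivative i \<phi>) x = (LINT z|lborel. fund_grad z $ i * \<phi> (x - z))"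
  using fund_partial[OF test_function_reflect[OF \<phi>], of i x]
  by (simp add: pot_eq[OF test_function_partial[OF \<phi>]] partial_derivative_reflect[OF test_function_smooth[OF \<phi>]])

text \<open>In these integrals the kernel is reflected. \<open>fund\<close> is even and
  \<open>fund_grad\<close> is odd, hence the sign in the second equation.\<close>

lemma integral_test_kernel:
  assumes \<phi>: "test_function \<phi>"
  shows "(LINT x|lborel. \<phi> x * fund (x - y)) = pot \<phi> y"
    and "(LINT x|lborel. \<phi> x * fund_grad (x - y) $ i) = - pot (partial_derivative i \<phi>) y"
proof -
  have [measurable]: "\<phi> \<in> borel_measurable borel" by (intro smooth_borel test_function_smooth \<phi>)
  have r: "(LINT x|lborel. h x) = (LINT z|lborel. h (y - z))" if "h \<in> borel_measurable borel" for h :: "real^3 \<Rightarrow> real"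
    using lborel_integral_affine(1)[OF that, of "-1" y] by simp
  have "(LINT x|lborel. \<phi> x * fund (x - y)) = (LINT z|lborel. \<phi> (y - z) * fund (- z))"
    by (subst r) simp_all
  then show "(LINT x|lborel. \<phi> x * fund (x - y)) = pot \<phi> y"
    by (simp add: pot_eq[OF \<phi>] fund_minus mult.commute)
  have "(LINT x|lborel. \<phi> x * fund_grad (x - y) $ i) = (LINT z|lborel. \<phi> (y - z) * fund_grad (- z) $ i)"
    by (subst r) simp_all
  then show "(LINT x|lborel. \<phi> x * fund_grad (x - y) $ i) = - pot (partial_derivative i \<phi>) y"
    by (simp add: pot_partial_eq[OF \<phi>] fund_grad_minus mult.commute)
qed

lemma kernel_integral_decay:
  assumes p: "0 \<le> p" "p < 3" and \<phi>: "test_function \<phi>"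
    and k: "k \<in> borel_measurable borel" "\<And>z. \<bar>k z\<bar> \<le> norm z powr - p"
  shows "\<exists>B>0. \<forall>y. \<bar>LINT x|lborel. \<phi> x * k (x - y)\<bar> \<le> B * (1 + norm y) powr - p"
proof -
  obtain C M where C: "C > 0" "\<And>x. \<bar>\<phi> x\<bar> \<le> C * indicator (cball 0 M) x"
    using test_function_bound[OF \<phi>] by metis
  obtain B where B: "B > 0" "\<And>y::real^3. (\<integral>\<^sup>+x. ennreal (indicator (cball 0 M) x * norm (x - y) powr - p) \<partial>lborel)
    \<le> ennreal (B * (1 + norm y) powr - p)" using decay_bound_nn[OF p] by blast
  have [measurable]: "\<phi> \<in> borel_measurable borel" by (intro smooth_borel test_function_smooth \<phi>)
  note k(1)[measurable]
  have "\<bar>LINT x|lborel. \<phi> x * k (x - y)\<bar> \<le> C * B * (1 + norm y) powr - p" for y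
  proof (cases "integrable lborel (\<lambda>x. \<phi> x * k (x - y))")
    case True
    have "ennreal (norm (LINT x|lborel. \<phi> x * k (x - y))) \<le> (\<integral>\<^sup>+x. ennreal (norm (\<phi> x * k (x - y))) \<partial>lborel)"
      by (rule integral_norm_bound_ennreal[OF True])
    also have "\<dots> \<le> (\<integral>\<^sup>+x. ennreal C * ennreal (indicator (cball 0 M) x * norm (x - y) powr - p) \<partial>lborel)"
    proof (rule nn_integral_mono)
      fix x
      have "norm (\<phi> x * k (x - y)) \<le> (C * indicator (cball 0 M) x) * norm (x - y) powr - p"
        unfolding real_norm_def abs_mult using C(1) by (intro mult_mono C k) auto
      then show "ennreal (norm (\<phi> x * k (x - y))) \<le> ennreal C * ennreal (indicator (cball 0 M) x * norm (x - y) powr - p)"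
        using C(1) by (subst ennreal_mult[symmetric]) (auto simp: mult.assoc intro: ennreal_leI)
    qed
    also have "\<dots> = ennreal C * (\<integral>\<^sup>+x. ennreal (indicator (cball 0 M) x * norm (x - y) powr - p) \<partial>lborel)"
      by (rule nn_integral_cmult) measurable
    also have "\<dots> \<le> ennreal C * ennreal (B * (1 + norm y) powr - p)"
      by (intro mult_left_mono B) auto
    also have "\<dots> = ennreal (C * B * (1 + norm y) powr - p)"
      using C(1) B(1) by (subst ennreal_mult[symmetric]) (auto simp: mult.assoc)
    finally show ?thesis using C(1) B(1) by (subst (asm) ennreal_le_iff) auto
  next
    case False
    then show ?thesis using C(1) B(1) by (simp add: not_integrable_integral_eq)
  qed
  then show ?thesis using C(1) B(1) by (intro exI[of _ "C * B"]) auto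
qed

lemma pot_decay:
  assumes \<phi>: "test_function \<phi>"
  shows "\<exists>B>0. \<forall>x. \<bar>pot \<phi> x\<bar> \<le> B * (1 + norm x) powr - 1"
    and "\<exists>B>0. \<forall>x. \<bar>pot (partial_derivative i \<phi>) x\<bar> \<le> B * (1 + norm x) powr - 2"
  using kernel_integral_decay[OF _ _ \<phi> borel_measurable_fund fund_le]
    kernel_integral_decay[OF _ _ \<phi> borel_measurable_fund_grad_nth fund_grad_le]
  unfolding integral_test_kernel[OF \<phi>] by simp_all

lemma pot_borel: "test_function \<phi> \<Longrightarrow> pot \<phi> \<in> borel_measurable borel"
  by (intro smooth_borel smooth_pot)

lemma decay_mult_integrable:
  fixes F :: "real^3 \<Rightarrow> 'b::euclidean_space"
  assumes F: "F \<in> borel_measurable lebesgue" "integrable lebesgue (\<lambda>y. (1 + norm y) powr - p *\<^sub>R F y)"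
    and \<psi>: "\<psi> \<in> borel_measurable borel" "\<exists>B>0. \<forall>x. \<bar>\<psi> x\<bar> \<le> B * (1 + norm x) powr - p"
  shows "integrable lebesgue (\<lambda>x. \<psi> x *\<^sub>R F x)"
proof -
  obtain B where B: "B > 0" "\<And>x. \<bar>\<psi> x\<bar> \<le> B * (1 + norm x) powr - p" using \<psi>(2) by blast
  show ?thesis
  proof (rule Bochner_Integration.integrable_bound)
    show "integrable lebesgue (\<lambda>x. B *\<^sub>R ((1 + norm x) powr - p *\<^sub>R F x))" by (intro integrable_scaleR_right F)
    show "(\<lambda>x. \<psi> x *\<^sub>R F x) \<in> borel_measurable lebesgue"
      by (intro borel_measurable_scaleR lebesgue_measurable_borel \<psi> F)
    have "norm (\<psi> x *\<^sub>R F x) \<le> norm (B *\<^sub>R ((1 + norm x) powr - p *\<^sub>R F x))" for x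
      using mult_right_mono[OF B(2)[of x], of "norm (F x)"] B(1) by (simp add: mult.assoc)
    then show "AE x in lebesgue. norm (\<psi> x *\<^sub>R F x) \<le> norm (B *\<^sub>R ((1 + norm x) powr - p *\<^sub>R F x))" by simp
  qed
qed

section \<open>The fundamental lemma for vector fields\<close>

lemma fundamental_lemma:
  fixes F :: "real^3 \<Rightarrow> 'b::euclidean_space"
  assumes F: "locally_integrable F"
    and zero: "\<And>\<phi>. test_function \<phi> \<Longrightarrow> (LINT x|lebesgue. \<phi> x *\<^sub>R F x) = 0"
  shows "AE x in lebesgue. F x = 0"
proof -
  have "AE x in lebesgue. F x \<bullet> b = 0" for b
  proof (rule fundamental_lemma_real)
    show "locally_integrable (\<lambda>x. F x \<bullet> b)"
      unfolding locally_integrable_iff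
    proof (intro allI impI)
      fix K :: "(real^3) set" assume "compact K"
      then have "integrable lebesgue (\<lambda>x. indicator K x *\<^sub>R F x)" using F by (simp add: locally_integrable_iff)
      then have "integrable lebesgue (\<lambda>x. (indicator K x *\<^sub>R F x) \<bullet> b)" by (rule integrable_inner_left)
      then show "integrable lebesgue (\<lambda>x. indicator K x *\<^sub>R (F x \<bullet> b))" by simp
    qed
    fix \<phi> :: "real^3 \<Rightarrow> real" assume \<phi>: "test_function \<phi>"
    have "(LINT x|lebesgue. (\<phi> x *\<^sub>R F x) \<bullet> b) = (LINT x|lebesgue. \<phi> x *\<^sub>R F x) \<bullet> b"
      using test_function_mult_integrable[OF F \<phi>] by (intro integral_inner_left) auto
    then show "(LINT x|lebesgue. \<phi> x * (F x \<bullet> b)) = 0" using zero[OF \<phi>] by simp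
  qed
  then have "AE x in lebesgue. \<forall>b\<in>Basis. F x \<bullet> b = 0"
    by (intro AE_finite_allI) auto
  then show ?thesis by eventually_elim (simp add: euclidean_all_zero_iff)
qed

lemma locally_integrable_diff:
  fixes F G :: "real^3 \<Rightarrow> 'b::euclidean_space"
  assumes "locally_integrable F" "locally_integrable G"
  shows "locally_integrable (\<lambda>x. F x - G x)"
  using assms unfolding locally_integrable_def by (auto intro: set_integral_diff)

lemma fundamental_lemma_eq:
  fixes F G :: "real^3 \<Rightarrow> 'b::euclidean_space"
  assumes "locally_integrable F" "locally_integrable G"
    and eq: "\<And>\<phi>. test_function \<phi> \<Longrightarrow> (LINT x|lebesgue. \<phi> x *\<^sub>R F x) = (LINT x|lebesgue. \<phi> x *\<^sub>R G x)"
  shows "AE x in lebesgue. F x = G x"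
proof -
  have "AE x in lebesgue. F x - G x = 0"
  proof (rule fundamental_lemma[OF locally_integrable_diff[OF assms(1,2)]])
    fix \<phi> :: "real^3 \<Rightarrow> real" assume \<phi>: "test_function \<phi>"
    show "(LINT x|lebesgue. \<phi> x *\<^sub>R (F x - G x)) = 0"
      using eq[OF \<phi>] test_function_mult_integrable[OF assms(1) \<phi>] test_function_mult_integrable[OF assms(2) \<phi>]
      by (simp add: scaleR_diff_right)
  qed
  then show ?thesis by eventually_elim simp
qed

section \<open>First-order operators in the weak sense\<close>

text \<open>The weak gradient, divergence, curl and partial derivatives are all of the form \<open>D = \<Sum>i. L i (\<partial>i F)\<close>.\<close>

definition weak_op ::
    "(3 \<Rightarrow> 'b::euclidean_space \<Rightarrow> 'c::euclidean_space) \<Rightarrow> (real^3 \<Rightarrow> 'b) \<Rightarrow> (real^3 \<Rightarrow> 'c) \<Rightarrow> bool" where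
  "weak_op L F D \<longleftrightarrow> locally_integrable F \<and> locally_integrable D \<and>
     (\<forall>\<phi>. test_function \<phi> \<longrightarrow>
        (LINT x|lebesgue. \<phi> x *\<^sub>R D x) = - (LINT x|lebesgue. (\<Sum>i\<in>UNIV. partial_derivative i \<phi> x *\<^sub>R L i (F x))))"

abbreviation grad_symbol :: "3 \<Rightarrow> real \<Rightarrow> real^3" where "grad_symbol \<equiv> \<lambda>i t. t *\<^sub>R axis i 1"
abbreviation div_symbol :: "3 \<Rightarrow> real^3 \<Rightarrow> real" where "div_symbol \<equiv> \<lambda>i v. v $ i"
abbreviation curl_symbol :: "3 \<Rightarrow> real^3 \<Rightarrow> real^3" where "curl_symbol \<equiv> \<lambda>i v. cross3 (axis i 1) v"
abbreviation partial_symbol :: "3 \<Rightarrow> 3 \<Rightarrow> 'b \<Rightarrow> 'b::euclidean_space" where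
  "partial_symbol j \<equiv> \<lambda>i v. if i = j then v else 0"

lemma nabla_expand: "nabla \<phi> x = (\<Sum>i\<in>UNIV. partial_derivative i \<phi> x *\<^sub>R axis i 1)"
  by (simp add: vec_eq_iff axis_def if_distrib[where f = "\<lambda>t. _ * t"] cong: if_cong)

lemma cross3_nabla: "cross3 (nabla \<phi> x) v = (\<Sum>i\<in>UNIV. partial_derivative i \<phi> x *\<^sub>R cross3 (axis i 1) v)"
  by (simp add: sum_3 cross3_simps vec_eq_iff forall_3 axis_def nabla_def)

lemma weak_op_gradient: "has_weak_gradient u G \<longleftrightarrow> weak_op grad_symbol u G"
  unfolding has_weak_gradient_def weak_op_def nabla_expand
  by (simp add: scaleR_sum_right mult.commute)

lemma weak_op_divergence: "has_weak_divergence F f \<longleftrightarrow> weak_op div_symbol F f"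
  unfolding has_weak_divergence_def weak_op_def by (simp add: inner_vec_def)

lemma weak_op_curl: "has_weak_curl F C \<longleftrightarrow> weak_op curl_symbol F C"
  unfolding has_weak_curl_def weak_op_def cross3_nabla ..

lemma weak_op_partial: "has_weak_partial j F D \<longleftrightarrow> weak_op (partial_symbol j) F D"
  unfolding has_weak_partial_def weak_op_def
  by (simp add: if_distrib[where f = "scaleR _"] cong: if_cong)

lemma bounded_linear_symbols:
  "bounded_linear (grad_symbol i)" "bounded_linear (div_symbol i)" "bounded_linear (curl_symbol i)"
  "bounded_linear (partial_symbol j i :: 'b \<Rightarrow> 'b::euclidean_space)"
proof -
  show "bounded_linear (curl_symbol i)"
    by (intro linear_conv_bounded_linear[THEN iffD1] linearI) (simp_all add: cross3_simps)
  show "bounded_linear (partial_symbol j i :: 'b \<Rightarrow> 'b::euclidean_space)"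
    by (cases "i = j") (simp_all add: bounded_linear_ident bounded_linear_zero)
qed (auto intro: bounded_linear_scaleR_left bounded_linear_vec_nth)

lemma bounded_linear_borel:
  "bounded_linear (T :: 'b::euclidean_space \<Rightarrow> 'c::euclidean_space) \<Longrightarrow> T \<in> borel_measurable borel"
  by (intro borel_measurable_continuous_onI linear_continuous_on)

text \<open>The bump \<open>exp (1 - 1 / (1 - |x|^2))\<close> on the unit ball. The square of the
  norm is spelt out as a sum of products of coordinates, so that the closure rules for
  \<open>smooth\<close> apply.\<close>

lemma cutoff_function: "\<exists>\<eta>. test_function \<eta> \<and> \<eta> 0 = 1"
proof -
  define \<eta> where "\<eta> x = exp 1 * flat 0 (1 + (\<Sum>i\<in>UNIV. -1 * (x $ i * x $ i)))" for x :: "real^3"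
  have n: "(\<Sum>i\<in>UNIV. -1 * (x $ i * x $ i)) = - (norm x)\<^sup>2" for x :: "real^3"
    by (simp add: power2_norm_eq_inner inner_vec_def sum_negf)
  have "smooth \<eta>"
    unfolding \<eta>_def[abs_def]
    by (intro smooth_cmult smooth_flat smooth_add smooth_const smooth_sum smooth_mult smooth_coordinate)
  moreover have "norm x \<le> 1" if "\<eta> x \<noteq> 0" for x
  proof -
    have "1 - (norm x)\<^sup>2 > 0" using that unfolding \<eta>_def n by (auto simp: flat_0 split: if_splits)
    then have "(norm x)\<^sup>2 \<le> 1\<^sup>2" by simp
    then show ?thesis by (rule power2_le_imp_le) simp
  qed
  moreover have "\<eta> 0 = 1" by (simp add: \<eta>_def flat_0 flip: exp_add)
  ultimately show ?thesis unfolding test_function_def bounded_iff by blast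
qed

text \<open>The test function is multiplied by \<open>\<eta> (x / n)\<close>; the gradient of this factor is at most \<open>C / (1 + norm x)\<close>,
  uniformly in \<open>n\<close>, and tends to \<open>0\<close>.\<close>

lemma weak_op_decaying:
  fixes F :: "real^3 \<Rightarrow> 'b::euclidean_space" and D :: "real^3 \<Rightarrow> 'c::euclidean_space"
  assumes W: "weak_op L F D" and L: "\<And>i. bounded_linear (L i)" and \<psi>: "smooth \<psi>"
    and I1: "integrable lebesgue (\<lambda>x. \<psi> x *\<^sub>R D x)"
    and I2: "\<And>i. integrable lebesgue (\<lambda>x. partial_derivative i \<psi> x *\<^sub>R F x)"
    and I3: "integrable lebesgue (\<lambda>x. ((1 + norm x) powr - 1 * \<psi> x) *\<^sub>R F x)"
  shows "(LINT x|lebesgue. \<psi> x *\<^sub>R D x) = - (\<Sum>i\<in>UNIV. LINT x|lebesgue. partial_derivative i \<psi> x *\<^sub>R L i (F x))"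
proof -
  obtain \<eta> where \<eta>: "test_function \<eta>" "\<eta> 0 = 1" using cutoff_function by blast
  obtain C M where C: "C > 0" "\<And>x. \<bar>\<eta> x\<bar> \<le> C * indicator (cball 0 M) x" using test_function_bound[OF \<eta>(1)] by metis
  have C': "\<bar>\<eta> x\<bar> \<le> C" for x using C(2)[of x] C(1) by (cases "norm x \<le> M") auto
  have "\<exists>C M. C > 0 \<and> M > 0 \<and> (\<forall>x. \<bar>partial_derivative i \<eta> x\<bar> \<le> C * indicator (cball 0 M) x)" for i
    using test_function_bound[OF test_function_partial[OF \<eta>(1)]] by metis
  then obtain C1 M1 where C1: "\<And>i. C1 i > 0" "\<And>i. M1 i > 0"
    "\<And>i x. \<bar>partial_derivative i \<eta> x\<bar> \<le> C1 i * indicator (cball 0 (M1 i)) x" by metis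
  define t where "t n = 1 / real (Suc n)" for n
  have t: "0 < t n" "t n \<le> 1" for n by (auto simp: t_def)
  have t_lim: "t \<longlonglongrightarrow> 0" unfolding t_def[abs_def] using LIMSEQ_inverse_real_of_nat by (simp add: inverse_eq_divide)
  define \<eta>n where "\<eta>n n x = \<eta> (t n *\<^sub>R x)" for n x
  have \<eta>n: "test_function (\<eta>n n)" for n
    using test_function_affine[OF \<eta>(1), of "t n" 0] t[of n] by (simp add: \<eta>n_def[abs_def])
  have p\<eta>n: "partial_derivative i (\<eta>n n) x = t n * partial_derivative i \<eta> (t n *\<^sub>R x)" for i n x
    using partial_derivative_affine(1)[OF smooth_differentiable[OF test_function_smooth[OF \<eta>(1)]], of i "t n" 0]
    by (simp add: \<eta>n_def[abs_def] fun_eq_iff)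
  \<comment> \<open>Where the derivative of the rescaled cut-off is nonzero,
    \<open>t n * norm x \<le> M1 i\<close> and \<open>t n \<le> 1\<close>, hence
    \<open>t n * (1 + norm x) \<le> 1 + M1 i\<close>.\<close>
  define K where "K i = C1 i * (1 + M1 i)" for i
  have K: "\<bar>partial_derivative i (\<eta>n n) x\<bar> \<le> K i * (1 + norm x) powr - 1"
    "\<bar>partial_derivative i (\<eta>n n) x\<bar> \<le> t n * C1 i" for i n x
  proof -
    have b: "\<bar>partial_derivative i (\<eta>n n) x\<bar> \<le> t n * (C1 i * indicator (cball 0 (M1 i)) (t n *\<^sub>R x))"
      unfolding p\<eta>n abs_mult using t[of n] C1(3)[of i "t n *\<^sub>R x"] by simp
    have "t n * (C1 i * indicator (cball 0 (M1 i)) (t n *\<^sub>R x)) \<le> t n * (C1 i * 1)"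
      using t[of n] C1(1)[of i] by (intro mult_left_mono) (auto simp: indicator_def less_imp_le)
    with b show "\<bar>partial_derivative i (\<eta>n n) x\<bar> \<le> t n * C1 i" by simp
    show "\<bar>partial_derivative i (\<eta>n n) x\<bar> \<le> K i * (1 + norm x) powr - 1"
    proof (cases "norm (t n *\<^sub>R x) \<le> M1 i")
      case True
      have "t n * (1 + norm x) \<le> 1 + M1 i" using True t[of n] by (simp add: distrib_left)
      then have "t n \<le> (1 + M1 i) * (1 + norm x) powr - 1"
        by (simp add: powr_minus_divide pos_le_divide_eq add_pos_nonneg)
      then have "t n * C1 i \<le> K i * (1 + norm x) powr - 1"
        using C1(1)[of i] mult_right_mono[of "t n" "(1 + M1 i) * (1 + norm x) powr - 1" "C1 i"]
        unfolding K_def by (simp only: mult_ac less_imp_le)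
      with b True show ?thesis by simp
    next
      case False
      with b have "\<bar>partial_derivative i (\<eta>n n) x\<bar> \<le> 0" by simp
      also have "0 \<le> K i * (1 + norm x) powr - 1" using C1[of i] by (simp add: K_def)
      finally show ?thesis .
    qed
  qed
  have \<eta>n_lim: "(\<lambda>n. \<eta>n n x) \<longlonglongrightarrow> 1" for x
  proof -
    have "(\<lambda>n. t n *\<^sub>R x) \<longlonglongrightarrow> 0" using tendsto_scaleR[OF t_lim tendsto_const[of x]] by simp
    moreover have "isCont \<eta> 0"
      using smooth_differentiable[OF test_function_smooth[OF \<eta>(1)]] by (rule differentiable_imp_continuous_within)
    ultimately show ?thesis unfolding \<eta>n_def \<eta>(2)[symmetric] by (rule isCont_tendsto_compose[rotated])
  qed
  have p\<eta>n_lim: "(\<lambda>n. partial_derivative i (\<eta>n n) x) \<longlonglongrightarrow> 0" for i x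
  proof (rule tendsto_rabs_zero_cancel, rule tendsto_sandwich[where f = "\<lambda>_. 0" and h = "\<lambda>n. t n * C1 i"])
    show "(\<lambda>n. t n * C1 i) \<longlonglongrightarrow> 0" using tendsto_mult_left_zero[OF t_lim] .
  qed (auto simp: K(2))
  have mF: "F \<in> borel_measurable lebesgue" "D \<in> borel_measurable lebesgue"
    using W locally_integrable_measurable unfolding weak_op_def by auto
  have mLF: "(\<lambda>x. L i (F x)) \<in> borel_measurable lebesgue" for i
    by (rule measurable_compose[OF mF(1) bounded_linear_borel[OF L]])
  have m\<eta>n: "\<eta>n n \<in> borel_measurable lebesgue" "partial_derivative i (\<eta>n n) \<in> borel_measurable lebesgue"
    "\<psi> \<in> borel_measurable lebesgue" "partial_derivative i \<psi> \<in> borel_measurable lebesgue" for i n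
    by (intro lebesgue_measurable_borel smooth_borel test_function_smooth smooth_partial \<eta>n \<psi>)+
  let ?h = "\<lambda>i n x. partial_derivative i (\<lambda>x. \<eta>n n x * \<psi> x) x *\<^sub>R L i (F x)"
  have h: "?h i n x = L i ((\<eta>n n x * partial_derivative i \<psi> x) *\<^sub>R F x) + L i ((partial_derivative i (\<eta>n n) x * \<psi> x) *\<^sub>R F x)"
    for i n x
  proof -
    have "partial_derivative i (\<lambda>x. \<eta>n n x * \<psi> x) x = \<eta>n n x * partial_derivative i \<psi> x + partial_derivative i (\<eta>n n) x * \<psi> x"
      by (intro partial_derivative_mult smooth_differentiable \<psi> test_function_smooth \<eta>n)
    then show ?thesis
      by (simp add: scaleR_add_left linear_scale[OF bounded_linear.linear[OF L]])
  qed
  have hI: "integrable lebesgue (?h i n)"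
    and h_lim: "(\<lambda>n. LINT x|lebesgue. ?h i n x) \<longlonglongrightarrow> (LINT x|lebesgue. partial_derivative i \<psi> x *\<^sub>R L i (F x))" for i n
  proof -
    obtain B where B: "B > 0" "\<And>v. norm (L i v) \<le> norm v * B" using bounded_linear.pos_bounded[OF L] by blast
    let ?w = "\<lambda>x. (C * norm (partial_derivative i \<psi> x *\<^sub>R F x) + K i * norm (((1 + norm x) powr - 1 * \<psi> x) *\<^sub>R F x)) * B"
    have w: "integrable lebesgue ?w"
      by (intro integrable_mult_left Bochner_Integration.integrable_add integrable_mult_right integrable_norm I2 I3)
    have bd: "norm (?h i n x) \<le> ?w x" for n x
    proof -
      have "norm (L i ((\<eta>n n x * partial_derivative i \<psi> x) *\<^sub>R F x)) \<le> (C * norm (partial_derivative i \<psi> x *\<^sub>R F x)) * B"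
      proof (rule order_trans[OF B(2)], rule mult_right_mono)
        show "norm ((\<eta>n n x * partial_derivative i \<psi> x) *\<^sub>R F x) \<le> C * norm (partial_derivative i \<psi> x *\<^sub>R F x)"
          using mult_right_mono[OF C'[of "t n *\<^sub>R x"], of "norm (partial_derivative i \<psi> x *\<^sub>R F x)"]
          by (simp add: abs_mult \<eta>n_def mult.assoc)
      qed (use B in simp)
      moreover have "norm (L i ((partial_derivative i (\<eta>n n) x * \<psi> x) *\<^sub>R F x)) \<le>
          (K i * norm (((1 + norm x) powr - 1 * \<psi> x) *\<^sub>R F x)) * B"
      proof (rule order_trans[OF B(2)], rule mult_right_mono)
        show "norm ((partial_derivative i (\<eta>n n) x * \<psi> x) *\<^sub>R F x) \<le> K i * norm (((1 + norm x) powr - 1 * \<psi> x) *\<^sub>R F x)"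
          using mult_right_mono[OF K(1)[of i n x], of "\<bar>\<psi> x\<bar> * norm (F x)"]
          by (simp add: abs_mult mult.assoc)
      qed (use B in simp)
      ultimately show ?thesis unfolding h distrib_right by (rule norm_triangle_mono)
    qed
    have hm: "?h i n \<in> borel_measurable lebesgue" for n
    proof -
      have "smooth (\<lambda>x. \<eta>n n x * \<psi> x)" by (intro smooth_mult \<psi> test_function_smooth \<eta>n)
      then show ?thesis by (intro borel_measurable_scaleR lebesgue_measurable_borel smooth_borel smooth_partial mLF)
    qed
    have lim: "(\<lambda>n. ?h i n x) \<longlonglongrightarrow> partial_derivative i \<psi> x *\<^sub>R L i (F x)" for x
    proof -
      have "(\<lambda>n. L i ((\<eta>n n x * partial_derivative i \<psi> x) *\<^sub>R F x) + L i ((partial_derivative i (\<eta>n n) x * \<psi> x) *\<^sub>R F x))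
         \<longlonglongrightarrow> L i ((1 * partial_derivative i \<psi> x) *\<^sub>R F x) + L i ((0 * \<psi> x) *\<^sub>R F x)"
        by (intro tendsto_add bounded_linear.tendsto[OF L] tendsto_scaleR tendsto_mult tendsto_const \<eta>n_lim p\<eta>n_lim)
      then show ?thesis unfolding h
        by (simp add: linear_scale[OF bounded_linear.linear[OF L]] linear_0[OF bounded_linear.linear[OF L]])
    qed
    have m0: "(\<lambda>x. partial_derivative i \<psi> x *\<^sub>R L i (F x)) \<in> borel_measurable lebesgue"
      by (intro borel_measurable_scaleR m\<eta>n mLF)
    show "integrable lebesgue (?h i n)"
      by (rule Bochner_Integration.integrable_bound[OF w hm])
        (use bd in \<open>auto intro!: always_eventually intro: order_trans[OF _ abs_ge_self]\<close>)
    show "(\<lambda>n. LINT x|lebesgue. ?h i n x) \<longlonglongrightarrow> (LINT x|lebesgue. partial_derivative i \<psi> x *\<^sub>R L i (F x))"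
      by (rule integral_dominated_convergence[OF m0 hm w always_eventually always_eventually]) (use lim bd in auto)
  qed
  have lhs: "(\<lambda>n. LINT x|lebesgue. (\<eta>n n x * \<psi> x) *\<^sub>R D x) \<longlonglongrightarrow> (LINT x|lebesgue. \<psi> x *\<^sub>R D x)"
  proof (rule integral_dominated_convergence[where w = "\<lambda>x. C * norm (\<psi> x *\<^sub>R D x)"])
    show "AE x in lebesgue. (\<lambda>n. (\<eta>n n x * \<psi> x) *\<^sub>R D x) \<longlonglongrightarrow> \<psi> x *\<^sub>R D x"
    proof (intro always_eventually allI)
      fix x
      have "(\<lambda>n. (\<eta>n n x * \<psi> x) *\<^sub>R D x) \<longlonglongrightarrow> (1 * \<psi> x) *\<^sub>R D x"
        by (intro tendsto_scaleR tendsto_mult tendsto_const \<eta>n_lim)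
      then show "(\<lambda>n. (\<eta>n n x * \<psi> x) *\<^sub>R D x) \<longlonglongrightarrow> \<psi> x *\<^sub>R D x" by simp
    qed
    show "AE x in lebesgue. norm ((\<eta>n n x * \<psi> x) *\<^sub>R D x) \<le> C * norm (\<psi> x *\<^sub>R D x)" for n
    proof (intro always_eventually allI)
      fix x
      show "norm ((\<eta>n n x * \<psi> x) *\<^sub>R D x) \<le> C * norm (\<psi> x *\<^sub>R D x)"
        using mult_right_mono[OF C'[of "t n *\<^sub>R x"], of "norm (\<psi> x *\<^sub>R D x)"]
        by (simp add: abs_mult \<eta>n_def mult.assoc)
    qed
    show "integrable lebesgue (\<lambda>x. C * norm (\<psi> x *\<^sub>R D x))" by (intro integrable_mult_right integrable_norm I1)
    show "(\<lambda>x. \<psi> x *\<^sub>R D x) \<in> borel_measurable lebesgue" by (intro borel_measurable_scaleR m\<eta>n mF)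
    show "(\<lambda>x. (\<eta>n n x * \<psi> x) *\<^sub>R D x) \<in> borel_measurable lebesgue" for n
      by (intro borel_measurable_scaleR borel_measurable_times m\<eta>n mF)
  qed
  have eq: "(LINT x|lebesgue. (\<eta>n n x * \<psi> x) *\<^sub>R D x) = - (\<Sum>i\<in>UNIV. LINT x|lebesgue. ?h i n x)" for n
  proof -
    have "(LINT x|lebesgue. (\<eta>n n x * \<psi> x) *\<^sub>R D x) = - (LINT x|lebesgue. (\<Sum>i\<in>UNIV. ?h i n x))"
      using W test_function_mult[OF \<eta>n \<psi>] unfolding weak_op_def by blast
    then show ?thesis using hI by (simp add: Bochner_Integration.integral_sum)
  qed
  have "(\<lambda>n. LINT x|lebesgue. (\<eta>n n x * \<psi> x) *\<^sub>R D x) \<longlonglongrightarrow>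
      - (\<Sum>i\<in>UNIV. LINT x|lebesgue. partial_derivative i \<psi> x *\<^sub>R L i (F x))"
    unfolding eq by (intro tendsto_minus tendsto_sum h_lim)
  with lhs show ?thesis by (rule LIMSEQ_unique)
qed

section \<open>Stability of the weighted space\<close>

lemma L2w_bounded_linear:
  fixes F :: "real^3 \<Rightarrow> 'b::euclidean_space" and T :: "'b \<Rightarrow> 'c::euclidean_space"
  assumes F: "F \<in> L2w \<gamma>" and T: "bounded_linear T"
  shows "(\<lambda>x. T (F x)) \<in> L2w \<gamma>"
proof -
  obtain B where B: "B > 0" "\<And>v. norm (T v) \<le> norm v * B" using bounded_linear.pos_bounded[OF T] by blast
  have m: "(\<lambda>x. T (F x)) \<in> borel_measurable lebesgue"
    by (rule measurable_compose[OF L2w_D(1)[OF F] bounded_linear_borel[OF T]])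
  have "integrable lebesgue (\<lambda>x. weight \<gamma> x * (norm (T (F x)))\<^sup>2)"
  proof (rule Bochner_Integration.integrable_bound)
    show "integrable lebesgue (\<lambda>x. B\<^sup>2 * (weight \<gamma> x * (norm (F x))\<^sup>2))"
      by (intro integrable_mult_right L2w_D F)
    show "(\<lambda>x. weight \<gamma> x * (norm (T (F x)))\<^sup>2) \<in> borel_measurable lebesgue"
      by (intro borel_measurable_times lebesgue_measurable_borel weight_borel norm_square_measurable m)
    have "weight \<gamma> x * (norm (T (F x)))\<^sup>2 \<le> B\<^sup>2 * (weight \<gamma> x * (norm (F x))\<^sup>2)" for x
    proof -
      have "(norm (T (F x)))\<^sup>2 \<le> (norm (F x) * B)\<^sup>2" by (intro power_mono B) auto
      then have "weight \<gamma> x * (norm (T (F x)))\<^sup>2 \<le> weight \<gamma> x * (norm (F x) * B)\<^sup>2"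
        using weight_pos[of x \<gamma>] by (intro mult_left_mono) auto
      then show ?thesis by (simp only: power_mult_distrib mult_ac)
    qed
    then show "AE x in lebesgue. norm (weight \<gamma> x * (norm (T (F x)))\<^sup>2) \<le> norm (B\<^sup>2 * (weight \<gamma> x * (norm (F x))\<^sup>2))"
      using weight_pos[where \<gamma> = \<gamma>] by (simp add: abs_mult less_imp_le)
  qed
  then show ?thesis using m by (simp add: L2_weighted_def)
qed

lemma weighted_L2_add:
  fixes F G :: "real^3 \<Rightarrow> 'b::euclidean_space"
  assumes F: "F \<in> borel_measurable lebesgue" "integrable lebesgue (\<lambda>x. w x * (norm (F x))\<^sup>2)"
    and G: "G \<in> borel_measurable lebesgue" "integrable lebesgue (\<lambda>x. w x * (norm (G x))\<^sup>2)"
    and w: "w \<in> borel_measurable borel" "\<And>x. w x > 0"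
  shows "integrable lebesgue (\<lambda>x. w x * (norm (F x + G x))\<^sup>2)"
proof (rule Bochner_Integration.integrable_bound)
  show "integrable lebesgue (\<lambda>x. 2 * (w x * (norm (F x))\<^sup>2) + 2 * (w x * (norm (G x))\<^sup>2))"
    by (intro integrable_mult_right Bochner_Integration.integrable_add F G)
  show "(\<lambda>x. w x * (norm (F x + G x))\<^sup>2) \<in> borel_measurable lebesgue"
    by (intro borel_measurable_times lebesgue_measurable_borel w norm_square_measurable borel_measurable_add F G)
  have "w x * (norm (F x + G x))\<^sup>2 \<le> 2 * (w x * (norm (F x))\<^sup>2) + 2 * (w x * (norm (G x))\<^sup>2)" for x
  proof -
    have "(norm (F x + G x))\<^sup>2 \<le> (norm (F x) + norm (G x))\<^sup>2" by (intro power_mono norm_triangle_ineq) auto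
    also have "\<dots> \<le> 2 * (norm (F x))\<^sup>2 + 2 * (norm (G x))\<^sup>2"
      using sum_squares_bound[of "norm (F x)" "norm (G x)"] by (simp add: power2_sum)
    finally have "w x * (norm (F x + G x))\<^sup>2 \<le> w x * (2 * (norm (F x))\<^sup>2 + 2 * (norm (G x))\<^sup>2)"
      using w(2)[of x] by (intro mult_left_mono) auto
    then show ?thesis by (simp only: distrib_left mult_ac)
  qed
  then show "AE x in lebesgue. norm (w x * (norm (F x + G x))\<^sup>2) \<le>
      norm (2 * (w x * (norm (F x))\<^sup>2) + 2 * (w x * (norm (G x))\<^sup>2))"
    using w(2) by (auto simp: abs_mult less_imp_le intro!: always_eventually intro: order_trans[OF _ abs_ge_self])
qed

lemma L2w_add:
  fixes F G :: "real^3 \<Rightarrow> 'b::euclidean_space"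
  assumes "F \<in> L2w \<gamma>" "G \<in> L2w \<gamma>"
  shows "(\<lambda>x. F x + G x) \<in> L2w \<gamma>"
  using weighted_L2_add[OF L2w_D[OF assms(1)] L2w_D[OF assms(2)] weight_borel weight_pos]
    borel_measurable_add[OF L2w_D(1)[OF assms(1)] L2w_D(1)[OF assms(2)]]
  by (simp add: L2_weighted_def)

lemma L2w_sum:
  fixes F :: "'i \<Rightarrow> real^3 \<Rightarrow> 'b::euclidean_space"
  shows "(\<And>i. i \<in> I \<Longrightarrow> F i \<in> L2w \<gamma>) \<Longrightarrow> (\<lambda>x. \<Sum>i\<in>I. F i x) \<in> L2w \<gamma>"
proof (induction I rule: infinite_finite_induct)
  case (insert j I)
  then show ?case using L2w_add[of "F j" \<gamma> "\<lambda>x. \<Sum>i\<in>I. F i x"] by simp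
qed (simp_all add: L2_weighted_def)

lemma L2w_cong_AE:
  fixes F G :: "real^3 \<Rightarrow> 'b::euclidean_space"
  assumes F: "F \<in> L2w \<gamma>" and eq: "AE x in lebesgue. G x = F x" and G: "G \<in> borel_measurable lebesgue"
  shows "G \<in> L2w \<gamma>"
proof -
  have "AE x in lebesgue. weight \<gamma> x * (norm (F x))\<^sup>2 = weight \<gamma> x * (norm (G x))\<^sup>2"
    using eq by eventually_elim simp
  moreover have "(\<lambda>x. weight \<gamma> x * (norm (F x))\<^sup>2) \<in> borel_measurable lebesgue"
    "(\<lambda>x. weight \<gamma> x * (norm (G x))\<^sup>2) \<in> borel_measurable lebesgue"
    by (intro borel_measurable_times[OF lebesgue_measurable_borel[OF weight_borel] norm_square_measurable]
        L2w_D(1)[OF F] G)+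
  ultimately have "integrable lebesgue (\<lambda>x. weight \<gamma> x * (norm (G x))\<^sup>2)"
    using L2w_D(2)[OF F] integrable_cong_AE by blast
  then show ?thesis using G by (simp add: L2_weighted_def)
qed

lemma weak_op_unique:
  assumes "weak_op L F D" "weak_op L F D'"
  shows "AE x in lebesgue. D x = D' x"
  using assms unfolding weak_op_def by (intro fundamental_lemma_eq) auto

section \<open>Recovering a field from its curl and divergence\<close>

lemma locally_integrable_bounded_linear:
  fixes F :: "real^3 \<Rightarrow> 'b::euclidean_space" and T :: "'b \<Rightarrow> 'c::euclidean_space"
  assumes "locally_integrable F" "bounded_linear T"
  shows "locally_integrable (\<lambda>x. T (F x))"
  unfolding locally_integrable_iff
proof (intro allI impI)
  fix K :: "(real^3) set" assume "compact K"
  then have "integrable lebesgue (\<lambda>x. T (indicator K x *\<^sub>R F x))"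
    using assms by (intro integrable_bounded_linear[OF assms(2)]) (simp add: locally_integrable_iff)
  then show "integrable lebesgue (\<lambda>x. indicator K x *\<^sub>R T (F x))"
    by (simp add: linear_scale[OF bounded_linear.linear[OF assms(2)]])
qed

lemma locally_integrable_sum:
  fixes F :: "'i \<Rightarrow> real^3 \<Rightarrow> 'b::euclidean_space"
  assumes "\<And>i. i \<in> I \<Longrightarrow> locally_integrable (F i)"
  shows "locally_integrable (\<lambda>x. \<Sum>i\<in>I. F i x)"
  using assms unfolding locally_integrable_iff
  by (auto simp: scaleR_sum_right intro!: Bochner_Integration.integrable_sum)

lemma locally_integrable_zero: "locally_integrable (\<lambda>x. 0)"
  by (simp add: locally_integrable_iff)

lemma L2_locally_integrable:
  fixes F :: "real^3 \<Rightarrow> 'b::euclidean_space"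
  assumes "F \<in> borel_measurable lebesgue" "integrable lebesgue (\<lambda>y. (norm (F y))\<^sup>2)"
  shows "locally_integrable F"
  unfolding locally_integrable_iff
proof (intro allI impI)
  fix K :: "(real^3) set" assume K: "compact K"
  have "integrable lborel (indicator K :: _ \<Rightarrow> real)"
    using emeasure_compact_finite[OF K] borel_compact[OF K] by (intro integrable_real_indicator) auto
  moreover have "norm (indicator K y :: real) = (indicator K y)\<^sup>2 / 1" for y by (simp add: indicator_def)
  ultimately have "(\<integral>\<^sup>+y. ennreal ((indicator K y)\<^sup>2 / 1) \<partial>lborel) < \<infinity>"
    unfolding integrable_iff_bounded by simp
  then show "integrable lebesgue (\<lambda>x. indicator K x *\<^sub>R F x)"
    using assms by (intro weighted_Cauchy_Schwarz(1)[where w = "\<lambda>_. 1"])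
      (auto intro: borel_measurable_indicator borel_compact K)
qed

lemma L2_add:
  fixes F G :: "real^3 \<Rightarrow> 'b::euclidean_space"
  assumes "F \<in> borel_measurable lebesgue" "integrable lebesgue (\<lambda>y. (norm (F y))\<^sup>2)"
    and "G \<in> borel_measurable lebesgue" "integrable lebesgue (\<lambda>y. (norm (G y))\<^sup>2)"
  shows "integrable lebesgue (\<lambda>y. (norm (F y + G y))\<^sup>2)"
  using weighted_L2_add[of F "\<lambda>_. 1" G] assms by simp

lemma L2_sum:
  fixes F :: "'i \<Rightarrow> real^3 \<Rightarrow> 'b::euclidean_space"
  assumes "\<And>i. i \<in> I \<Longrightarrow> F i \<in> borel_measurable lebesgue" "\<And>i. i \<in> I \<Longrightarrow> integrable lebesgue (\<lambda>y. (norm (F i y))\<^sup>2)"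
  shows "integrable lebesgue (\<lambda>y. (norm (\<Sum>i\<in>I. F i y))\<^sup>2)"
  using assms
proof (induction I rule: infinite_finite_induct)
  case (insert j I)
  have "integrable lebesgue (\<lambda>y. (norm (F j y + (\<Sum>i\<in>I. F i y)))\<^sup>2)"
    by (intro L2_add borel_measurable_sum insert) (use insert in auto)
  then show ?case using insert by simp
qed simp_all

lemma L2_component:
  fixes F :: "real^3 \<Rightarrow> real^3"
  assumes F: "F \<in> borel_measurable lebesgue" "integrable lebesgue (\<lambda>y. (norm (F y))\<^sup>2)"
  shows "(\<lambda>y. F y $ i) \<in> borel_measurable lebesgue" "integrable lebesgue (\<lambda>y. (norm (F y $ i))\<^sup>2)"
proof -
  show m: "(\<lambda>y. F y $ i) \<in> borel_measurable lebesgue"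
    by (rule measurable_compose[OF F(1) borel_measurable_vec_nth])
  show "integrable lebesgue (\<lambda>y. (norm (F y $ i))\<^sup>2)"
  proof (rule Bochner_Integration.integrable_bound[OF F(2) norm_square_measurable[OF m]])
    have "(norm (F y $ i))\<^sup>2 \<le> (norm (F y))\<^sup>2" for y
      using component_le_norm_cart[of "F y" i] by (intro power_mono) auto
    then show "AE y in lebesgue. norm ((norm (F y $ i))\<^sup>2) \<le> norm ((norm (F y))\<^sup>2)" by simp
  qed
qed

lemma weak_op_minus:
  assumes "weak_op L F D" and L: "\<And>i. bounded_linear (L i)"
  shows "weak_op L (\<lambda>x. - F x) (\<lambda>x. - D x)"
proof -
  have "locally_integrable (\<lambda>x. - F x)" "locally_integrable (\<lambda>x. - D x)"
    using assms(1) locally_integrable_bounded_linear[OF _ bounded_linear_minus[OF bounded_linear_ident]]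
    unfolding weak_op_def by blast+
  then show ?thesis
    using assms(1) unfolding weak_op_def
    by (simp add: linear_neg[OF bounded_linear.linear[OF L]] sum_negf)
qed

lemma test_op_integrable:
  fixes F :: "real^3 \<Rightarrow> 'b::euclidean_space" and T :: "'b \<Rightarrow> 'c::euclidean_space"
  assumes "locally_integrable F" "bounded_linear T" "test_function \<phi>"
  shows "integrable lebesgue (\<lambda>x. partial_derivative i \<phi> x *\<^sub>R T (F x))"
  by (rule test_function_mult_integrable[OF locally_integrable_bounded_linear[OF assms(1,2)]
        test_function_partial[OF assms(3)]])

lemma weak_op_diff:
  assumes W: "weak_op L F D" "weak_op L F' D'" and L: "\<And>i. bounded_linear (L i)"
  shows "weak_op L (\<lambda>x. F x - F' x) (\<lambda>x. D x - D' x)"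
  unfolding weak_op_def
proof (intro conjI allI impI)
  have loc: "locally_integrable F" "locally_integrable D" "locally_integrable F'" "locally_integrable D'"
    using W unfolding weak_op_def by auto
  then show "locally_integrable (\<lambda>x. F x - F' x)" "locally_integrable (\<lambda>x. D x - D' x)"
    by (auto intro: locally_integrable_diff)
  fix \<phi> :: "real^3 \<Rightarrow> real" assume \<phi>: "test_function \<phi>"
  have "(LINT x|lebesgue. \<phi> x *\<^sub>R (D x - D' x)) = (LINT x|lebesgue. \<phi> x *\<^sub>R D x) - (LINT x|lebesgue. \<phi> x *\<^sub>R D' x)"
    using test_function_mult_integrable[OF loc(2) \<phi>] test_function_mult_integrable[OF loc(4) \<phi>]
    by (simp add: scaleR_diff_right)
  also have "\<dots> = - ((LINT x|lebesgue. (\<Sum>i\<in>UNIV. partial_derivative i \<phi> x *\<^sub>R L i (F x)))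
      - (LINT x|lebesgue. (\<Sum>i\<in>UNIV. partial_derivative i \<phi> x *\<^sub>R L i (F' x))))"
    using W \<phi> unfolding weak_op_def by simp
  also have "\<dots> = - (LINT x|lebesgue. (\<Sum>i\<in>UNIV. partial_derivative i \<phi> x *\<^sub>R L i (F x - F' x)))"
  proof -
    have "integrable lebesgue (\<lambda>x. \<Sum>i\<in>UNIV. partial_derivative i \<phi> x *\<^sub>R L i (F x))"
      "integrable lebesgue (\<lambda>x. \<Sum>i\<in>UNIV. partial_derivative i \<phi> x *\<^sub>R L i (F' x))"
      by (rule Bochner_Integration.integrable_sum, rule test_op_integrable[OF _ L \<phi>], rule loc)+
    from Bochner_Integration.integral_diff[OF this] show ?thesis
      by (simp add: linear_diff[OF bounded_linear.linear[OF L]] scaleR_diff_right sum_subtractf)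
  qed
  finally show "(LINT x|lebesgue. \<phi> x *\<^sub>R (D x - D' x)) =
    - (LINT x|lebesgue. (\<Sum>i\<in>UNIV. partial_derivative i \<phi> x *\<^sub>R L i (F x - F' x)))" .
qed

lemma weak_op_cong_AE:
  fixes F F' :: "real^3 \<Rightarrow> 'b::euclidean_space" and D :: "real^3 \<Rightarrow> 'c::euclidean_space"
  assumes W: "weak_op L F D" and L: "\<And>i. bounded_linear (L i)"
    and eq: "AE x in lebesgue. F' x = F x" and F': "locally_integrable F'"
  shows "weak_op L F' D"
proof -
  have loc: "locally_integrable F" "locally_integrable D" using W unfolding weak_op_def by auto
  have "(LINT x|lebesgue. (\<Sum>i\<in>UNIV. partial_derivative i \<phi> x *\<^sub>R L i (F x))) =
      (LINT x|lebesgue. (\<Sum>i\<in>UNIV. partial_derivative i \<phi> x *\<^sub>R L i (F' x)))" if \<phi>: "test_function \<phi>" for \<phi>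
  proof (rule integral_cong_AE)
    show "AE x in lebesgue. (\<Sum>i\<in>UNIV. partial_derivative i \<phi> x *\<^sub>R L i (F x)) =
        (\<Sum>i\<in>UNIV. partial_derivative i \<phi> x *\<^sub>R L i (F' x))"
      using eq by eventually_elim simp
    show "(\<lambda>x. \<Sum>i\<in>UNIV. partial_derivative i \<phi> x *\<^sub>R L i (F x)) \<in> borel_measurable lebesgue"
      by (intro borel_measurable_sum borel_measurable_integrable test_op_integrable loc L \<phi>)
    show "(\<lambda>x. \<Sum>i\<in>UNIV. partial_derivative i \<phi> x *\<^sub>R L i (F' x)) \<in> borel_measurable lebesgue"
      by (intro borel_measurable_sum borel_measurable_integrable test_op_integrable F' L \<phi>)
  qed
  then show ?thesis using W F' unfolding weak_op_def by simp
qed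

text \<open>Tested with \<phi>, the composition pairs the symmetric second derivatives of \<phi>
  with the coefficients \<open>L' i (L j v)\<close>, which are antisymmetric in \<open>i\<close> and
  \<open>j\<close>. Exchanging the indices shows that the sum equals its own negative. This contains
  both \<open>curl grad = 0\<close> and \<open>div curl = 0\<close>.\<close>

lemma weak_op_compose_0:
  fixes L :: "3 \<Rightarrow> 'b::euclidean_space \<Rightarrow> 'c::euclidean_space" and L' :: "3 \<Rightarrow> 'c \<Rightarrow> 'd::euclidean_space"
  assumes W: "weak_op L F D" and L: "\<And>i. bounded_linear (L i)" "\<And>i. bounded_linear (L' i)"
    and anti: "\<And>i j v. L' i (L j v) = - L' j (L i v)"
  shows "weak_op L' D (\<lambda>x. 0)"
  unfolding weak_op_def
proof (intro conjI allI impI locally_integrable_zero)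
  have loc: "locally_integrable F" "locally_integrable D" using W unfolding weak_op_def by auto
  then show "locally_integrable D" by simp
  fix \<phi> :: "real^3 \<Rightarrow> real" assume \<phi>: "test_function \<phi>"
  have p: "test_function (partial_derivative i \<phi>)" for i by (rule test_function_partial[OF \<phi>])
  define h where "h i j x = partial_derivative j (partial_derivative i \<phi>) x *\<^sub>R L j (F x)" for i j x
  have hI: "integrable lebesgue (h i j)" for i j
    unfolding h_def[abs_def] by (rule test_op_integrable[OF loc(1) L(1) p])
  have hs: "h i j = (\<lambda>x. partial_derivative i (partial_derivative j \<phi>) x *\<^sub>R L j (F x))" for i j
    unfolding h_def[abs_def] using partial_derivative_commute[OF test_function_smooth[OF \<phi>]] by metis
  have "(LINT x|lebesgue. (\<Sum>i\<in>UNIV. partial_derivative i \<phi> x *\<^sub>R L' i (D x))) =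
      (\<Sum>i\<in>UNIV. LINT x|lebesgue. L' i (partial_derivative i \<phi> x *\<^sub>R D x))"
    unfolding linear_scale[OF bounded_linear.linear[OF L(2)]]
    by (rule Bochner_Integration.integral_sum) (rule test_op_integrable[OF loc(2) L(2) \<phi>])
  also have "\<dots> = (\<Sum>i\<in>UNIV. L' i (LINT x|lebesgue. partial_derivative i \<phi> x *\<^sub>R D x))"
    by (intro sum.cong refl integral_bounded_linear L test_function_mult_integrable loc p)
  also have "\<dots> = (\<Sum>i\<in>UNIV. L' i (- (\<Sum>j\<in>UNIV. LINT x|lebesgue. h i j x)))"
  proof (rule sum.cong[OF refl])
    fix i
    have "(LINT x|lebesgue. partial_derivative i \<phi> x *\<^sub>R D x) = - (LINT x|lebesgue. (\<Sum>j\<in>UNIV. h i j x))"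
      using W p[of i] unfolding weak_op_def h_def by blast
    also have "(LINT x|lebesgue. (\<Sum>j\<in>UNIV. h i j x)) = (\<Sum>j\<in>UNIV. LINT x|lebesgue. h i j x)"
      by (rule Bochner_Integration.integral_sum) (rule hI)
    finally show "L' i (LINT x|lebesgue. partial_derivative i \<phi> x *\<^sub>R D x) = L' i (- (\<Sum>j\<in>UNIV. LINT x|lebesgue. h i j x))"
      by simp
  qed
  also have "\<dots> = - (\<Sum>i\<in>UNIV. \<Sum>j\<in>UNIV. LINT x|lebesgue. L' i (h i j x))"
    by (simp add: linear_neg[OF bounded_linear.linear[OF L(2)]] linear_sum[OF bounded_linear.linear[OF L(2)]]
        sum_negf integral_bounded_linear[OF L(2) hI])
  also have "(\<Sum>i\<in>UNIV. \<Sum>j\<in>UNIV. LINT x|lebesgue. L' i (h i j x)) = 0"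
  proof -
    have a: "L' i (h i j x) = - L' j (h j i x)" for i j x
      unfolding hs[of j i] unfolding h_def
      by (simp add: linear_scale[OF bounded_linear.linear[OF L(2)]] anti[of i j])
    have "(\<Sum>i\<in>UNIV. \<Sum>j\<in>UNIV. LINT x|lebesgue. L' i (h i j x)) =
        (\<Sum>i\<in>UNIV. \<Sum>j\<in>UNIV. - (LINT x|lebesgue. L' j (h j i x)))"
    proof (intro sum.cong refl)
      fix i j
      have "(\<lambda>x. L' i (h i j x)) = (\<lambda>x. - L' j (h j i x))" by (rule ext) (rule a)
      then show "(LINT x|lebesgue. L' i (h i j x)) = - (LINT x|lebesgue. L' j (h j i x))"
        by (simp only: Bochner_Integration.integral_minus)
    qed
    also have "\<dots> = - (\<Sum>j\<in>UNIV. \<Sum>i\<in>UNIV. LINT x|lebesgue. L' j (h j i x))"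
      by (subst sum.swap) (simp add: sum_negf)
    finally have neg: "(\<Sum>i\<in>UNIV. \<Sum>j\<in>UNIV. LINT x|lebesgue. L' i (h i j x)) =
      - (\<Sum>i\<in>UNIV. \<Sum>j\<in>UNIV. LINT x|lebesgue. L' i (h i j x))" .
    have "w = 0" if "w = - w" for w :: 'd
    proof -
      have "2 *\<^sub>R w = w + w" by (rule scaleR_2)
      also have "\<dots> = 0" using that by (metis add.right_inverse)
      finally show ?thesis by simp
    qed
    from this[OF neg] show ?thesis .
  qed
  finally show "(LINT x|lebesgue. \<phi> x *\<^sub>R 0) = - (LINT x|lebesgue. (\<Sum>i\<in>UNIV. partial_derivative i \<phi> x *\<^sub>R L' i (D x)))"
    by simp
qed

lemma weak_curl_gradient: "weak_op grad_symbol u G \<Longrightarrow> weak_op curl_symbol G (\<lambda>x. 0)"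
proof (rule weak_op_compose_0[OF _ bounded_linear_symbols(1,3)])
  have "cross3 x (t *\<^sub>R y) = - cross3 y (t *\<^sub>R x)" for x y :: "real^3" and t :: real
    by (simp add: cross3_def vec_eq_iff forall_3 algebra_simps)
  then show "cross3 (axis i 1) (t *\<^sub>R axis j 1) = - cross3 (axis j 1) (t *\<^sub>R axis i 1)" for i j :: 3 and t :: real .
qed

lemma weak_divergence_curl: "weak_op curl_symbol V B \<Longrightarrow> weak_op div_symbol B (\<lambda>x. 0)"
proof (rule weak_op_compose_0[OF _ bounded_linear_symbols(3,2)])
  have "cross3 y v \<bullet> x = - (cross3 x v \<bullet> y)" for x y v :: "real^3"
    by (simp add: cross3_def inner_vec_def sum_3 algebra_simps)
  then show "cross3 (axis j 1) v $ i = - (cross3 (axis i 1) v $ j)" for i j :: 3 and v :: "real^3"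
    unfolding cart_eq_inner_axis .
qed

section \<open>Weak derivatives of Newton potentials\<close>

lemma kernel_op_bounded_linear:
  assumes "integrable lebesgue (\<lambda>y. k (x - y) *\<^sub>R F y)" "bounded_linear T"
  shows "kernel_op k (\<lambda>y. T (F y)) x = T (kernel_op k F x)"
  unfolding kernel_op_def integral_bounded_linear[OF assms(2,1), symmetric]
  by (simp add: linear_scale[OF bounded_linear.linear[OF assms(2)]])

text \<open>The operators act on the test function instead of the field: testing the Newton
  potential of \<open>F\<close> with \<phi> is testing \<open>F\<close> with
  \<open>pot \<phi>\<close>. With the gradient kernel a sign appears, since that kernel is odd, and
  square-integrability of \<open>F\<close> is enough.\<close>

lemma kernel_op_pot:
  fixes F :: "real^3 \<Rightarrow> 'b::euclidean_space"
  assumes \<phi>: "test_function \<phi>"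
  shows "F \<in> L2w \<gamma> \<Longrightarrow> \<gamma> > 2 \<Longrightarrow>
      (LINT x|lebesgue. \<phi> x *\<^sub>R kernel_op fund F x) = (LINT y|lebesgue. pot \<phi> y *\<^sub>R F y)"
    and "F \<in> borel_measurable lebesgue \<Longrightarrow> integrable lebesgue (\<lambda>y. (norm (F y))\<^sup>2) \<Longrightarrow>
      (LINT x|lebesgue. \<phi> x *\<^sub>R kernel_op (\<lambda>z. fund_grad z $ i) F x) =
      - (LINT y|lebesgue. pot (partial_derivative i \<phi>) y *\<^sub>R F y)"
proof -
  obtain C M where CM: "\<And>x. \<bar>\<phi> x\<bar> \<le> C * indicator (cball 0 M) x" using test_function_bound[OF \<phi>] by metis
  have b: "\<phi> \<in> borel_measurable borel" by (intro smooth_borel test_function_smooth \<phi>)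
  show "(LINT x|lebesgue. \<phi> x *\<^sub>R kernel_op fund F x) = (LINT y|lebesgue. pot \<phi> y *\<^sub>R F y)" if "F \<in> L2w \<gamma>" "\<gamma> > 2"
    using kernel_op_Fubini(1)[OF _ _ borel_measurable_fund fund_le b CM L2w_D(1)[OF that(1)] decay_integrable(1)[OF that]]
    by (simp add: integral_test_kernel[OF \<phi>])
  show "(LINT x|lebesgue. \<phi> x *\<^sub>R kernel_op (\<lambda>z. fund_grad z $ i) F x) =
      - (LINT y|lebesgue. pot (partial_derivative i \<phi>) y *\<^sub>R F y)"
    if F: "F \<in> borel_measurable lebesgue" "integrable lebesgue (\<lambda>y. (norm (F y))\<^sup>2)"
    using kernel_op_Fubini(1)[OF _ _ borel_measurable_fund_grad_nth fund_grad_le b CM F(1) decay_integrable(2)[OF F]]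
    by (simp add: integral_test_kernel[OF \<phi>])
qed

lemma locally_integrable_newton:
  fixes F :: "real^3 \<Rightarrow> 'b::euclidean_space"
  assumes "F \<in> L2w \<gamma>" "\<gamma> > 2"
  shows "locally_integrable (kernel_op fund F)"
  using locally_integrable_kernel_op[OF _ _ borel_measurable_fund fund_le L2w_D(1)[OF assms(1)] decay_integrable(1)[OF assms]]
  by simp

lemma locally_integrable_fund_grad:
  fixes F :: "real^3 \<Rightarrow> 'b::euclidean_space"
  assumes F: "F \<in> borel_measurable lebesgue" "integrable lebesgue (\<lambda>y. (norm (F y))\<^sup>2)"
  shows "locally_integrable (kernel_op (\<lambda>z. fund_grad z $ i) F)"
  using locally_integrable_kernel_op[OF _ _ borel_measurable_fund_grad_nth fund_grad_le F(1) decay_integrable(2)[OF F]]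
  by simp

text \<open>The integrability conditions for using \<open>pot \<phi>\<close> like a test function:
  against the weak derivative, against the field after differentiation, and in the error term of the
  cut-off. In the error term two factors of order \<open>1 / |x|\<close> combine to
  \<open>1 / |x|^2\<close>, so no weight is required there.\<close>

lemma pot_mult_integrable:
  fixes F :: "real^3 \<Rightarrow> 'b::euclidean_space"
  assumes \<phi>: "test_function \<phi>"
  shows "F \<in> L2w \<gamma> \<Longrightarrow> \<gamma> > 2 \<Longrightarrow> integrable lebesgue (\<lambda>x. pot \<phi> x *\<^sub>R F x)"
    and "F \<in> borel_measurable lebesgue \<Longrightarrow> integrable lebesgue (\<lambda>y. (norm (F y))\<^sup>2) \<Longrightarrow>
      integrable lebesgue (\<lambda>x. pot (partial_derivative i \<phi>) x *\<^sub>R F x)"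
    and "F \<in> borel_measurable lebesgue \<Longrightarrow> integrable lebesgue (\<lambda>y. (norm (F y))\<^sup>2) \<Longrightarrow>
      integrable lebesgue (\<lambda>x. ((1 + norm x) powr - 1 * pot \<phi> x) *\<^sub>R F x)"
proof -
  show "integrable lebesgue (\<lambda>x. pot \<phi> x *\<^sub>R F x)" if "F \<in> L2w \<gamma>" "\<gamma> > 2"
    by (rule decay_mult_integrable[OF L2w_D(1)[OF that(1)] decay_integrable(1)[OF that] pot_borel[OF \<phi>] pot_decay(1)[OF \<phi>]])
  assume F: "F \<in> borel_measurable lebesgue" "integrable lebesgue (\<lambda>y. (norm (F y))\<^sup>2)"
  show "integrable lebesgue (\<lambda>x. pot (partial_derivative i \<phi>) x *\<^sub>R F x)"
    by (rule decay_mult_integrable[OF F(1) decay_integrable(2)[OF F] pot_borel[OF test_function_partial[OF \<phi>]] pot_decay(2)[OF \<phi>]])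
  obtain B where B: "B > 0" "\<And>x. \<bar>pot \<phi> x\<bar> \<le> B * (1 + norm x) powr - 1" using pot_decay(1)[OF \<phi>] by blast
  have "\<bar>(1 + norm x) powr - 1 * pot \<phi> x\<bar> \<le> B * (1 + norm x) powr - 2" for x
  proof -
    have "\<bar>(1 + norm x) powr - 1 * pot \<phi> x\<bar> \<le> (1 + norm x) powr - 1 * (B * (1 + norm x) powr - 1)"
      unfolding abs_mult using mult_left_mono[OF B(2)[of x], of "(1 + norm x) powr - 1"] by simp
    also have "\<dots> = B * ((1 + norm x) powr - 1 * (1 + norm x) powr - 1)" by (simp only: mult_ac)
    also have "(1 + norm x) powr - 1 * (1 + norm x) powr - 1 = (1 + norm x) powr - 2"
      using powr_add[of "1 + norm x" "-1" "-1"] by simp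
    finally show ?thesis .
  qed
  then have "\<exists>B>0. \<forall>x. \<bar>(1 + norm x) powr - 1 * pot \<phi> x\<bar> \<le> B * (1 + norm x) powr - 2" using B(1) by blast
  moreover have "(\<lambda>x. (1 + norm x) powr - 1 * pot \<phi> x) \<in> borel_measurable borel"
    using pot_borel[OF \<phi>] by measurable
  ultimately show "integrable lebesgue (\<lambda>x. ((1 + norm x) powr - 1 * pot \<phi> x) *\<^sub>R F x)"
    by (intro decay_mult_integrable[OF F(1) decay_integrable(2)[OF F]])
qed

text \<open>The field itself needs only to be square-integrable. Integrability against
  \<open>D\<close> is left as a condition: it comes from the weight when \<open>D\<close> is a
  weighted field, and it is trivial when \<open>D = 0\<close>.\<close>

lemma weak_op_pot:
  fixes F :: "real^3 \<Rightarrow> 'b::euclidean_space" and D :: "real^3 \<Rightarrow> 'c::euclidean_space"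
  assumes W: "weak_op L F D" and L: "\<And>i. bounded_linear (L i)"
    and F: "F \<in> borel_measurable lebesgue" "integrable lebesgue (\<lambda>y. (norm (F y))\<^sup>2)"
    and \<phi>: "test_function \<phi>" and D: "integrable lebesgue (\<lambda>x. pot \<phi> x *\<^sub>R D x)"
  shows "(LINT x|lebesgue. pot \<phi> x *\<^sub>R D x) =
    - (\<Sum>i\<in>UNIV. LINT x|lebesgue. pot (partial_derivative i \<phi>) x *\<^sub>R L i (F x))"
  using weak_op_decaying[OF W L smooth_pot[OF \<phi>] D] pot_mult_integrable(2,3)[OF \<phi> F]
  unfolding partial_derivative_pot[OF \<phi>] by blast

text \<open>The derivative falls on the kernel, so \<open>F\<close> need not have weak derivatives.
  Tested with \<phi>, both sides reduce to pairings of \<open>L i (F y)\<close> with the potentials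
  of the derivatives of \<phi>.\<close>

lemma weak_op_kernel:
  fixes F :: "real^3 \<Rightarrow> 'b::euclidean_space" and L :: "3 \<Rightarrow> 'b \<Rightarrow> 'c::euclidean_space"
  assumes L: "\<And>i. bounded_linear (L i)" and F: "F \<in> L2w \<gamma>" "\<gamma> > 2"
  shows "weak_op L (kernel_op fund F) (\<lambda>x. \<Sum>i\<in>UNIV. kernel_op (\<lambda>z. fund_grad z $ i) (\<lambda>y. L i (F y)) x)"
    and "test_function \<phi> \<Longrightarrow>
      (LINT x|lebesgue. (\<Sum>i\<in>UNIV. partial_derivative i \<phi> x *\<^sub>R L i (kernel_op fund F x))) =
      (\<Sum>i\<in>UNIV. LINT y|lebesgue. pot (partial_derivative i \<phi>) y *\<^sub>R L i (F y))"
proof -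
  have LF: "(\<lambda>y. L i (F y)) \<in> L2w \<gamma>" for i by (rule L2w_bounded_linear[OF F(1) L])
  have LF2: "(\<lambda>y. L i (F y)) \<in> borel_measurable lebesgue" "integrable lebesgue (\<lambda>y. (norm (L i (F y)))\<^sup>2)" for i
    using L2w_D(1)[OF LF[of i]] L2w_mult_le(2)[OF LF[of i], of 0] F(2) by simp_all
  have loc: "locally_integrable (kernel_op fund F)" by (rule locally_integrable_newton[OF F])
  have loc': "locally_integrable (kernel_op (\<lambda>z. fund_grad z $ i) (\<lambda>y. L i (F y)))" for i
    by (rule locally_integrable_fund_grad[OF LF2])
  have rhs: "(LINT x|lebesgue. (\<Sum>i\<in>UNIV. partial_derivative i \<phi> x *\<^sub>R L i (kernel_op fund F x))) =
      (\<Sum>i\<in>UNIV. LINT y|lebesgue. pot (partial_derivative i \<phi>) y *\<^sub>R L i (F y))" if \<phi>: "test_function \<phi>" for \<phi>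
  proof -
    have "(LINT x|lebesgue. (\<Sum>i\<in>UNIV. partial_derivative i \<phi> x *\<^sub>R L i (kernel_op fund F x))) =
        (\<Sum>i\<in>UNIV. LINT x|lebesgue. partial_derivative i \<phi> x *\<^sub>R L i (kernel_op fund F x))"
      by (intro Bochner_Integration.integral_sum test_op_integrable loc L \<phi>)
    also have "\<dots> = (\<Sum>i\<in>UNIV. LINT x|lebesgue. partial_derivative i \<phi> x *\<^sub>R kernel_op fund (\<lambda>y. L i (F y)) x)"
      by (simp add: kernel_op_bounded_linear[OF L2w_fund_integrable[OF F] L])
    also have "\<dots> = (\<Sum>i\<in>UNIV. LINT y|lebesgue. pot (partial_derivative i \<phi>) y *\<^sub>R L i (F y))"
      by (intro sum.cong refl kernel_op_pot(1)[OF test_function_partial[OF \<phi>] LF F(2)])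
    finally show ?thesis .
  qed
  then show "test_function \<phi> \<Longrightarrow>
      (LINT x|lebesgue. (\<Sum>i\<in>UNIV. partial_derivative i \<phi> x *\<^sub>R L i (kernel_op fund F x))) =
      (\<Sum>i\<in>UNIV. LINT y|lebesgue. pot (partial_derivative i \<phi>) y *\<^sub>R L i (F y))" .
  show "weak_op L (kernel_op fund F) (\<lambda>x. \<Sum>i\<in>UNIV. kernel_op (\<lambda>z. fund_grad z $ i) (\<lambda>y. L i (F y)) x)"
    unfolding weak_op_def
  proof (intro conjI allI impI loc locally_integrable_sum loc')
    fix \<phi> :: "real^3 \<Rightarrow> real" assume \<phi>: "test_function \<phi>"
    have "(LINT x|lebesgue. \<phi> x *\<^sub>R (\<Sum>i\<in>UNIV. kernel_op (\<lambda>z. fund_grad z $ i) (\<lambda>y. L i (F y)) x)) =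
        (\<Sum>i\<in>UNIV. LINT x|lebesgue. \<phi> x *\<^sub>R kernel_op (\<lambda>z. fund_grad z $ i) (\<lambda>y. L i (F y)) x)"
      unfolding scaleR_sum_right
      by (intro Bochner_Integration.integral_sum test_function_mult_integrable loc' \<phi>)
    also have "\<dots> = - (\<Sum>i\<in>UNIV. LINT y|lebesgue. pot (partial_derivative i \<phi>) y *\<^sub>R L i (F y))"
      by (simp add: kernel_op_pot(2)[OF \<phi> LF2] sum_negf)
    finally show "(LINT x|lebesgue. \<phi> x *\<^sub>R (\<Sum>i\<in>UNIV. kernel_op (\<lambda>z. fund_grad z $ i) (\<lambda>y. L i (F y)) x)) =
      - (LINT x|lebesgue. (\<Sum>i\<in>UNIV. partial_derivative i \<phi> x *\<^sub>R L i (kernel_op fund F x)))"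
      by (simp only: rhs[OF \<phi>])
  qed
qed

lemma L2w_L2:
  fixes F :: "real^3 \<Rightarrow> 'b::euclidean_space"
  assumes "F \<in> L2w \<gamma>" "\<gamma> > 2"
  shows "F \<in> borel_measurable lebesgue" "integrable lebesgue (\<lambda>y. (norm (F y))\<^sup>2)"
  using L2w_D(1)[OF assms(1)] L2w_mult_le(2)[OF assms(1), of 0] assms(2) by simp_all

text \<open>Here the derivative falls on the field: the Newton potential commutes with the operator.
  By uniqueness of weak derivatives, comparison with \<open>weak_op_kernel\<close> identifies the
  potential of \<open>D\<close> with the expression in \<open>fund_grad\<close> applied to
  \<open>F\<close>.\<close>

lemma weak_op_newton:
  fixes F :: "real^3 \<Rightarrow> 'b::euclidean_space" and D :: "real^3 \<Rightarrow> 'c::euclidean_space"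
  assumes W: "weak_op L F D" and L: "\<And>i. bounded_linear (L i)"
    and F: "F \<in> L2w \<gamma>" and D: "D \<in> L2w \<gamma>" and \<gamma>: "\<gamma> > 2"
  shows "weak_op L (kernel_op fund F) (kernel_op fund D)"
  unfolding weak_op_def
proof (intro conjI allI impI locally_integrable_newton[OF F \<gamma>] locally_integrable_newton[OF D \<gamma>])
  fix \<phi> :: "real^3 \<Rightarrow> real" assume \<phi>: "test_function \<phi>"
  have "(LINT x|lebesgue. \<phi> x *\<^sub>R kernel_op fund D x) = (LINT y|lebesgue. pot \<phi> y *\<^sub>R D y)"
    by (rule kernel_op_pot(1)[OF \<phi> D \<gamma>])
  also have "\<dots> = - (\<Sum>i\<in>UNIV. LINT x|lebesgue. pot (partial_derivative i \<phi>) x *\<^sub>R L i (F x))"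
    by (rule weak_op_pot[OF W L L2w_L2[OF F \<gamma>] \<phi> pot_mult_integrable(1)[OF \<phi> D \<gamma>]])
  finally show "(LINT x|lebesgue. \<phi> x *\<^sub>R kernel_op fund D x) =
      - (LINT x|lebesgue. (\<Sum>i\<in>UNIV. partial_derivative i \<phi> x *\<^sub>R L i (kernel_op fund F x)))"
    by (simp only: weak_op_kernel(2)[OF L F \<gamma> \<phi>])
qed

text \<open>The identity \<open>curl curl - grad div = - Laplace\<close> as pure algebra, with a
  symmetric matrix \<open>h\<close> in the role of the second derivatives.\<close>

lemma curl_curl_minus_grad_div_symbol:
  fixes h :: "3 \<Rightarrow> 3 \<Rightarrow> real" and v :: "real^3"
  assumes "\<And>i j. h i j = h j i"
  shows "(\<Sum>j\<in>UNIV. cross3 (axis j 1) (\<Sum>i\<in>UNIV. h i j *\<^sub>R cross3 (axis i 1) v) - (\<Sum>i\<in>UNIV. h i j *\<^sub>R (v $ i)) *\<^sub>R axis j 1)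
    = - (\<Sum>i\<in>UNIV. h i i) *\<^sub>R v"
  using assms[of 1 2] assms[of 1 3] assms[of 2 3]
  by (simp add: sum_3 cross3_def vec_eq_iff forall_3 axis_def vector_3 algebra_simps)

text \<open>Since \<open>\<phi>\<close> is minus the Laplacian of \<open>pot \<phi>\<close>, integration against \<open>\<phi>\<close> only involves the curl and the divergence.\<close>

lemma integral_test_curl_div:
  fixes F :: "real^3 \<Rightarrow> real^3"
  assumes F: "F \<in> borel_measurable lebesgue" "integrable lebesgue (\<lambda>y. (norm (F y))\<^sup>2)"
    and \<phi>: "test_function \<phi>"
  shows "(LINT x|lebesgue. \<phi> x *\<^sub>R F x) =
    (\<Sum>j\<in>UNIV. cross3 (axis j 1)
        (\<Sum>i\<in>UNIV. LINT x|lebesgue. pot (partial_derivative i (partial_derivative j \<phi>)) x *\<^sub>R curl_symbol i (F x))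
      - (\<Sum>i\<in>UNIV. LINT x|lebesgue. pot (partial_derivative i (partial_derivative j \<phi>)) x *\<^sub>R div_symbol i (F x)) *\<^sub>R axis j 1)"
proof -
  let ?h = "\<lambda>i j. pot (partial_derivative i (partial_derivative j \<phi>))"
  have I: "integrable lebesgue (\<lambda>x. ?h i j x *\<^sub>R F x)" for i j
    by (rule pot_mult_integrable(2)[OF test_function_partial[OF \<phi>] F])
  have IT: "integrable lebesgue (\<lambda>x. ?h i j x *\<^sub>R T (F x))" if "bounded_linear T" for T :: "real^3 \<Rightarrow> 'b::euclidean_space" and i j
    using integrable_bounded_linear[OF that I] by (simp add: linear_scale[OF bounded_linear.linear[OF that]])
  have Ic: "integrable lebesgue (\<lambda>x. ?h i j x *\<^sub>R curl_symbol i (F x))" for i j by (rule IT[OF bounded_linear_symbols(3)])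
  have Id: "integrable lebesgue (\<lambda>x. ?h i j x *\<^sub>R div_symbol i (F x))" for i j by (rule IT[OF bounded_linear_symbols(2)])
  have C: "cross3 (axis j 1) (\<Sum>i\<in>UNIV. LINT x|lebesgue. ?h i j x *\<^sub>R curl_symbol i (F x)) =
      (LINT x|lebesgue. cross3 (axis j 1) (\<Sum>i\<in>UNIV. ?h i j x *\<^sub>R curl_symbol i (F x)))"
      "integrable lebesgue (\<lambda>x. cross3 (axis j 1) (\<Sum>i\<in>UNIV. ?h i j x *\<^sub>R curl_symbol i (F x)))" for j
  proof -
    have "integrable lebesgue (\<lambda>x. \<Sum>i\<in>UNIV. ?h i j x *\<^sub>R curl_symbol i (F x))"
      by (intro Bochner_Integration.integrable_sum Ic)
    note integral_bounded_linear[OF bounded_linear_symbols(3) this, of j]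
      integrable_bounded_linear[OF bounded_linear_symbols(3) this, of j]
    then show "cross3 (axis j 1) (\<Sum>i\<in>UNIV. LINT x|lebesgue. ?h i j x *\<^sub>R curl_symbol i (F x)) =
      (LINT x|lebesgue. cross3 (axis j 1) (\<Sum>i\<in>UNIV. ?h i j x *\<^sub>R curl_symbol i (F x)))"
      "integrable lebesgue (\<lambda>x. cross3 (axis j 1) (\<Sum>i\<in>UNIV. ?h i j x *\<^sub>R curl_symbol i (F x)))"
      using Ic by (simp_all add: Bochner_Integration.integral_sum)
  qed
  have D: "(\<Sum>i\<in>UNIV. LINT x|lebesgue. ?h i j x *\<^sub>R div_symbol i (F x)) *\<^sub>R axis j 1 =
      (LINT x|lebesgue. (\<Sum>i\<in>UNIV. ?h i j x *\<^sub>R div_symbol i (F x)) *\<^sub>R axis j 1)"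
      "integrable lebesgue (\<lambda>x. (\<Sum>i\<in>UNIV. ?h i j x *\<^sub>R div_symbol i (F x)) *\<^sub>R (axis j 1 :: real^3))" for j
  proof -
    have i: "integrable lebesgue (\<lambda>x. \<Sum>i\<in>UNIV. ?h i j x *\<^sub>R div_symbol i (F x))"
      by (intro Bochner_Integration.integrable_sum Id)
    then show "integrable lebesgue (\<lambda>x. (\<Sum>i\<in>UNIV. ?h i j x *\<^sub>R div_symbol i (F x)) *\<^sub>R (axis j 1 :: real^3))"
      by (intro integrable_scaleR_left)
    show "(\<Sum>i\<in>UNIV. LINT x|lebesgue. ?h i j x *\<^sub>R div_symbol i (F x)) *\<^sub>R axis j 1 =
      (LINT x|lebesgue. (\<Sum>i\<in>UNIV. ?h i j x *\<^sub>R div_symbol i (F x)) *\<^sub>R axis j 1)"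
      using i Id by (subst integral_scaleR_left) (simp_all only: Bochner_Integration.integral_sum)
  qed
  have sym: "?h i j = ?h j i" for i j
    using partial_derivative_commute[OF test_function_smooth[OF \<phi>], of i j] by simp
  have "(\<Sum>j\<in>UNIV. cross3 (axis j 1) (\<Sum>i\<in>UNIV. LINT x|lebesgue. ?h i j x *\<^sub>R curl_symbol i (F x))
      - (\<Sum>i\<in>UNIV. LINT x|lebesgue. ?h i j x *\<^sub>R div_symbol i (F x)) *\<^sub>R axis j 1) =
    (\<Sum>j\<in>UNIV. LINT x|lebesgue. cross3 (axis j 1) (\<Sum>i\<in>UNIV. ?h i j x *\<^sub>R curl_symbol i (F x))
      - (\<Sum>i\<in>UNIV. ?h i j x *\<^sub>R div_symbol i (F x)) *\<^sub>R axis j 1)"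
    unfolding C(1) D(1) by (intro sum.cong refl Bochner_Integration.integral_diff[symmetric] C(2) D(2))
  also have "\<dots> = (LINT x|lebesgue. (\<Sum>j\<in>UNIV. cross3 (axis j 1) (\<Sum>i\<in>UNIV. ?h i j x *\<^sub>R curl_symbol i (F x))
      - (\<Sum>i\<in>UNIV. ?h i j x *\<^sub>R div_symbol i (F x)) *\<^sub>R axis j 1))"
    by (intro Bochner_Integration.integral_sum[symmetric] Bochner_Integration.integrable_diff C(2) D(2))
  also have "\<dots> = (LINT x|lebesgue. \<phi> x *\<^sub>R F x)"
    by (subst curl_curl_minus_grad_div_symbol) (simp_all add: pot_laplacian[OF \<phi>] fun_cong[OF sym])
  finally show ?thesis by simp
qed

text \<open>A Liouville theorem. In \<open>integral_test_curl_div\<close> the inner sums are, up to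
  sign, the pairings of the curl and of the divergence of \<open>F\<close> with
  \<open>pot (partial_derivative j \<phi>)\<close>, so both vanish.\<close>

lemma L2_curl_div_free:
  fixes F :: "real^3 \<Rightarrow> real^3"
  assumes F: "F \<in> borel_measurable lebesgue" "integrable lebesgue (\<lambda>y. (norm (F y))\<^sup>2)"
    and c: "weak_op curl_symbol F (\<lambda>x. 0)" and d: "weak_op div_symbol F (\<lambda>x. 0)"
  shows "AE x in lebesgue. F x = 0"
proof (rule fundamental_lemma[OF L2_locally_integrable[OF F]])
  fix \<phi> :: "real^3 \<Rightarrow> real" assume \<phi>: "test_function \<phi>"
  have "(\<Sum>i\<in>UNIV. LINT x|lebesgue. pot (partial_derivative i (partial_derivative j \<phi>)) x *\<^sub>R curl_symbol i (F x)) = 0"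
    "(\<Sum>i\<in>UNIV. LINT x|lebesgue. pot (partial_derivative i (partial_derivative j \<phi>)) x *\<^sub>R div_symbol i (F x)) = 0" for j
    using weak_op_pot[OF c bounded_linear_symbols(3) F test_function_partial[OF \<phi>]]
      weak_op_pot[OF d bounded_linear_symbols(2) F test_function_partial[OF \<phi>]] by simp_all
  then show "(LINT x|lebesgue. \<phi> x *\<^sub>R F x) = 0"
    unfolding integral_test_curl_div[OF F \<phi>] by simp
qed

text \<open>Tested with \<phi>, the two potentials become pairings of \<open>ca\<close> and
  \<open>gf\<close> with \<open>pot \<phi>\<close>. Using the weak derivative twice, first from
  \<open>ca\<close> to \<open>a\<close> and from \<open>gf\<close> to \<open>f\<close>, then from
  these to \<open>A\<close>, leaves the second derivatives of \<open>pot \<phi>\<close> against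
  \<open>A\<close>, in exactly the combination of \<open>integral_test_curl_div\<close>.\<close>

lemma newton_representation:
  fixes A a ca gf :: "real^3 \<Rightarrow> real^3" and f :: "real^3 \<Rightarrow> real"
  assumes \<gamma>: "\<gamma> > 2" and L: "A \<in> L2w \<gamma>" "a \<in> L2w \<gamma>" "ca \<in> L2w \<gamma>" "gf \<in> L2w \<gamma>" "f \<in> L2w \<gamma>"
    and W: "weak_op curl_symbol A a" "weak_op div_symbol A f" "weak_op curl_symbol a ca" "weak_op grad_symbol f gf"
  shows "AE x in lebesgue. A x = kernel_op fund ca x - kernel_op fund gf x"
proof (rule fundamental_lemma_eq)
  note loc = locally_integrable_newton[OF L(3) \<gamma>] locally_integrable_newton[OF L(4) \<gamma>]
  show "locally_integrable A" using W(1) by (simp add: weak_op_def)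
  show "locally_integrable (\<lambda>x. kernel_op fund ca x - kernel_op fund gf x)"
    by (intro locally_integrable_diff loc)
  fix \<phi> :: "real^3 \<Rightarrow> real" assume \<phi>: "test_function \<phi>"
  have p: "test_function (partial_derivative j \<phi>)" for j by (rule test_function_partial[OF \<phi>])
  have c1: "(LINT x|lebesgue. pot \<phi> x *\<^sub>R ca x) = - (\<Sum>j\<in>UNIV. cross3 (axis j 1) (LINT x|lebesgue. pot (partial_derivative j \<phi>) x *\<^sub>R a x))"
  proof -
    have "(LINT x|lebesgue. pot \<phi> x *\<^sub>R ca x) = - (\<Sum>j\<in>UNIV. LINT x|lebesgue. pot (partial_derivative j \<phi>) x *\<^sub>R curl_symbol j (a x))"
      by (rule weak_op_pot[OF W(3) bounded_linear_symbols(3) L2w_L2[OF L(2) \<gamma>] \<phi> pot_mult_integrable(1)[OF \<phi> L(3) \<gamma>]])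
    also have "\<dots> = - (\<Sum>j\<in>UNIV. cross3 (axis j 1) (LINT x|lebesgue. pot (partial_derivative j \<phi>) x *\<^sub>R a x))"
      using integral_bounded_linear[OF bounded_linear_symbols(3) pot_mult_integrable(1)[OF p L(2) \<gamma>]]
      by (simp add: cross_mult_right)
    finally show ?thesis .
  qed
  have c2: "(LINT x|lebesgue. pot \<phi> x *\<^sub>R gf x) = - (\<Sum>j\<in>UNIV. (LINT x|lebesgue. pot (partial_derivative j \<phi>) x *\<^sub>R f x) *\<^sub>R axis j 1)"
  proof -
    have "(LINT x|lebesgue. pot \<phi> x *\<^sub>R gf x) = - (\<Sum>j\<in>UNIV. LINT x|lebesgue. pot (partial_derivative j \<phi>) x *\<^sub>R grad_symbol j (f x))"
      by (rule weak_op_pot[OF W(4) bounded_linear_symbols(1) L2w_L2[OF L(5) \<gamma>] \<phi> pot_mult_integrable(1)[OF \<phi> L(4) \<gamma>]])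
    also have "\<dots> = - (\<Sum>j\<in>UNIV. (LINT x|lebesgue. pot (partial_derivative j \<phi>) x *\<^sub>R f x) *\<^sub>R axis j 1)"
      using integral_bounded_linear[OF bounded_linear_symbols(1) pot_mult_integrable(1)[OF p L(5) \<gamma>]]
      by simp
    finally show ?thesis .
  qed
  have c3: "(LINT x|lebesgue. pot (partial_derivative j \<phi>) x *\<^sub>R a x) =
      - (\<Sum>i\<in>UNIV. LINT x|lebesgue. pot (partial_derivative i (partial_derivative j \<phi>)) x *\<^sub>R curl_symbol i (A x))" for j
    by (rule weak_op_pot[OF W(1) bounded_linear_symbols(3) L2w_L2[OF L(1) \<gamma>] p pot_mult_integrable(1)[OF p L(2) \<gamma>]])
  have c4: "(LINT x|lebesgue. pot (partial_derivative j \<phi>) x *\<^sub>R f x) =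
      - (\<Sum>i\<in>UNIV. LINT x|lebesgue. pot (partial_derivative i (partial_derivative j \<phi>)) x *\<^sub>R div_symbol i (A x))" for j
    by (rule weak_op_pot[OF W(2) bounded_linear_symbols(2) L2w_L2[OF L(1) \<gamma>] p pot_mult_integrable(1)[OF p L(5) \<gamma>]])
  have "(LINT x|lebesgue. \<phi> x *\<^sub>R (kernel_op fund ca x - kernel_op fund gf x)) =
      (LINT x|lebesgue. \<phi> x *\<^sub>R kernel_op fund ca x) - (LINT x|lebesgue. \<phi> x *\<^sub>R kernel_op fund gf x)"
    using test_function_mult_integrable[OF loc(1) \<phi>] test_function_mult_integrable[OF loc(2) \<phi>]
    by (simp add: scaleR_diff_right)
  also have "\<dots> = (LINT x|lebesgue. \<phi> x *\<^sub>R A x)"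
    unfolding kernel_op_pot(1)[OF \<phi> L(3) \<gamma>] kernel_op_pot(1)[OF \<phi> L(4) \<gamma>] c1 c2 c3 c4
      integral_test_curl_div[OF L2w_L2[OF L(1) \<gamma>] \<phi>]
    by (simp add: cross_minus_right sum_negf sum_subtractf)
  finally show "(LINT x|lebesgue. \<phi> x *\<^sub>R A x) = (LINT x|lebesgue. \<phi> x *\<^sub>R (kernel_op fund ca x - kernel_op fund gf x))"
    by simp
qed

text \<open>Formally this is the divergence of the Newton potential of \<open>F\<close>. For a
  merely square-integrable \<open>F\<close> that potential is not at hand, so the sum is tested
  directly: it becomes minus the pairing of \<open>F\<close> with the gradient of
  \<open>pot \<phi>\<close>, which is 0 by the weak divergence.\<close>

lemma div_free_fund_grad:
  fixes F :: "real^3 \<Rightarrow> real^3"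
  assumes F: "F \<in> borel_measurable lebesgue" "integrable lebesgue (\<lambda>y. (norm (F y))\<^sup>2)"
    and d: "weak_op div_symbol F (\<lambda>x. 0)"
  shows "AE y in lebesgue. (\<Sum>i\<in>UNIV. kernel_op (\<lambda>z. fund_grad z $ i) (\<lambda>x. F x $ i) y) = 0"
proof (rule fundamental_lemma)
  note loc = locally_integrable_fund_grad[OF L2_component[OF F]]
  show "locally_integrable (\<lambda>y. \<Sum>i\<in>UNIV. kernel_op (\<lambda>z. fund_grad z $ i) (\<lambda>x. F x $ i) y)"
    by (intro locally_integrable_sum loc)
  fix \<phi> :: "real^3 \<Rightarrow> real" assume \<phi>: "test_function \<phi>"
  have "(LINT y|lebesgue. \<phi> y *\<^sub>R (\<Sum>i\<in>UNIV. kernel_op (\<lambda>z. fund_grad z $ i) (\<lambda>x. F x $ i) y)) =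
      (\<Sum>i\<in>UNIV. LINT y|lebesgue. \<phi> y *\<^sub>R kernel_op (\<lambda>z. fund_grad z $ i) (\<lambda>x. F x $ i) y)"
    unfolding scaleR_sum_right by (intro Bochner_Integration.integral_sum test_function_mult_integrable loc \<phi>)
  also have "\<dots> = - (\<Sum>i\<in>UNIV. LINT y|lebesgue. pot (partial_derivative i \<phi>) y *\<^sub>R (F y $ i))"
    by (simp only: kernel_op_pot(2)[OF \<phi> L2_component[OF F]] sum_negf)
  also have "\<dots> = (LINT x|lebesgue. pot \<phi> x *\<^sub>R 0)"
    by (rule weak_op_pot[OF d bounded_linear_symbols(2) F \<phi>, symmetric]) simp
  finally show "(LINT y|lebesgue. \<phi> y *\<^sub>R (\<Sum>i\<in>UNIV. kernel_op (\<lambda>z. fund_grad z $ i) (\<lambda>x. F x $ i) y)) = 0"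
    by simp
qed

section \<open>The Helmholtz decomposition\<close>

lemma weak_op_of_partials:
  fixes F :: "real^3 \<Rightarrow> 'b::euclidean_space" and L :: "3 \<Rightarrow> 'b \<Rightarrow> 'c::euclidean_space"
  assumes P: "\<And>i. has_weak_partial i F (D i)" and L: "\<And>i. bounded_linear (L i)"
  shows "weak_op L F (\<lambda>x. \<Sum>i\<in>UNIV. L i (D i x))"
proof -
  have loc: "locally_integrable F" "\<And>i. locally_integrable (D i)"
    using P unfolding has_weak_partial_def by auto
  have locL: "locally_integrable (\<lambda>x. L i (D i x))" for i
    by (rule locally_integrable_bounded_linear[OF loc(2) L])
  show ?thesis
    unfolding weak_op_def
  proof (intro conjI allI impI loc locally_integrable_sum locL)
    fix \<phi> :: "real^3 \<Rightarrow> real" assume \<phi>: "test_function \<phi>"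
    have "(LINT x|lebesgue. \<phi> x *\<^sub>R (\<Sum>i\<in>UNIV. L i (D i x))) = (\<Sum>i\<in>UNIV. LINT x|lebesgue. \<phi> x *\<^sub>R L i (D i x))"
      unfolding scaleR_sum_right
      by (rule Bochner_Integration.integral_sum) (rule test_function_mult_integrable[OF locL \<phi>])
    also have "\<dots> = (\<Sum>i\<in>UNIV. - (LINT x|lebesgue. partial_derivative i \<phi> x *\<^sub>R L i (F x)))"
    proof (rule sum.cong[OF refl])
      fix i
      have "(LINT x|lebesgue. \<phi> x *\<^sub>R L i (D i x)) = L i (LINT x|lebesgue. \<phi> x *\<^sub>R D i x)"
        unfolding linear_scale[OF bounded_linear.linear[OF L], symmetric]
        by (rule integral_bounded_linear[OF L test_function_mult_integrable[OF loc(2) \<phi>]])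
      also have "(LINT x|lebesgue. \<phi> x *\<^sub>R D i x) = - (LINT x|lebesgue. partial_derivative i \<phi> x *\<^sub>R F x)"
        using P[of i] \<phi> unfolding has_weak_partial_def by blast
      also have "L i \<dots> = - (LINT x|lebesgue. L i (partial_derivative i \<phi> x *\<^sub>R F x))"
        unfolding linear_neg[OF bounded_linear.linear[OF L]]
        by (subst integral_bounded_linear[OF L test_function_mult_integrable[OF loc(1) test_function_partial[OF \<phi>]]]) simp
      finally show "(LINT x|lebesgue. \<phi> x *\<^sub>R L i (D i x)) = - (LINT x|lebesgue. partial_derivative i \<phi> x *\<^sub>R L i (F x))"
        by (simp only: linear_scale[OF bounded_linear.linear[OF L]])
    qed
    also have "\<dots> = - (LINT x|lebesgue. (\<Sum>i\<in>UNIV. partial_derivative i \<phi> x *\<^sub>R L i (F x)))"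
      unfolding sum_negf
      by (subst Bochner_Integration.integral_sum) (simp_all add: test_op_integrable[OF loc(1) L \<phi>])
    finally show "(LINT x|lebesgue. \<phi> x *\<^sub>R (\<Sum>i\<in>UNIV. L i (D i x))) =
      - (LINT x|lebesgue. (\<Sum>i\<in>UNIV. partial_derivative i \<phi> x *\<^sub>R L i (F x)))" .
  qed
qed

text \<open>The fields \<open>b\<close> and \<open>c\<close> are given only as weak derivatives.
  Uniqueness identifies them almost everywhere with linear combinations of the derivatives provided
  by the Sobolev space, and membership in the weighted space carries over.\<close>

lemma H2_weighted_weak_op:
  fixes A :: "real^3 \<Rightarrow> 'b::euclidean_space" and L :: "3 \<Rightarrow> 'b \<Rightarrow> 'c::euclidean_space"
    and L' :: "3 \<Rightarrow> 'c \<Rightarrow> 'd::euclidean_space"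
  assumes A: "A \<in> H2_weighted (weight \<gamma>)"
    and L: "\<And>i. bounded_linear (L i)" and L': "\<And>i. bounded_linear (L' i)"
    and W: "weak_op L A b" and W': "weak_op L' b c"
  shows "b \<in> L2w \<gamma>" "c \<in> L2w \<gamma>"
proof -
  obtain D D2 where D: "\<And>i. has_weak_partial i A (D i)" "\<And>i. D i \<in> L2w \<gamma>"
    "\<And>i j. has_weak_partial j (D i) (D2 i j)" "\<And>i j. D2 i j \<in> L2w \<gamma>"
    using A unfolding H2_weighted_def sobolev2_def by blast
  have loc: "locally_integrable b" "locally_integrable c" using W W' unfolding weak_op_def by auto
  have W0: "weak_op L A (\<lambda>x. \<Sum>i\<in>UNIV. L i (D i x))" by (rule weak_op_of_partials[OF D(1) L])
  have eq: "AE x in lebesgue. b x = (\<Sum>i\<in>UNIV. L i (D i x))" by (rule weak_op_unique[OF W W0])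
  have "(\<lambda>x. \<Sum>i\<in>UNIV. L i (D i x)) \<in> L2w \<gamma>"
    by (rule L2w_sum) (rule L2w_bounded_linear[OF D(2) L])
  then show "b \<in> L2w \<gamma>" by (rule L2w_cong_AE[OF _ eq locally_integrable_measurable[OF loc(1)]])
  define E where "E j x = (\<Sum>i\<in>UNIV. L i (D2 i j x))" for j x
  have E: "has_weak_partial j b (E j)" for j
  proof -
    have locD: "locally_integrable (D i)" "locally_integrable (D2 i j)" for i
      using D(3)[of j i] unfolding has_weak_partial_def by auto
    have locL: "locally_integrable (\<lambda>x. L i (D i x))" "locally_integrable (\<lambda>x. L i (D2 i j x))" for i
      by (rule locally_integrable_bounded_linear[OF locD(1) L], rule locally_integrable_bounded_linear[OF locD(2) L])
    have "weak_op (partial_symbol j) (\<lambda>x. \<Sum>i\<in>UNIV. L i (D i x)) (E j)"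
      unfolding weak_op_partial[symmetric] has_weak_partial_def E_def[abs_def]
    proof (intro conjI allI impI locally_integrable_sum locL)
      fix \<phi> :: "real^3 \<Rightarrow> real" assume \<phi>: "test_function \<phi>"
      have s: "(LINT x|lebesgue. \<psi> x *\<^sub>R (\<Sum>i\<in>UNIV. L i (H i x))) = (\<Sum>i\<in>UNIV. L i (LINT x|lebesgue. \<psi> x *\<^sub>R H i x))"
        if \<psi>: "test_function \<psi>" and H: "\<And>i. locally_integrable (H i)" for \<psi> and H :: "3 \<Rightarrow> real^3 \<Rightarrow> 'b"
      proof -
        have "(LINT x|lebesgue. \<psi> x *\<^sub>R (\<Sum>i\<in>UNIV. L i (H i x))) = (\<Sum>i\<in>UNIV. LINT x|lebesgue. \<psi> x *\<^sub>R L i (H i x))"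
          unfolding scaleR_sum_right
          by (rule Bochner_Integration.integral_sum)
            (rule test_function_mult_integrable[OF locally_integrable_bounded_linear[OF H L] \<psi>])
        also have "\<dots> = (\<Sum>i\<in>UNIV. L i (LINT x|lebesgue. \<psi> x *\<^sub>R H i x))"
          unfolding linear_scale[OF bounded_linear.linear[OF L], symmetric]
          by (rule sum.cong[OF refl], rule integral_bounded_linear[OF L test_function_mult_integrable[OF H \<psi>]])
        finally show ?thesis .
      qed
      have "(LINT x|lebesgue. \<phi> x *\<^sub>R D2 i j x) = - (LINT x|lebesgue. partial_derivative j \<phi> x *\<^sub>R D i x)" for i
        using D(3)[of j i] \<phi> unfolding has_weak_partial_def by blast
      then show "(LINT x|lebesgue. \<phi> x *\<^sub>R (\<Sum>i\<in>UNIV. L i (D2 i j x))) =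
          - (LINT x|lebesgue. partial_derivative j \<phi> x *\<^sub>R (\<Sum>i\<in>UNIV. L i (D i x)))"
        unfolding s[OF \<phi> locD(2)] s[OF test_function_partial[OF \<phi>] locD(1)]
        by (simp add: linear_neg[OF bounded_linear.linear[OF L]] sum_negf)
    qed
    from weak_op_cong_AE[OF this bounded_linear_symbols(4) eq loc(1)] show ?thesis
      unfolding weak_op_partial .
  qed
  have EL: "E j \<in> L2w \<gamma>" for j
    unfolding E_def[abs_def] by (rule L2w_sum) (rule L2w_bounded_linear[OF D(4) L])
  have eq': "AE x in lebesgue. c x = (\<Sum>j\<in>UNIV. L' j (E j x))"
    by (rule weak_op_unique[OF W' weak_op_of_partials[OF E L']])
  have "(\<lambda>x. \<Sum>j\<in>UNIV. L' j (E j x)) \<in> L2w \<gamma>"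
    by (rule L2w_sum) (rule L2w_bounded_linear[OF EL L'])
  then show "c \<in> L2w \<gamma>" by (rule L2w_cong_AE[OF _ eq' locally_integrable_measurable[OF loc(2)]])
qed

text \<open>The \<open>i\<close>-th coordinate is a left inverse of scaling the \<open>i\<close>-th
  axis vector, so both integrals exist together, and no integrability has to be assumed.\<close>

lemma kernel_op_grad_symbol:
  "kernel_op k (\<lambda>y. f y *\<^sub>R axis i 1 :: real^3) x = kernel_op k f x *\<^sub>R axis i 1"
proof -
  have "(LINT y|lebesgue. (k (x - y) * f y) *\<^sub>R (axis i 1 :: real^3)) = (LINT y|lebesgue. k (x - y) * f y) *\<^sub>R axis i 1"
    by (rule integral_bounded_linear'[OF bounded_linear_scaleR_left bounded_linear_vec_nth[of i]]) (simp add: axis_def)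
  then show ?thesis by (simp add: kernel_op_def)
qed

text \<open>Fubini moves the odd kernel \<open>fund_grad\<close> from \<open>f\<close> to \<open>F\<close>.\<close>

lemma fund_grad_antisymmetric:
  fixes f F :: "real^3 \<Rightarrow> real"
  assumes f: "f \<in> L2w \<gamma>" "\<gamma> > 2"
    and F: "F \<in> borel_measurable lebesgue" "integrable lebesgue (\<lambda>y. (norm (F y))\<^sup>2)"
  shows "(LINT x|lebesgue. kernel_op (\<lambda>z. fund_grad z $ i) f x * F x) =
      - (LINT y|lebesgue. f y * kernel_op (\<lambda>z. fund_grad z $ i) F y)"
    and "integrable lebesgue (\<lambda>x. kernel_op (\<lambda>z. fund_grad z $ i) f x * F x)"
    and "integrable lebesgue (\<lambda>y. f y * kernel_op (\<lambda>z. fund_grad z $ i) F y)"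
proof -
  let ?k = "\<lambda>z. fund_grad z $ i"
  let ?g = "\<lambda>x y. F x * (?k (x - y) * f y)"
  note mf = L2w_D(1)[OF f(1)]
  have meas: "(\<lambda>(x, y). ?g x y) \<in> borel_measurable (lebesgue \<Otimes>\<^sub>M lebesgue)"
    using borel_measurable_times[OF measurable_compose[OF measurable_fst F(1)]
        kernel_integrand_measurable[OF borel_measurable_fund_grad_nth mf]]
    by (simp add: case_prod_beta)
  \<comment> \<open>The double integral is dominated by the integral of \<open>|F| * ?T\<close>,
    where both factors are square-integrable: \<open>F\<close> by assumption, \<open>?T\<close> by
    the Stein-Weiss estimate.\<close>
  let ?T = "\<lambda>x. \<integral>\<^sup>+y. ennreal (norm (x - y) powr - 2 * norm (f y)) \<partial>lebesgue"
  have T: "(\<integral>\<^sup>+x. (?T x)\<^sup>2 \<partial>lebesgue) < \<infinity>"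
    by (rule Stein_Weiss[OF mf L2w_fin[OF f]])
  have Fm: "(\<lambda>x. (ennreal \<bar>F x\<bar>)\<^sup>2) \<in> borel_measurable lebesgue"
    using measurable_compose[OF norm_square_measurable[OF F(1)] measurable_ennreal]
    by (simp add: ennreal_power)
  have "(\<integral>\<^sup>+x. \<integral>\<^sup>+y. ennreal (norm (?g x y)) \<partial>lebesgue \<partial>lebesgue) \<le>
      (\<integral>\<^sup>+x. (ennreal \<bar>F x\<bar>)\<^sup>2 + (?T x)\<^sup>2 \<partial>lebesgue)"
  proof (rule nn_integral_mono)
    fix x
    have "(\<integral>\<^sup>+y. ennreal (norm (?g x y)) \<partial>lebesgue) \<le>
        (\<integral>\<^sup>+y. ennreal \<bar>F x\<bar> * ennreal (norm (x - y) powr - 2 * norm (f y)) \<partial>lebesgue)"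
    proof (rule nn_integral_mono)
      fix y
      have "norm (?g x y) \<le> \<bar>F x\<bar> * (norm (x - y) powr - 2 * norm (f y))"
        unfolding real_norm_def abs_mult by (intro mult_left_mono mult_right_mono fund_grad_le) auto
      then show "ennreal (norm (?g x y)) \<le> ennreal \<bar>F x\<bar> * ennreal (norm (x - y) powr - 2 * norm (f y))"
        by (subst ennreal_mult[symmetric]) (auto intro: ennreal_leI)
    qed
    also have "\<dots> = ennreal \<bar>F x\<bar> * ?T x"
    proof (rule nn_integral_cmult)
      have "(\<lambda>y::real^3. norm (x - y) powr - 2) \<in> borel_measurable lebesgue"
        by (rule lebesgue_measurable_borel) measurable
      then show "(\<lambda>y. ennreal (norm (x - y) powr - 2 * norm (f y))) \<in> borel_measurable lebesgue"
        by (intro measurable_compose[OF borel_measurable_times[OF _ measurable_compose[OF mf borel_measurable_norm]] measurable_ennreal])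
    qed
    \<comment> \<open>The factor 2 prepares for \<open>2 a b \<le> a^2 + b^2\<close>.\<close>
    also have "\<dots> \<le> 2 * ennreal \<bar>F x\<bar> * ?T x"
      using mult_right_mono[of "1::ennreal" 2 "ennreal \<bar>F x\<bar> * ?T x"] by (simp add: mult.assoc)
    also have "\<dots> \<le> (ennreal \<bar>F x\<bar>)\<^sup>2 + (?T x)\<^sup>2" by (rule sum_of_squares_ge_ennreal)
    finally show "(\<integral>\<^sup>+y. ennreal (norm (?g x y)) \<partial>lebesgue) \<le> (ennreal \<bar>F x\<bar>)\<^sup>2 + (?T x)\<^sup>2" .
  qed
  also have "\<dots> = (\<integral>\<^sup>+x. (ennreal \<bar>F x\<bar>)\<^sup>2 \<partial>lebesgue) + (\<integral>\<^sup>+x. (?T x)\<^sup>2 \<partial>lebesgue)"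
  proof (rule nn_integral_add[OF Fm])
    have "(\<lambda>p::(real^3)\<times>(real^3). norm (fst p - snd p) powr - 2) \<in> borel_measurable (lebesgue \<Otimes>\<^sub>M lebesgue)"
      by (rule borel_pair_lebesgue) measurable
    then have "(\<lambda>p. ennreal (norm (fst p - snd p) powr - 2 * norm (f (snd p)))) \<in> borel_measurable (lebesgue \<Otimes>\<^sub>M lebesgue)"
      by (intro measurable_compose[OF borel_measurable_times[OF _ measurable_compose[OF measurable_compose[OF
          measurable_snd mf] borel_measurable_norm]] measurable_ennreal])
    from sigma_finite_measure.borel_measurable_nn_integral_fst[OF sigma_finite_lebesgue this]
    have "?T \<in> borel_measurable lebesgue" by simp
    then show "(\<lambda>x. (?T x)\<^sup>2) \<in> borel_measurable lebesgue"
      unfolding power2_eq_square by (intro borel_measurable_times_ennreal)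
  qed
  also have "\<dots> < \<infinity>"
    using T F(2) unfolding integrable_iff_bounded by (simp add: ennreal_power)
  finally have fin: "(\<integral>\<^sup>+x. \<integral>\<^sup>+y. ennreal (norm (?g x y)) \<partial>lebesgue \<partial>lebesgue) < \<infinity>" .
  have e1: "(LINT y|lebesgue. ?g x y) = kernel_op ?k f x * F x" for x
    by (simp add: kernel_op_def mult.commute)
  have e2: "(LINT x|lebesgue. ?g x y) = - (f y * kernel_op ?k F y)" for y
  proof -
    have "(\<lambda>x. ?g x y) = (\<lambda>x. - f y * (?k (y - x) * F x))"
      using fund_grad_minus[of "y - _"] by (auto simp: fun_eq_iff)
    then show ?thesis by (simp add: kernel_op_def)
  qed
  show "integrable lebesgue (\<lambda>x. kernel_op ?k f x * F x)"
    using Fubini_lebesgue(2)[OF meas fin] by (simp only: e1)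
  show "integrable lebesgue (\<lambda>y. f y * kernel_op ?k F y)"
    using Fubini_lebesgue(3)[OF meas fin] unfolding e2 by simp
  show "(LINT x|lebesgue. kernel_op ?k f x * F x) = - (LINT y|lebesgue. f y * kernel_op ?k F y)"
    using Fubini_lebesgue(1)[OF meas fin] unfolding e1 e2 by simp
qed

lemma gradient_orthogonal_div_free:
  fixes F :: "real^3 \<Rightarrow> real^3"
  assumes f: "f \<in> L2w \<gamma>" "\<gamma> > 2"
    and F: "F \<in> borel_measurable lebesgue" "integrable lebesgue (\<lambda>y. (norm (F y))\<^sup>2)"
    and d: "weak_op div_symbol F (\<lambda>x. 0)"
  shows "integrable lebesgue (\<lambda>x. (\<Sum>i\<in>UNIV. kernel_op (\<lambda>z. fund_grad z $ i) (\<lambda>y. grad_symbol i (f y)) x) \<bullet> F x)"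
    and "(LINT x|lebesgue. (\<Sum>i\<in>UNIV. kernel_op (\<lambda>z. fund_grad z $ i) (\<lambda>y. grad_symbol i (f y)) x) \<bullet> F x) = 0"
proof -
  let ?k = "\<lambda>i z. fund_grad z $ i"
  note anti = fund_grad_antisymmetric[OF f L2_component[OF F]]
  have e: "(\<Sum>i\<in>UNIV. kernel_op (?k i) (\<lambda>y. grad_symbol i (f y)) x) \<bullet> F x = (\<Sum>i\<in>UNIV. kernel_op (?k i) f x * (F x $ i))" for x
    by (simp add: kernel_op_grad_symbol inner_sum_left inner_axis')
  show "integrable lebesgue (\<lambda>x. (\<Sum>i\<in>UNIV. kernel_op (?k i) (\<lambda>y. grad_symbol i (f y)) x) \<bullet> F x)"
    unfolding e by (rule Bochner_Integration.integrable_sum) (rule anti(2))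
  have "(LINT x|lebesgue. (\<Sum>i\<in>UNIV. kernel_op (?k i) (\<lambda>y. grad_symbol i (f y)) x) \<bullet> F x) =
      (\<Sum>i\<in>UNIV. LINT x|lebesgue. kernel_op (?k i) f x * (F x $ i))"
    unfolding e by (rule Bochner_Integration.integral_sum) (rule anti(2))
  also have "\<dots> = - (\<Sum>i\<in>UNIV. LINT y|lebesgue. f y * kernel_op (?k i) (\<lambda>x. F x $ i) y)"
    by (simp only: anti(1) sum_negf)
  also have "(\<Sum>i\<in>UNIV. LINT y|lebesgue. f y * kernel_op (?k i) (\<lambda>x. F x $ i) y) =
      (LINT y|lebesgue. (\<Sum>i\<in>UNIV. f y * kernel_op (?k i) (\<lambda>x. F x $ i) y))"
    by (rule Bochner_Integration.integral_sum[symmetric]) (rule anti(3))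
  also have "\<dots> = 0"
    by (rule integral_eq_zero_AE, rule eventually_mono[OF div_free_fund_grad[OF F d]])
      (simp flip: sum_distrib_left)
  finally show "(LINT x|lebesgue. (\<Sum>i\<in>UNIV. kernel_op (?k i) (\<lambda>y. grad_symbol i (f y)) x) \<bullet> F x) = 0"
    by simp
qed

text \<open>Young's inequality bounds the potential by \<open>d * I\<close> plus a multiple of
  \<open>|x|^(-1/2) / d\<close>. The first term is made small by the choice of \<open>d\<close>,
  uniformly in \<open>x\<close>; for that fixed \<open>d\<close> the second tends to 0.\<close>

lemma newton_vanishes:
  fixes f :: "real^3 \<Rightarrow> real"
  assumes f: "f \<in> L2w \<gamma>" "\<gamma> > 2"
  shows "vanishes_at_infinity (\<lambda>x. - kernel_op fund f x)"
  unfolding vanishes_at_infinity_def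
proof (intro allI impI)
  fix \<epsilon> :: real assume \<epsilon>: "\<epsilon> > 0"
  define I where "I = (LINT y|lebesgue. weight \<gamma> y * (norm (f y))\<^sup>2)"
  have I: "I \<ge> 0" unfolding I_def by (intro integral_nonneg_AE always_eventually allI mult_nonneg_nonneg less_imp_le[OF weight_pos]) auto
  obtain C where C: "C > 0" "\<And>x::real^3. x \<noteq> 0 \<Longrightarrow>
      (\<integral>\<^sup>+y. ennreal (norm (x - y) powr - 2 / weight \<gamma> y) \<partial>lborel) \<le> ennreal (C * norm x powr (- 1 / 2))"
    using inverse_weight_kernel(2)[OF f(2)] by blast
  \<comment> \<open>\<open>I + 1\<close> instead of \<open>I\<close>, so that \<open>d\<close> is
    defined and positive also for \<open>f = 0\<close>.\<close>
  define d where "d = \<epsilon> / (2 * (I + 1))"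
  have d: "d > 0" using \<epsilon> I by (simp add: d_def)
  have dI: "d * I \<le> \<epsilon> / 2" using \<epsilon> I by (simp add: d_def field_simps)
  have "((\<lambda>r. C * r powr (- 1 / 2) / d) \<longlongrightarrow> C * 0 / d) at_top"
    by (intro tendsto_divide tendsto_mult tendsto_const tendsto_neg_powr filterlim_ident) (use d in auto)
  then have "\<forall>\<^sub>F r in at_top. C * r powr (- 1 / 2) / d < \<epsilon> / 2"
    using \<epsilon> by (intro order_tendstoD(2)) auto
  then obtain R where R: "\<And>r. r \<ge> R \<Longrightarrow> C * r powr (- 1 / 2) / d < \<epsilon> / 2"
    unfolding eventually_at_top_linorder by blast
  have "\<bar>- kernel_op fund f x\<bar> < \<epsilon>" if x: "norm x \<ge> max R 1" for x
  proof -
    have "x \<noteq> 0" using x by auto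
    let ?N = "\<integral>\<^sup>+y. ennreal ((fund (x - y))\<^sup>2 / weight \<gamma> y) \<partial>lborel"
    have b: "(\<lambda>y. fund (x - y)) \<in> borel_measurable borel" by measurable
    have "\<bar>- kernel_op fund f x\<bar> = \<bar>LINT y|lebesgue. fund (x - y) * f y\<bar>" by (simp add: kernel_op_def)
    also have "\<dots> \<le> (LINT y|lebesgue. \<bar>fund (x - y) * f y\<bar>)" by (rule integral_abs_bound)
    also have "\<dots> = (LINT y|lebesgue. \<bar>fund (x - y)\<bar> * norm (f y))" by (simp add: abs_mult)
    also have "\<dots> \<le> d * I + enn2real ?N / d"
      unfolding I_def
      by (rule weighted_Cauchy_Schwarz(2)[OF L2w_D[OF f(1)] weight_borel weight_pos b fund_weight_fin(1)[OF f(2)] d])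
    also have "enn2real ?N / d \<le> C * norm x powr (- 1 / 2) / d"
    proof (rule divide_right_mono)
      have "?N \<le> ennreal (C * norm x powr (- 1 / 2))"
        using fund_weight_fin(2)[OF f(2), of x] C(2)[OF \<open>x \<noteq> 0\<close>] by (rule order_trans)
      then show "enn2real ?N \<le> C * norm x powr (- 1 / 2)"
        using C(1) by (intro enn2real_leI) auto
    qed (use d in simp)
    also have "\<dots> < \<epsilon> / 2" using R[of "norm x"] x by simp
    finally show ?thesis using dI by linarith
  qed
  then show "\<exists>R. AE x in lebesgue. R \<le> norm x \<longrightarrow> \<bar>- kernel_op fund f x\<bar> < \<epsilon>"
    by (intro exI[of _ "max R 1"] always_eventually) blast
qed

text \<open>If \<open>c\<close> were nonzero, then \<open>|c| \<le> |u| + |u'| < |c|\<close> almost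
  everywhere outside some ball. The complement of a ball has infinite measure, so it is not a null
  set.\<close>

lemma vanishes_at_infinity_constant:
  assumes u: "vanishes_at_infinity u" and u': "vanishes_at_infinity u'"
    and eq: "AE x in lebesgue. u' x = u x + c"
  shows "c = 0"
proof (rule ccontr)
  assume "c \<noteq> 0"
  then have "\<bar>c\<bar> / 2 > 0" by simp
  then obtain R where R: "AE x in lebesgue. norm x \<ge> R \<longrightarrow> \<bar>u x\<bar> < \<bar>c\<bar> / 2"
    using u unfolding vanishes_at_infinity_def by blast
  obtain R' where R': "AE x in lebesgue. norm x \<ge> R' \<longrightarrow> \<bar>u' x\<bar> < \<bar>c\<bar> / 2"
    using u' \<open>\<bar>c\<bar> / 2 > 0\<close> unfolding vanishes_at_infinity_def by blast
  have "AE x in lebesgue. \<not> norm (x::real^3) \<ge> max R R'"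
  proof (rule eventually_mono[OF eventually_conj[OF eq eventually_conj[OF R R']]])
    fix x :: "real^3"
    assume "u' x = u x + c \<and> (R \<le> norm x \<longrightarrow> \<bar>u x\<bar> < \<bar>c\<bar> / 2) \<and> (R' \<le> norm x \<longrightarrow> \<bar>u' x\<bar> < \<bar>c\<bar> / 2)"
    then have h: "u' x = u x + c" "norm x \<ge> R \<Longrightarrow> \<bar>u x\<bar> < \<bar>c\<bar> / 2" "norm x \<ge> R' \<Longrightarrow> \<bar>u' x\<bar> < \<bar>c\<bar> / 2"
      by auto
    show "\<not> norm x \<ge> max R R'"
    proof
      assume "norm x \<ge> max R R'"
      with h(2,3) have "\<bar>u x\<bar> < \<bar>c\<bar> / 2" "\<bar>u x + c\<bar> < \<bar>c\<bar> / 2" unfolding h(1) by auto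
      then show False by linarith
    qed
  qed
  then have "AE x in lebesgue. x \<in> ball (0::real^3) (max R R')"
    by (rule eventually_mono) (simp only: mem_ball_0 not_le)
  then have "emeasure lebesgue (- ball (0::real^3) (max R R')) = 0"
    by (subst (asm) AE_iff_measurable[OF _ refl]) (auto simp: Compl_eq)
  moreover have "emeasure lebesgue (- ball (0::real^3) (max R R')) = \<infinity>"
  proof -
    have "emeasure lebesgue (UNIV :: (real^3) set) \<le>
        emeasure lebesgue (- ball (0::real^3) (max R R')) + emeasure lebesgue (ball (0::real^3) (max R R'))"
      using emeasure_subadditive[of "- ball (0::real^3) (max R R')" lebesgue "ball (0::real^3) (max R R')"] by simp
    then show ?thesis
      using emeasure_lborel_ball_finite[of "0::real^3" "max R R'"] by (auto simp: top_unique)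
  qed
  ultimately show False by simp
qed

lemma L2_diff:
  fixes F G :: "real^3 \<Rightarrow> 'b::euclidean_space"
  assumes F: "F \<in> borel_measurable lebesgue" "integrable lebesgue (\<lambda>y. (norm (F y))\<^sup>2)"
    and G: "G \<in> borel_measurable lebesgue" "integrable lebesgue (\<lambda>y. (norm (G y))\<^sup>2)"
  shows "(\<lambda>y. F y - G y) \<in> borel_measurable lebesgue" "integrable lebesgue (\<lambda>y. (norm (F y - G y))\<^sup>2)"
proof -
  have m: "(\<lambda>y. - G y) \<in> borel_measurable lebesgue" using G(1) by simp
  show "(\<lambda>y. F y - G y) \<in> borel_measurable lebesgue" by (intro borel_measurable_diff F G)
  show "integrable lebesgue (\<lambda>y. (norm (F y - G y))\<^sup>2)"
    using L2_add[OF F m] G(2) by simp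
qed

lemma weak_gradient_AE_0_imp_constant:
  assumes W: "weak_op grad_symbol v H" and H: "AE x in lebesgue. H x = 0"
  shows "\<exists>c. AE x in lebesgue. v x = c"
proof (rule weak_gradient_0_imp_constant)
  show v: "locally_integrable v" using W by (simp add: weak_op_def)
  have locH: "locally_integrable H" using W by (simp add: weak_op_def)
  fix \<phi> :: "real^3 \<Rightarrow> real" and j assume \<phi>: "test_function \<phi>"
  have "(LINT x|lebesgue. \<phi> x *\<^sub>R H x) = 0"
    by (rule integral_eq_zero_AE) (rule eventually_mono[OF H], simp)
  then have "(LINT x|lebesgue. (\<Sum>i\<in>UNIV. partial_derivative i \<phi> x *\<^sub>R grad_symbol i (v x))) = 0"
    using W \<phi> unfolding weak_op_def by simp
  then have "0 = (\<Sum>i\<in>UNIV. LINT x|lebesgue. partial_derivative i \<phi> x *\<^sub>R grad_symbol i (v x)) $ j"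
    by (subst Bochner_Integration.integral_sum[symmetric])
      (simp_all only: test_op_integrable[OF v bounded_linear_symbols(1) \<phi>] zero_index)
  also have "\<dots> = (\<Sum>i\<in>UNIV. (LINT x|lebesgue. partial_derivative i \<phi> x * v x) *\<^sub>R axis i (1::real)) $ j"
  proof -
    have "(LINT x|lebesgue. partial_derivative i \<phi> x *\<^sub>R grad_symbol i (v x)) =
        (LINT x|lebesgue. partial_derivative i \<phi> x * v x) *\<^sub>R axis i 1" for i
      using integral_scaleR_left[of "axis i (1::real) :: real^3" lebesgue "\<lambda>x. partial_derivative i \<phi> x * v x"]
        test_function_mult_integrable[OF v test_function_partial[OF \<phi>], of i] by simp
    then show ?thesis by simp
  qed
  also have "\<dots> = (LINT x|lebesgue. partial_derivative j \<phi> x * v x)"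
    by (simp add: axis_def if_distrib[where f = "\<lambda>t. _ * t"] cong: if_cong)
  finally show "(LINT x|lebesgue. partial_derivative j \<phi> x * v x) = 0" by simp
qed

theorem theorem3p1:
  fixes A a curl_a grad_f V :: "real^3 \<Rightarrow> real^3" and f u :: "real^3 \<Rightarrow> real" and \<gamma> :: real
  assumes "\<gamma> > 2"
    and "A \<in> H2_loc"
    and "A \<in> H2_weighted (\<lambda>x. 1 + norm x powr \<gamma>)"
    and "has_weak_curl A a" and "has_weak_divergence A f"
    and "has_weak_curl a curl_a" and "has_weak_gradient f grad_f"
    and "u = (\<lambda>x. - (LINT y|lebesgue. newton_kernel x y * f y))"
    and "V = (\<lambda>x. LINT y|lebesgue. newton_kernel x y *\<^sub>R a y)"
  shows
    "(\<forall>x. integrable lebesgue (\<lambda>y. newton_kernel x y *\<^sub>R curl_a y) \<and>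
          integrable lebesgue (\<lambda>y. newton_kernel x y *\<^sub>R grad_f y) \<and>
          integrable lebesgue (\<lambda>y. newton_kernel x y * f y) \<and>
          integrable lebesgue (\<lambda>y. newton_kernel x y *\<^sub>R a y)) \<and>
     (AE x in lebesgue.
        A x = (LINT y|lebesgue. newton_kernel x y *\<^sub>R curl_a y)
              - (LINT y|lebesgue. newton_kernel x y *\<^sub>R grad_f y)) \<and>
     (\<forall>A'. A' \<in> H2_loc \<and> A' \<in> H2_weighted (\<lambda>x. 1 + norm x powr \<gamma>) \<and>
           has_weak_curl A' a \<and> has_weak_divergence A' f \<longrightarrow>
           (AE x in lebesgue. A' x = A x)) \<and>
     (\<exists>G B. has_weak_curl V B \<and> helmholtz_decomposition A u G B \<and>
        vanishes_at_infinity u \<and>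
        (\<forall>u' G' B'. helmholtz_decomposition A u' G' B' \<longrightarrow>
           (AE x in lebesgue. G' x = G x) \<and> (AE x in lebesgue. B' x = B x) \<and>
           (\<exists>c. AE x in lebesgue. u' x = u x + c) \<and>
           (vanishes_at_infinity u' \<longrightarrow> (AE x in lebesgue. u' x = u x))))"
proof -
  note \<gamma> = assms(1)
  have H2: "A \<in> H2_weighted (weight \<gamma>)" using assms(3) by simp
  have W: "weak_op curl_symbol A a" "weak_op div_symbol A f" "weak_op curl_symbol a curl_a" "weak_op grad_symbol f grad_f"
    using assms(4-7) by (simp_all only: weak_op_curl weak_op_divergence weak_op_gradient)
  have A: "A \<in> L2w \<gamma>" using H2 by (simp add: H2_weighted_def sobolev2_def)
  have a: "a \<in> L2w \<gamma>" and ca: "curl_a \<in> L2w \<gamma>"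
    using H2_weighted_weak_op[OF H2 bounded_linear_symbols(3) bounded_linear_symbols(3) W(1,3)] .
  have f: "f \<in> L2w \<gamma>" and gf: "grad_f \<in> L2w \<gamma>"
    using H2_weighted_weak_op[OF H2 bounded_linear_symbols(2) bounded_linear_symbols(1) W(2,4)] .
  have nk: "(\<lambda>x. LINT y|lebesgue. newton_kernel x y *\<^sub>R F y) = kernel_op fund F" for F :: "real^3 \<Rightarrow> 'b::euclidean_space"
    by (simp add: kernel_op_def[abs_def] newton_kernel_fund)
  have u: "u = (\<lambda>x. - kernel_op fund f x)"
    unfolding assms(8) by (simp add: kernel_op_def newton_kernel_fund)
  have V: "V = kernel_op fund a" unfolding assms(9) by (rule nk)
  have ints: "\<forall>x. integrable lebesgue (\<lambda>y. newton_kernel x y *\<^sub>R curl_a y) \<and>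
          integrable lebesgue (\<lambda>y. newton_kernel x y *\<^sub>R grad_f y) \<and>
          integrable lebesgue (\<lambda>y. newton_kernel x y * f y) \<and>
          integrable lebesgue (\<lambda>y. newton_kernel x y *\<^sub>R a y)"
    unfolding newton_kernel_fund
    using L2w_fund_integrable[OF ca \<gamma>] L2w_fund_integrable[OF gf \<gamma>] L2w_fund_integrable[OF f \<gamma>]
      L2w_fund_integrable[OF a \<gamma>] by simp
  have rep: "AE x in lebesgue. A' x = kernel_op fund curl_a x - kernel_op fund grad_f x"
    if "A' \<in> L2w \<gamma>" "weak_op curl_symbol A' a" "weak_op div_symbol A' f" for A'
    by (rule newton_representation[OF \<gamma> that(1) a ca gf f that(2,3) W(3,4)])
  note repA = rep[OF A W(1,2)]
  have unique: "AE x in lebesgue. A' x = A x"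
    if "A' \<in> H2_weighted (weight \<gamma>)" "has_weak_curl A' a" "has_weak_divergence A' f" for A'
  proof -
    have "A' \<in> L2w \<gamma>" using that(1) by (simp add: H2_weighted_def sobolev2_def)
    from rep[OF this] that(2,3) have "AE x in lebesgue. A' x = kernel_op fund curl_a x - kernel_op fund grad_f x"
      by (simp only: weak_op_curl weak_op_divergence)
    with repA show ?thesis by eventually_elim simp
  qed
  \<comment> \<open>The gradient and the curl of the potentials, with the derivative on the kernel.
    This is the form to which the Stein-Weiss estimate applies; it makes \<open>G\<close> and
    \<open>B\<close> square-integrable.\<close>
  define G0 where "G0 x = (\<Sum>i\<in>UNIV. kernel_op (\<lambda>z. fund_grad z $ i) (\<lambda>y. grad_symbol i (f y)) x)" for x
  define G where "G x = - G0 x" for x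
  define B where "B x = (\<Sum>i\<in>UNIV. kernel_op (\<lambda>z. fund_grad z $ i) (\<lambda>y. curl_symbol i (a y)) x)" for x
  have WG0: "weak_op grad_symbol (kernel_op fund f) G0"
    unfolding G0_def[abs_def] by (rule weak_op_kernel(1)[OF bounded_linear_symbols(1) f \<gamma>])
  have WG: "weak_op grad_symbol u G"
    unfolding u G_def[abs_def] by (rule weak_op_minus[OF WG0 bounded_linear_symbols(1)])
  have WB: "weak_op curl_symbol V B"
    unfolding V B_def[abs_def] by (rule weak_op_kernel(1)[OF bounded_linear_symbols(3) a \<gamma>])
  have dB: "weak_op div_symbol B (\<lambda>x. 0)" by (rule weak_divergence_curl[OF WB])
  have L2_op: "(\<lambda>x. \<Sum>i\<in>UNIV. kernel_op (\<lambda>z. fund_grad z $ i) (F i) x) \<in> borel_measurable lebesgue"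
    "integrable lebesgue (\<lambda>x. (norm (\<Sum>i\<in>UNIV. kernel_op (\<lambda>z. fund_grad z $ i) (F i) x))\<^sup>2)"
    if F: "\<And>i. F i \<in> L2w \<gamma>" for F :: "3 \<Rightarrow> real^3 \<Rightarrow> real^3"
  proof -
    have m: "kernel_op (\<lambda>z. fund_grad z $ i) (F i) \<in> borel_measurable lebesgue" for i
      by (rule kernel_op_measurable[OF borel_measurable_fund_grad_nth L2w_D(1)[OF F]])
    then show "(\<lambda>x. \<Sum>i\<in>UNIV. kernel_op (\<lambda>z. fund_grad z $ i) (F i) x) \<in> borel_measurable lebesgue"
      by (intro borel_measurable_sum)
    show "integrable lebesgue (\<lambda>x. (norm (\<Sum>i\<in>UNIV. kernel_op (\<lambda>z. fund_grad z $ i) (F i) x))\<^sup>2)"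
      by (rule L2_sum[OF m L2_kernel_op[OF L2w_D(1)[OF F] L2w_fin[OF F \<gamma>] borel_measurable_fund_grad_nth fund_grad_le]])
  qed
  have B2: "B \<in> borel_measurable lebesgue" "integrable lebesgue (\<lambda>x. (norm (B x))\<^sup>2)"
    unfolding B_def[abs_def] by (rule L2_op, rule L2w_bounded_linear[OF a bounded_linear_symbols(3)])+
  have G02: "G0 \<in> borel_measurable lebesgue" "integrable lebesgue (\<lambda>x. (norm (G0 x))\<^sup>2)"
    unfolding G0_def[abs_def] by (rule L2_op, rule L2w_bounded_linear[OF f bounded_linear_symbols(1)])+
  have G2: "G \<in> borel_measurable lebesgue" "integrable lebesgue (\<lambda>x. (norm (G x))\<^sup>2)"
    using G02 by (simp_all add: G_def[abs_def])
  have decomp: "AE x in lebesgue. A x = G x + B x"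
  proof -
    \<comment> \<open>The weak curl of \<open>V\<close> is known in two forms, with the derivative
      on the field and with the derivative on the kernel. The same comparison for \<open>f\<close>
      turns the integral formula for \<open>A\<close> into the decomposition.\<close>
    have "AE x in lebesgue. kernel_op fund curl_a x = B x"
      by (rule weak_op_unique[OF weak_op_newton[OF W(3) bounded_linear_symbols(3) a ca \<gamma>] WB[unfolded V]])
    moreover have "AE x in lebesgue. kernel_op fund grad_f x = G0 x"
      by (rule weak_op_unique[OF weak_op_newton[OF W(4) bounded_linear_symbols(1) f gf \<gamma>] WG0])
    ultimately show ?thesis using repA by eventually_elim (simp add: G_def)
  qed
  have orth: "integrable lebesgue (\<lambda>x. G x \<bullet> B x)" "(LINT x|lebesgue. G x \<bullet> B x) = 0"
    using gradient_orthogonal_div_free[OF f \<gamma> B2 dB] unfolding G_def G0_def[symmetric] by simp_all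
  have helm: "helmholtz_decomposition A u G B"
    unfolding helmholtz_decomposition_def weak_op_gradient weak_op_divergence
    using WG dB decomp orth by blast
  have van: "vanishes_at_infinity u" unfolding u by (rule newton_vanishes[OF f \<gamma>])
  have helm_unique: "(AE x in lebesgue. G' x = G x) \<and> (AE x in lebesgue. B' x = B x) \<and>
      (\<exists>c. AE x in lebesgue. u' x = u x + c) \<and>
      (vanishes_at_infinity u' \<longrightarrow> (AE x in lebesgue. u' x = u x))"
    if h: "helmholtz_decomposition A u' G' B'" for u' G' B'
  proof -
    have WG': "weak_op grad_symbol u' G'" and dB': "weak_op div_symbol B' (\<lambda>x. 0)"
      and eq: "AE x in lebesgue. A x = G' x + B' x" and iGB: "integrable lebesgue (\<lambda>x. G' x \<bullet> B' x)"
      using h unfolding helmholtz_decomposition_def weak_op_gradient weak_op_divergence by blast+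
    have G'm: "G' \<in> borel_measurable lebesgue" using WG' locally_integrable_measurable unfolding weak_op_def by blast
    \<comment> \<open>Square-integrability is not part of a decomposition. It follows from
      \<open>|G'|^2 \<le> |G'|^2 + |B'|^2 = |A|^2 - 2 G' \<bullet> B'\<close>, whose right side is
      integrable.\<close>
    have G'i: "integrable lebesgue (\<lambda>x. (norm (G' x))\<^sup>2)"
    proof (rule Bochner_Integration.integrable_bound)
      show "integrable lebesgue (\<lambda>x. (norm (A x))\<^sup>2 - 2 * (G' x \<bullet> B' x))"
        by (intro Bochner_Integration.integrable_diff integrable_mult_right iGB L2w_L2(2)[OF A \<gamma>])
      show "AE x in lebesgue. norm ((norm (G' x))\<^sup>2) \<le> norm ((norm (A x))\<^sup>2 - 2 * (G' x \<bullet> B' x))"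
        using eq
      proof eventually_elim
        case (elim x)
        have "(norm (A x))\<^sup>2 - 2 * (G' x \<bullet> B' x) = (norm (G' x))\<^sup>2 + (norm (B' x))\<^sup>2"
          unfolding elim power2_norm_eq_inner by (simp add: inner_add inner_commute)
        then show ?case by simp
      qed
    qed (rule norm_square_measurable[OF G'm])
    note H2 = L2_diff[OF G'm G'i G2]
    have WH: "weak_op grad_symbol (\<lambda>x. u' x - u x) (\<lambda>x. G' x - G x)"
      by (rule weak_op_diff[OF WG' WG bounded_linear_symbols(1)])
    \<comment> \<open>The difference \<open>G' - G\<close> is a gradient, hence curl-free, and
      equals \<open>B - B'\<close> almost everywhere, hence divergence-free. Being
      square-integrable, it vanishes.\<close>
    have "weak_op div_symbol (\<lambda>x. B x - B' x) (\<lambda>x. 0)"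
      using weak_op_diff[OF dB dB' bounded_linear_symbols(2)] by simp
    moreover have "AE x in lebesgue. G' x - G x = B x - B' x"
      using eq decomp by eventually_elim (simp add: algebra_simps)
    ultimately have dH: "weak_op div_symbol (\<lambda>x. G' x - G x) (\<lambda>x. 0)"
      by (rule weak_op_cong_AE[OF _ bounded_linear_symbols(2) _ L2_locally_integrable[OF H2]])
    have zero: "AE x in lebesgue. G' x - G x = 0"
      by (rule L2_curl_div_free[OF H2 weak_curl_gradient[OF WH] dH])
    have GG: "AE x in lebesgue. G' x = G x" using zero by eventually_elim simp
    moreover have "AE x in lebesgue. B' x = B x" using GG eq decomp by eventually_elim simp
    moreover obtain c where c: "AE x in lebesgue. u' x - u x = c"
      using weak_gradient_AE_0_imp_constant[OF WH zero] by blast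
    then have c': "AE x in lebesgue. u' x = u x + c" by eventually_elim simp
    moreover have "AE x in lebesgue. u' x = u x" if "vanishes_at_infinity u'"
      using vanishes_at_infinity_constant[OF van that c'] c' by simp
    ultimately show ?thesis by blast
  qed
  show ?thesis
  proof (intro conjI ints)
    show "AE x in lebesgue. A x = (LINT y|lebesgue. newton_kernel x y *\<^sub>R curl_a y)
              - (LINT y|lebesgue. newton_kernel x y *\<^sub>R grad_f y)"
      using repA by (simp add: kernel_op_def newton_kernel_fund)
    show "\<forall>A'. A' \<in> H2_loc \<and> A' \<in> H2_weighted (\<lambda>x. 1 + norm x powr \<gamma>) \<and>
           has_weak_curl A' a \<and> has_weak_divergence A' f \<longrightarrow> (AE x in lebesgue. A' x = A x)"
      using unique by blast
    show "\<exists>G B. has_weak_curl V B \<and> helmholtz_decomposition A u G B \<and>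
        vanishes_at_infinity u \<and>
        (\<forall>u' G' B'. helmholtz_decomposition A u' G' B' \<longrightarrow>
           (AE x in lebesgue. G' x = G x) \<and> (AE x in lebesgue. B' x = B x) \<and>
           (\<exists>c. AE x in lebesgue. u' x = u x + c) \<and>
           (vanishes_at_infinity u' \<longrightarrow> (AE x in lebesgue. u' x = u x)))"
      using WB[folded weak_op_curl] helm van helm_unique by blast
  qed
qed

end
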